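(* Let $\kappa$ be a regular uncountable cardinal, $\chi<\kappa$ an infinite regular cardinal such that $\kappa$ is $({<}\chi)$-closed, $\varsigma<\kappa$ an ordinal, and $\lambda<\kappa$ an infinite cardinal. Put $\mathcal S:=\{E^\kappa_{\ge\chi}\cap E^\kappa_{>\Lambda}\mid\Lambda<\lambda\}$. If $\mathrm P^\bullet(\kappa,\kappa,{}_\chi{\sqsubseteq},1,\mathcal S,2)$ holds, then there exists a normal, prolific, $\varsigma$-splitting, $\chi$-complete, rigid streamlined $\kappa$-Souslin tree $T$ such that, for every cardinal $\Lambda<\lambda$, there is no ascending path of width $\Lambda$ through $T$.
   Context: $\kappa$ is $({<}\chi)$-closed if $\lambda'^{<\chi}<\kappa$ for all $\lambda'<\kappa$. $E^\kappa_{\ge\chi}:=\{\alpha<\kappa\mid\mathrm{cf}(\alpha)\ge\chi\}$, $E^\kappa_{>\Lambda}:=\{\alpha<\kappa\mid\mathrm{cf}(\alpha)>\Lambda\}$. $H_\kappa$: sets of hereditary cardinality $<\kappa$. A streamlined tree is a set $T\subseteq{}^{<\kappa}H_\kappa$ closed under restrictions, ordered by $\subsetneq$; $T_\alpha:=T\cap{}^\alpha H_\kappa$. It is a streamlined $\kappa$-Souslin tree if $(T,\subsetneq)$ has height $\kappa$, levels of size $<\kappa$, and no branch or antichain of size $\kappa$. $T$ is normal if for $\alpha<\beta$ with $T_\beta\neq\emptyset$ every $s\in T_\alpha$ extends to some element of $T_\beta$; prolific if for all $\alpha<\kappa$, $t\in T_\alpha$, $\{t^\frown\langle i\rangle\mid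 i<\max\{\omega,\alpha\}\}\subseteq T_{\alpha+1}$; $\varsigma$-splitting if every node has at least $\varsigma$ immediate successors; $\chi$-complete if unions of $\subsetneq$-increasing sequences from $T$ of length $<\chi$ lie in $T$; rigid if the only bijection $\Phi:T\to T$ with ($x\subsetneq y\iff\Phi(x)\subsetneq\Phi(y)$) is the identity. An ascending path of width $\Lambda$ through $T$ is $\langle f_\alpha\mid\alpha<\kappa\rangle$ with $f_\alpha:\Lambda\to T_\alpha$ such that for all $\alpha<\beta<\kappa$ there are $i,j<\Lambda$ with $f_\alpha(i)\subsetneq f_\beta(j)$. Notation: $\mathrm{acc}(C):=\{\alpha\in C\mid\sup(C\cap\alpha)=\alpha>0\}$; $C(j)$ is the $j$-th element of $C$; $\mathrm{succ}_n(C):=\{C(j+1)\mid j<n,\ j+1<\mathrm{otp}(C)\}$; $\mathrm{acc}(\kappa)$: nonzero limit ordinals below $\kappa$. $\mathcal F(\kappa)$: functions $C$ whose domain $\partial C$ is a nonempty club subset of $\sup(\partial C)$ not containing its supremum, with values in $H_\kappa$; $\alpha_C:=\sup(\partial C)$. $C\,{}_\chi{\sqsubseteq}\,D$ iff ($C=D\restriction\alpha_C$ or $\mathrm{cf}(\alpha_C)<\chi$). For $B\subseteq\kappa$, $\Omega\subseteq H_\kappa$, $p\in H_{\kappa^+}$, $C\in\mathcal F(\kappa)$: $B(\Omega,p,C)$ is the set of $\beta\in B\cap\partial C$ for which some $\mathcal M\prec H_{\kappa^+}$ has $p\in\mathcal M$, $\mathcal M\cap\kappa=\beta$, $\mathcal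 M\cap\Omega=C(\beta)$. $\mathrm P^\bullet(\kappa,\mu,\mathcal R,\theta,\mathcal S,\nu)$ asserts the existence of $\langle\mathcal C_\alpha\mid\alpha<\kappa\rangle$ and a partition $\langle B_\iota\mid\iota<\kappa\rangle$ of $\kappa$ such that for every $\alpha\in\mathrm{acc}(\kappa)$: $\mathcal C_\alpha\subseteq\{C\in\mathcal F(\kappa)\mid\alpha_C=\alpha\}$, $0<|\mathcal C_\alpha|<\mu$, and for all $C\in\mathcal C_\alpha$, $\bar\alpha\in\mathrm{acc}(\partial C)$ there is $D\in\mathcal C_{\bar\alpha}$ with $D\,\mathcal R\,C$; and for every $\langle(\Omega_i,p_i,\iota_i)\mid i<\theta\rangle$ of elements of $\mathcal P(H_\kappa)\times H_{\kappa^+}\times\kappa$, every $S\in\mathcal S$ and every $n<\omega$, there are stationarily many $\alpha\in S$ with $|\mathcal C_\alpha|<\nu$ such that for all $C\in\mathcal C_\alpha$, $i<\min\{\alpha,\theta\}$: $\sup\{\gamma\in\partial C\mid\mathrm{succ}_n(\partial C\setminus\gamma)\subseteq B_{\iota_i}(\Omega_i,p_i,C)\}=\alpha$. *)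

theory Defs
  imports Main "HOL-Library.Equipollence" "HOL-Library.Disjoint_Sets"
begin

section \<open>Sets of hereditary cardinality at most that of a type\<close>

text \<open>
  A well-founded tree in which every node has at most \<open>|UNIV :: 'k set|\<close> children denotes a set:
  \<open>HNode f\<close> denotes the set whose elements are denoted by the trees \<open>f i\<close>.
  Identifying trees that denote the same set yields exactly the sets of hereditary
  cardinality at most \<open>|UNIV :: 'k set|\<close>; see the facts \<open>elts_inject\<close>, \<open>wf_elts\<close>, \<open>elts_lepoll\<close>
  and \<open>elts_set_of\<close> below, which characterize this structure up to isomorphism.
\<close>

datatype 'k htree = HEmpty | HNode "'k \<Rightarrow> 'k htree"

primrec kids :: "'k htree \<Rightarrow> 'k htree set" where
  "kids HEmpty = {}"
| "kids (HNode f) = range f"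

inductive heq :: "'k htree \<Rightarrow> 'k htree \<Rightarrow> bool" where
  heqI: "\<forall>x\<in>kids s. \<exists>y\<in>kids t. heq x y \<Longrightarrow> \<forall>y\<in>kids t. \<exists>x\<in>kids s. heq x y \<Longrightarrow> heq s t"

lemma heq_iff:
  "heq s t \<longleftrightarrow> (\<forall>x\<in>kids s. \<exists>y\<in>kids t. heq x y) \<and> (\<forall>y\<in>kids t. \<exists>x\<in>kids s. heq x y)"
  by (subst heq.simps) auto

lemma kids_induct: "(\<And>t. (\<And>x. x \<in> kids t \<Longrightarrow> P x) \<Longrightarrow> P t) \<Longrightarrow> P t"
proof (induction t)
  case HEmpty
  show ?case by (rule HEmpty) simp
next
  case (HNode f)
  show ?case by (rule HNode(2)) (simp add: HNode(1)[OF _ HNode(2)])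
qed

lemma heq_refl: "heq t t"
proof (induction t rule: kids_induct)
  case (1 t)
  then show ?case by (subst heq_iff) blast
qed

lemma heq_sym: "heq s t \<Longrightarrow> heq t s"
proof (induction rule: heq.induct)
  case (heqI s t)
  then show ?case by (subst heq_iff) blast
qed

lemma heq_trans: "heq s t \<Longrightarrow> heq t u \<Longrightarrow> heq s u"
proof (induction s arbitrary: t u rule: kids_induct)
  case (1 s)
  have 2: "\<forall>x\<in>kids s. \<exists>y\<in>kids t. heq x y" "\<forall>y\<in>kids t. \<exists>x\<in>kids s. heq x y"
    "\<forall>x\<in>kids t. \<exists>y\<in>kids u. heq x y" "\<forall>y\<in>kids u. \<exists>x\<in>kids t. heq x y"
    using 1(2,3) heq_iff by metis+
  show ?case
    by (rule heqI) (use 2 1(1) in metis)+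
qed

quotient_type 'k hset = "'k htree" / heq
  by (rule equivpI) (auto simp: reflp_def symp_def transp_def intro: heq_refl heq_sym heq_trans)

lift_definition elts :: "'k hset \<Rightarrow> 'k hset set" is kids
  unfolding rel_set_def by (subst (asm) heq_iff)

definition set_of :: "'k hset set \<Rightarrow> 'k hset" where
  "set_of A = (SOME x. elts x = A)"

lemma elts_abs_hset: "elts (abs_hset t) = abs_hset ` kids t"
  by (simp add: elts.abs_eq)

lemma elts_inject: "elts x = elts y \<longleftrightarrow> x = y"
proof
  assume eq: "elts x = elts y"
  obtain s t where [simp]: "x = abs_hset s" "y = abs_hset t"
    using Quotient3_abs_rep[OF Quotient3_hset] by metis
  have "abs_hset ` kids s = abs_hset ` kids t"
    using eq by (simp add: elts_abs_hset)
  then have "\<forall>a\<in>kids s. \<exists>b\<in>kids t. abs_hset a = abs_hset b"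
    "\<forall>b\<in>kids t. \<exists>a\<in>kids s. abs_hset a = abs_hset b"
    unfolding set_eq_iff image_iff by metis+
  then have "\<forall>a\<in>kids s. \<exists>b\<in>kids t. heq a b" "\<forall>b\<in>kids t. \<exists>a\<in>kids s. heq a b"
    unfolding hset.abs_eq_iff .
  then have "heq s t"
    by (rule heqI)
  then show "x = y"
    by (simp add: hset.abs_eq_iff)
qed simp

lemma wf_elts: "wf {(x, y). x \<in> elts y}"
proof (rule wfUNIVI)
  fix P :: "'k hset \<Rightarrow> bool" and x
  assume IH: "\<forall>x. (\<forall>y. (y, x) \<in> {(x, y). x \<in> elts y} \<longrightarrow> P y) \<longrightarrow> P x"
  have "P (abs_hset t)" for t
  proof (induction t rule: kids_induct)
    case (1 t)
    show ?case
      by (rule IH[rule_format]) (use 1 in \<open>auto simp: elts_abs_hset\<close>)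
  qed
  then show "P x"
    using Quotient3_abs_rep[OF Quotient3_hset] by metis
qed

lemma elts_lepoll: "elts (x :: 'k hset) \<lesssim> (UNIV :: 'k set)"
proof -
  obtain t where x: "x = abs_hset t"
    using Quotient3_abs_rep[OF Quotient3_hset] by metis
  show ?thesis
  proof (cases t)
    case HEmpty
    then show ?thesis by (simp add: x elts_abs_hset)
  next
    case (HNode f)
    then show ?thesis
      by (simp add: x elts_abs_hset image_image image_lepoll)
  qed
qed

lemma elts_set_of:
  assumes "(A :: 'k hset set) \<lesssim> (UNIV :: 'k set)"
  shows "elts (set_of A) = A"
proof -
  have "\<exists>x. elts x = A"
  proof (cases "A = {}")
    case True
    then show ?thesis
      by (intro exI[of _ "abs_hset HEmpty"]) (simp add: elts_abs_hset)
  next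
    case False
    then obtain g :: "'k \<Rightarrow> 'k hset" where g: "range g = A"
      using assms by (metis lepoll_iff image_subset_iff inj_on_iff_surj lepoll_def subset_UNIV)
    then show ?thesis
      by (intro exI[of _ "abs_hset (HNode (\<lambda>i. rep_hset (g i)))"])
        (simp add: elts_abs_hset image_image Quotient3_abs_rep[OF Quotient3_hset])
  qed
  then show ?thesis
    unfolding set_of_def by (rule someI_ex)
qed

text \<open>
  Inclusion orders the sets; between von Neumann ordinals, \<open><\<close> is therefore membership.
\<close>

instantiation hset :: (type) order
begin

definition less_eq_hset :: "'a hset \<Rightarrow> 'a hset \<Rightarrow> bool" where
  "x \<le> y \<longleftrightarrow> elts x \<subseteq> elts y"

definition less_hset :: "'a hset \<Rightarrow> 'a hset \<Rightarrow> bool" where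
  "x < y \<longleftrightarrow> elts x \<subset> elts y"

instance
  by standard (auto simp: less_eq_hset_def less_hset_def elts_inject[symmetric])

end

definition trcl :: "'k hset \<Rightarrow> 'k hset set" where
  "trcl x = {y. (y, x) \<in> {(u, v). u \<in> elts v}\<^sup>+}"

definition hered :: "'k hset \<Rightarrow> 'k hset set" where
  "hered \<kappa> = {x. trcl x \<prec> elts \<kappa>}"

text \<open>\<open>\<kappa>\<^sup>+\<close> itself need not exist in \<^typ>\<open>'k hset\<close>, but having cardinality less than \<open>\<kappa>\<^sup>+\<close> means having
  cardinality at most \<open>\<kappa>\<close>, and every such set does exist there.\<close>

definition hered_plus :: "'k hset \<Rightarrow> 'k hset set" where
  "hered_plus \<kappa> = {x. trcl x \<lesssim> elts \<kappa>}"


section \<open>Ordinals and cardinals\<close>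

definition Ord :: "'k hset \<Rightarrow> bool" where
  "Ord \<alpha> \<longleftrightarrow> (\<forall>x\<in>elts \<alpha>. elts x \<subseteq> elts \<alpha> \<and> (\<forall>y\<in>elts x. elts y \<subseteq> elts x))"

definition osucc :: "'k hset \<Rightarrow> 'k hset" where
  "osucc \<alpha> = set_of (insert \<alpha> (elts \<alpha>))"

primrec ord_of_nat :: "nat \<Rightarrow> 'k hset" where
  "ord_of_nat 0 = set_of {}"
| "ord_of_nat (Suc n) = osucc (ord_of_nat n)"

definition osup :: "'k hset set \<Rightarrow> 'k hset" where
  "osup A = set_of (\<Union>x\<in>A. elts x)"

definition Card :: "'k hset \<Rightarrow> bool" where
  "Card \<kappa> \<longleftrightarrow> Ord \<kappa> \<and> (\<forall>\<alpha>\<in>elts \<kappa>. elts \<alpha> \<prec> elts \<kappa>)"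

definition cf :: "'k hset \<Rightarrow> 'k hset" where
  "cf \<alpha> = (LEAST \<gamma>. Ord \<gamma> \<and> (\<exists>f\<in>elts \<gamma> \<rightarrow> elts \<alpha>. \<forall>\<xi>\<in>elts \<alpha>. \<exists>i\<in>elts \<gamma>. \<xi> \<le> f i))"

definition inf_card :: "'k hset \<Rightarrow> bool" where
  "inf_card \<kappa> \<longleftrightarrow> Card \<kappa> \<and> infinite (elts \<kappa>)"

definition regular_card :: "'k hset \<Rightarrow> bool" where
  "regular_card \<kappa> \<longleftrightarrow> inf_card \<kappa> \<and> cf \<kappa> = \<kappa>"

definition otp :: "'k hset set \<Rightarrow> 'k hset" where
  "otp A = (THE \<alpha>. Ord \<alpha> \<and> (\<exists>f. bij_betw f (elts \<alpha>) A \<and>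
     (\<forall>x\<in>elts \<alpha>. \<forall>y\<in>elts \<alpha>. x < y \<longleftrightarrow> f x < f y)))"

definition nth_elt :: "'k hset set \<Rightarrow> 'k hset \<Rightarrow> 'k hset" where
  "nth_elt C j = (THE \<beta>. \<beta> \<in> C \<and> otp {\<gamma> \<in> C. \<gamma> < \<beta>} = j)"

definition succ_n :: "nat \<Rightarrow> 'k hset set \<Rightarrow> 'k hset set" where
  "succ_n n C = {nth_elt C (osucc j) | j. j \<in> elts (ord_of_nat n) \<and> osucc j \<in> elts (otp C)}"

definition acc_pts :: "'k hset set \<Rightarrow> 'k hset set" where
  "acc_pts C = {\<alpha> \<in> C. osup (C \<inter> elts \<alpha>) = \<alpha> \<and> elts \<alpha> \<noteq> {}}"

definition club_in :: "'k hset set \<Rightarrow> 'k hset \<Rightarrow> bool" where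
  "club_in C \<alpha> \<longleftrightarrow> C \<subseteq> elts \<alpha> \<and> osup C = \<alpha> \<and>
     (\<forall>\<beta>\<in>elts \<alpha>. elts \<beta> \<noteq> {} \<and> osup (C \<inter> elts \<beta>) = \<beta> \<longrightarrow> \<beta> \<in> C)"

definition stationary_in :: "'k hset set \<Rightarrow> 'k hset \<Rightarrow> bool" where
  "stationary_in S \<kappa> \<longleftrightarrow> S \<subseteq> elts \<kappa> \<and> (\<forall>C. club_in C \<kappa> \<longrightarrow> S \<inter> C \<noteq> {})"

definition E_ge :: "'k hset \<Rightarrow> 'k hset \<Rightarrow> 'k hset set" where
  "E_ge \<kappa> \<chi> = {\<alpha> \<in> elts \<kappa>. \<chi> \<le> cf \<alpha>}"

definition E_gt :: "'k hset \<Rightarrow> 'k hset \<Rightarrow> 'k hset set" where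
  "E_gt \<kappa> \<Lambda> = {\<alpha> \<in> elts \<kappa>. \<Lambda> < cf \<alpha>}"


section \<open>Functions as sets of ordered pairs\<close>

definition hpair :: "'k hset \<Rightarrow> 'k hset \<Rightarrow> 'k hset" where
  "hpair a b = set_of {set_of {a}, set_of {a, b}}"

definition hfun :: "'k hset \<Rightarrow> bool" where
  "hfun f \<longleftrightarrow> (\<forall>z\<in>elts f. \<exists>x y. z = hpair x y) \<and>
     (\<forall>x y y'. hpair x y \<in> elts f \<and> hpair x y' \<in> elts f \<longrightarrow> y = y')"

definition hdom :: "'k hset \<Rightarrow> 'k hset set" where
  "hdom f = {x. \<exists>y. hpair x y \<in> elts f}"

definition hran :: "'k hset \<Rightarrow> 'k hset set" where
  "hran f = {y. \<exists>x. hpair x y \<in> elts f}"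

definition happ :: "'k hset \<Rightarrow> 'k hset \<Rightarrow> 'k hset" where
  "happ f x = (THE y. hpair x y \<in> elts f)"

definition hrestrict :: "'k hset \<Rightarrow> 'k hset \<Rightarrow> 'k hset" where
  "hrestrict f \<alpha> = set_of {z \<in> elts f. \<exists>x\<in>elts \<alpha>. \<exists>y. z = hpair x y}"

definition seqs :: "'k hset \<Rightarrow> 'k hset set \<Rightarrow> 'k hset set" where
  "seqs \<alpha> A = {f. hfun f \<and> hdom f = elts \<alpha> \<and> hran f \<subseteq> A}"

definition seqs_below :: "'k hset \<Rightarrow> 'k hset set \<Rightarrow> 'k hset set" where
  "seqs_below \<kappa> A = (\<Union>\<alpha>\<in>elts \<kappa>. seqs \<alpha> A)"

definition lt_closed :: "'k hset \<Rightarrow> 'k hset \<Rightarrow> bool" where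
  "lt_closed \<chi> \<kappa> \<longleftrightarrow> (\<forall>\<mu>\<in>elts \<kappa>. seqs_below \<chi> (elts \<mu>) \<prec> elts \<kappa>)"


section \<open>Streamlined trees\<close>

definition streamlined :: "'k hset \<Rightarrow> 'k hset set \<Rightarrow> bool" where
  "streamlined \<kappa> T \<longleftrightarrow> T \<subseteq> seqs_below \<kappa> (hered \<kappa>) \<and> (\<forall>t\<in>T. \<forall>\<beta>. Ord \<beta> \<longrightarrow> hrestrict t \<beta> \<in> T)"

definition level :: "'k hset \<Rightarrow> 'k hset set \<Rightarrow> 'k hset \<Rightarrow> 'k hset set" where
  "level \<kappa> T \<alpha> = T \<inter> seqs \<alpha> (hered \<kappa>)"

definition tree_height :: "'k hset \<Rightarrow> 'k hset set \<Rightarrow> 'k hset" where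
  "tree_height \<kappa> T = (LEAST \<alpha>. Ord \<alpha> \<and> level \<kappa> T \<alpha> = {})"

definition tree_chain :: "'k hset set \<Rightarrow> 'k hset set \<Rightarrow> bool" where
  "tree_chain T b \<longleftrightarrow> b \<subseteq> T \<and> (\<forall>x\<in>b. \<forall>y\<in>b. x < y \<or> x = y \<or> y < x)"

definition tree_branch :: "'k hset set \<Rightarrow> 'k hset set \<Rightarrow> bool" where
  "tree_branch T b \<longleftrightarrow> tree_chain T b \<and> (\<forall>c. tree_chain T c \<and> b \<subseteq> c \<longrightarrow> c = b)"

definition tree_antichain :: "'k hset set \<Rightarrow> 'k hset set \<Rightarrow> bool" where
  "tree_antichain T A \<longleftrightarrow> A \<subseteq> T \<and> (\<forall>x\<in>A. \<forall>y\<in>A. \<not> x < y)"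

definition streamlined_souslin :: "'k hset \<Rightarrow> 'k hset set \<Rightarrow> bool" where
  "streamlined_souslin \<kappa> T \<longleftrightarrow> streamlined \<kappa> T \<and> tree_height \<kappa> T = \<kappa> \<and>
     (\<forall>\<alpha>\<in>elts \<kappa>. level \<kappa> T \<alpha> \<prec> elts \<kappa>) \<and>
     \<not> (\<exists>b. tree_branch T b \<and> b \<approx> elts \<kappa>) \<and>
     \<not> (\<exists>A. tree_antichain T A \<and> A \<approx> elts \<kappa>)"

definition tree_normal :: "'k hset \<Rightarrow> 'k hset set \<Rightarrow> bool" where
  "tree_normal \<kappa> T \<longleftrightarrow> (\<forall>\<beta>\<in>elts \<kappa>. \<forall>\<alpha>\<in>elts \<beta>. level \<kappa> T \<beta> \<noteq> {} \<longrightarrow>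
     (\<forall>s\<in>level \<kappa> T \<alpha>. \<exists>t\<in>level \<kappa> T \<beta>. s < t))"

definition snoc :: "'k hset \<Rightarrow> 'k hset \<Rightarrow> 'k hset \<Rightarrow> 'k hset" where
  \<comment> \<open>\<open>t\<^sup>\<frown>\<langle>i\<rangle>\<close> for \<open>t\<close> of length \<open>\<alpha>\<close>\<close>
  "snoc \<alpha> t i = set_of (insert (hpair \<alpha> i) (elts t))"

definition tree_prolific :: "'k hset \<Rightarrow> 'k hset set \<Rightarrow> bool" where
  \<comment> \<open>\<open>range ord_of_nat\<close> is \<open>\<omega>\<close>, and the maximum of two ordinals is their union\<close>
  "tree_prolific \<kappa> T \<longleftrightarrow> (\<forall>\<alpha>\<in>elts \<kappa>. \<forall>t\<in>level \<kappa> T \<alpha>.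
     {snoc \<alpha> t i | i. i \<in> range ord_of_nat \<union> elts \<alpha>} \<subseteq> level \<kappa> T (osucc \<alpha>))"

definition imm_succs :: "'k hset set \<Rightarrow> 'k hset \<Rightarrow> 'k hset set" where
  "imm_succs T x = {y \<in> T. x < y \<and> \<not> (\<exists>z\<in>T. x < z \<and> z < y)}"

definition tree_splitting :: "'k hset \<Rightarrow> 'k hset set \<Rightarrow> bool" where
  "tree_splitting \<sigma> T \<longleftrightarrow> (\<forall>x\<in>T. elts \<sigma> \<lesssim> imm_succs T x)"

definition tree_complete :: "'k hset \<Rightarrow> 'k hset set \<Rightarrow> bool" where
  "tree_complete \<chi> T \<longleftrightarrow> (\<forall>\<delta>\<in>elts \<chi>. \<forall>s\<in>elts \<delta> \<rightarrow> T.
     (\<forall>j\<in>elts \<delta>. \<forall>i\<in>elts j. s i < s j) \<longrightarrow> set_of (\<Union>i\<in>elts \<delta>. elts (s i)) \<in> T)"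

definition tree_rigid :: "'k hset set \<Rightarrow> bool" where
  "tree_rigid T \<longleftrightarrow> (\<forall>\<Phi>. bij_betw \<Phi> T T \<and> (\<forall>x\<in>T. \<forall>y\<in>T. x < y \<longleftrightarrow> \<Phi> x < \<Phi> y) \<longrightarrow>
     (\<forall>x\<in>T. \<Phi> x = x))"

definition ascending_path ::
  "'k hset \<Rightarrow> 'k hset set \<Rightarrow> 'k hset \<Rightarrow> ('k hset \<Rightarrow> 'k hset \<Rightarrow> 'k hset) \<Rightarrow> bool" where
  "ascending_path \<kappa> T \<Lambda> f \<longleftrightarrow> (\<forall>\<alpha>\<in>elts \<kappa>. f \<alpha> \<in> elts \<Lambda> \<rightarrow> level \<kappa> T \<alpha>) \<and>
     (\<forall>\<beta>\<in>elts \<kappa>. \<forall>\<alpha>\<in>elts \<beta>. \<exists>i\<in>elts \<Lambda>. \<exists>j\<in>elts \<Lambda>. f \<alpha> i < f \<beta> j)"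


section \<open>Elementary submodels\<close>

datatype fm = Mem nat nat | Eql nat nat | Neg fm | Conj fm fm | Exi nat fm

primrec sat :: "'k hset set \<Rightarrow> fm \<Rightarrow> (nat \<Rightarrow> 'k hset) \<Rightarrow> bool" where
  "sat A (Mem m n) v \<longleftrightarrow> v m \<in> elts (v n)"
| "sat A (Eql m n) v \<longleftrightarrow> v m = v n"
| "sat A (Neg \<phi>) v \<longleftrightarrow> \<not> sat A \<phi> v"
| "sat A (Conj \<phi> \<psi>) v \<longleftrightarrow> sat A \<phi> v \<and> sat A \<psi> v"
| "sat A (Exi n \<phi>) v \<longleftrightarrow> (\<exists>x\<in>A. sat A \<phi> (v(n := x)))"

definition elem_submodel :: "'k hset set \<Rightarrow> 'k hset set \<Rightarrow> bool" where
  "elem_submodel M A \<longleftrightarrow> M \<noteq> {} \<and> M \<subseteq> A \<and>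
     (\<forall>\<phi> v. range v \<subseteq> M \<longrightarrow> (sat M \<phi> v \<longleftrightarrow> sat A \<phi> v))"


section \<open>The proxy principle\<close>

definition clubfuns :: "'k hset \<Rightarrow> 'k hset set" where
  "clubfuns \<kappa> = {C. hfun C \<and> hdom C \<noteq> {} \<and> (\<forall>\<beta>\<in>hdom C. Ord \<beta>) \<and> club_in (hdom C) (osup (hdom C)) \<and>
     osup (hdom C) \<notin> hdom C \<and> hran C \<subseteq> hered \<kappa>}"

definition alpha_of :: "'k hset \<Rightarrow> 'k hset" where
  "alpha_of C = osup (hdom C)"

definition sqsub :: "'k hset \<Rightarrow> 'k hset \<Rightarrow> 'k hset \<Rightarrow> bool" where
  "sqsub \<chi> C D \<longleftrightarrow> C = hrestrict D (alpha_of C) \<or> cf (alpha_of C) < \<chi>"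

definition guessing_set ::
  "'k hset \<Rightarrow> 'k hset set \<Rightarrow> 'k hset set \<Rightarrow> 'k hset \<Rightarrow> 'k hset \<Rightarrow> 'k hset set" where
  \<comment> \<open>\<open>B(\<Omega>, p, C)\<close>\<close>
  "guessing_set \<kappa> B \<Omega> p C = {\<beta> \<in> B \<inter> hdom C. \<exists>M. elem_submodel M (hered_plus \<kappa>) \<and> p \<in> M \<and>
     M \<inter> elts \<kappa> = elts \<beta> \<and> M \<inter> \<Omega> = elts (happ C \<beta>)}"

definition P_bullet ::
  "'k hset \<Rightarrow> 'k hset \<Rightarrow> ('k hset \<Rightarrow> 'k hset \<Rightarrow> bool) \<Rightarrow> 'k hset \<Rightarrow> 'k hset set set \<Rightarrow> 'k hset \<Rightarrow> bool"
where
  "P_bullet \<kappa> \<mu> R \<theta> \<S> \<nu> \<longleftrightarrow>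
    (\<exists>(\<C> :: 'k hset \<Rightarrow> 'k hset set) (B :: 'k hset \<Rightarrow> 'k hset set).
      (\<Union>\<iota>\<in>elts \<kappa>. B \<iota>) = elts \<kappa> \<and> disjoint_family_on B (elts \<kappa>) \<and>
      (\<forall>\<alpha>\<in>acc_pts (elts \<kappa>).
        \<C> \<alpha> \<subseteq> {C \<in> clubfuns \<kappa>. alpha_of C = \<alpha>} \<and> \<C> \<alpha> \<noteq> {} \<and> \<C> \<alpha> \<prec> elts \<mu> \<and>
        (\<forall>C\<in>\<C> \<alpha>. \<forall>\<alpha>'\<in>acc_pts (hdom C). \<exists>D\<in>\<C> \<alpha>'. R D C)) \<and>
      (\<forall>\<Omega> p \<iota>. (\<forall>i\<in>elts \<theta>. \<Omega> i \<subseteq> hered \<kappa> \<and> p i \<in> hered_plus \<kappa> \<and> \<iota> i \<in> elts \<kappa>) \<longrightarrow>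
        (\<forall>S\<in>\<S>. \<forall>n::nat.
          stationary_in
            {\<alpha> \<in> S. \<C> \<alpha> \<prec> elts \<nu> \<and>
              (\<forall>C\<in>\<C> \<alpha>. \<forall>i\<in>elts \<alpha> \<inter> elts \<theta>.
                osup {\<gamma> \<in> hdom C.
                  succ_n n (hdom C - elts \<gamma>) \<subseteq> guessing_set \<kappa> (B (\<iota> i)) (\<Omega> i) (p i) C} = \<alpha>)}
            \<kappa>)))"

end

theory Submission
  imports Defs
begin

text \<open>
  The levels of the tree are built by recursion, keeping all branches at limits of cofinality below
  \<open>\<chi>\<close>. At other limits \<open>\<alpha>\<close> a branch is kept iff it eventually follows some \<open>C \<in> \<C> \<alpha>\<close>: between
  consecutive points \<open>b < c\<close> of \<open>\<partial>C\<close> it is extended by a step function that depends only on \<open>b\<close>,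
  \<open>c\<close> and the guess \<open>C(c)\<close>, which makes the construction coherent. The step function avoids the set
  \<open>C(c)\<close> at some level strictly between \<open>b\<close> and \<open>c\<close>, uniformly for all nodes of level \<open>b\<close>,
  if it can. Hence if \<open>\<Omega> \<subseteq> T\<close> can be avoided above every node, there are \<open>\<alpha>\<close> such that any fewer than
  \<open>cf \<alpha>\<close> nodes of level \<open>\<alpha>\<close> simultaneously leave \<open>\<Omega>\<close> at some level below \<open>\<alpha>\<close>. Suitable choices of
  \<open>\<Omega>\<close> refute large antichains, large branches, ascending paths and nontrivial automorphisms.
\<close>

section \<open>Ordinals\<close>

text \<open>Following \<open>C\<close> only from some \<open>e\<close> on lets a thread start at any
  node, which gives normality, and leaves few threads: a thread is determined by \<open>C\<close>
  and its restriction to \<open>e\<close>, so such a limit level is no larger than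
  \<open>CC \<alpha>\<close> times the union of the levels below it. The obstacle is that a thread
  must stay in the tree at every accumulation point \<open>c\<close> of \<open>hdom C\<close>. There
  \<open>sqsub\<close> offers two ways out: either \<open>C\<close> cut at \<open>c\<close> belongs
  to \<open>CC c\<close>, and the thread follows it, or \<open>cf c < \<chi>\<close>, where all
  branches are kept and the closure of \<kappa> under powers below \<chi> bounds their number. A
  step avoids the guess at one level for all nodes of level \<open>b\<close> because ascending paths
  and automorphisms are refuted by several nodes leaving \<Omega> at one and the same level. Fewer
  than \<open>cf \<alpha>\<close> nodes have their starting points bounded below \<alpha>, so one
  step lies beyond all of them. The guess at \<open>c\<close> is the trace of an elementary submodel
  on \<Omega>; functions coded in the parameter force this trace to contain every element of
  \<Omega> below level \<open>c\<close>.\<close>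

lemma elts_irrefl: "x \<notin> elts x"
  using wf_not_refl[OF wf_elts] by fastforce

lemma elts_induct [case_names step]:
  assumes "\<And>x. (\<And>y. y \<in> elts x \<Longrightarrow> P y) \<Longrightarrow> P x"
  shows "P x"
  using wf_induct[OF wf_elts, of P x] assms by blast

lemma Ord_in: "Ord \<alpha> \<Longrightarrow> x \<in> elts \<alpha> \<Longrightarrow> Ord x"
  unfolding Ord_def by blast

lemma Ord_trans: "Ord \<alpha> \<Longrightarrow> x \<in> elts \<alpha> \<Longrightarrow> y \<in> elts x \<Longrightarrow> y \<in> elts \<alpha>"
  unfolding Ord_def by blast

lemma OrdI:
  assumes "\<And>x. x \<in> elts \<alpha> \<Longrightarrow> Ord x" and "\<And>x y. x \<in> elts \<alpha> \<Longrightarrow> y \<in> elts x \<Longrightarrow> y \<in> elts \<alpha>"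
  shows "Ord \<alpha>"
  using assms unfolding Ord_def by blast

lemma Ord_linear: "Ord \<alpha> \<Longrightarrow> Ord \<beta> \<Longrightarrow> \<alpha> \<in> elts \<beta> \<or> \<alpha> = \<beta> \<or> \<beta> \<in> elts \<alpha>"
proof (induction \<alpha> arbitrary: \<beta> rule: elts_induct)
  case (step \<alpha>)
  note IH1 = step.IH and \<alpha> = step.prems(1)
  show ?case
    using step.prems(2)
  proof (induction \<beta> rule: elts_induct)
    case (step \<beta>)
    show ?case
    proof (rule ccontr)
      assume neg: "\<not> (\<alpha> \<in> elts \<beta> \<or> \<alpha> = \<beta> \<or> \<beta> \<in> elts \<alpha>)"
      have "elts \<alpha> \<subseteq> elts \<beta>"
        using IH1 \<alpha> step.prems neg by (metis Ord_in Ord_trans subsetI)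
      moreover have "elts \<beta> \<subseteq> elts \<alpha>"
        using step.IH \<alpha> step.prems neg by (metis Ord_in Ord_trans subsetI)
      ultimately show False
        using neg elts_inject by blast
    qed
  qed
qed

lemma Ord_le_iff: "Ord \<alpha> \<Longrightarrow> Ord \<beta> \<Longrightarrow> \<alpha> \<le> \<beta> \<longleftrightarrow> \<alpha> \<in> elts \<beta> \<or> \<alpha> = \<beta>"
  unfolding less_eq_hset_def by (metis Ord_linear Ord_trans elts_irrefl subset_iff)

lemma Ord_less_iff: "Ord \<alpha> \<Longrightarrow> Ord \<beta> \<Longrightarrow> \<alpha> < \<beta> \<longleftrightarrow> \<alpha> \<in> elts \<beta>"
  using Ord_le_iff elts_irrefl less_le by metis

lemma Ord_not_le: "Ord \<alpha> \<Longrightarrow> Ord \<beta> \<Longrightarrow> \<not> \<alpha> \<le> \<beta> \<longleftrightarrow> \<beta> \<in> elts \<alpha>"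
  using Ord_le_iff Ord_linear Ord_trans elts_irrefl by metis

lemma Ord_le_linear: "Ord \<alpha> \<Longrightarrow> Ord \<beta> \<Longrightarrow> \<alpha> \<le> \<beta> \<or> \<beta> \<le> \<alpha>"
  using Ord_le_iff Ord_linear by metis

lemma Ord_le_in: "Ord \<gamma> \<Longrightarrow> Ord \<alpha> \<Longrightarrow> \<alpha> \<le> \<beta> \<Longrightarrow> \<beta> \<in> elts \<gamma> \<Longrightarrow> \<alpha> \<in> elts \<gamma>"
  by (metis Ord_in Ord_le_iff Ord_trans)

lemma Ord_in_le: "\<alpha> \<in> elts \<beta> \<Longrightarrow> \<beta> \<le> \<gamma> \<Longrightarrow> \<alpha> \<in> elts \<gamma>"
  unfolding less_eq_hset_def by blast

lemma Ord_in_imp_le: "Ord \<beta> \<Longrightarrow> \<alpha> \<in> elts \<beta> \<Longrightarrow> \<alpha> \<le> \<beta>"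
  by (metis Ord_in Ord_le_iff)

text \<open>Inclusion is only a partial order on the type, so \<open>LEAST\<close> needs an
  argument: well-foundedness yields a minimal witness, and comparability of ordinals makes it least.
  Hence the restriction of \<open>P\<close> to ordinals.\<close>

lemma Ord_least:
  assumes "P \<gamma>" and ord: "\<And>x. P x \<Longrightarrow> Ord x"
  shows "P (Least P)" and "Least P \<le> \<gamma>"
proof -
  have "\<exists>x. P x \<and> (\<forall>y. P y \<longrightarrow> x \<le> y)"
    using \<open>P \<gamma>\<close>
  proof (induction \<gamma> rule: elts_induct)
    case (step \<gamma>)
    then show ?case
      using Ord_not_le ord by metis
  qed
  then obtain x where x: "P x" "\<forall>y. P y \<longrightarrow> x \<le> y"
    by blast
  then have "Least P = x"
    by (intro Least_equality) auto
  then show "P (Least P)" and "Least P \<le> \<gamma>"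
    using x assms by auto
qed

lemma cf_le:
  assumes "Ord \<gamma>" "f \<in> elts \<gamma> \<rightarrow> elts \<alpha>" "\<forall>\<xi>\<in>elts \<alpha>. \<exists>i\<in>elts \<gamma>. \<xi> \<le> f i"
  shows "cf \<alpha> \<le> \<gamma>"
  unfolding cf_def
  using Ord_least(2)[where P = "\<lambda>\<gamma>. Ord \<gamma> \<and> (\<exists>f\<in>elts \<gamma> \<rightarrow> elts \<alpha>. \<forall>\<xi>\<in>elts \<alpha>. \<exists>i\<in>elts \<gamma>. \<xi> \<le> f i)"]
    assms by blast

lemma cf_cofinal:
  assumes "Ord \<alpha>"
  shows "Ord (cf \<alpha>)" and "\<exists>f\<in>elts (cf \<alpha>) \<rightarrow> elts \<alpha>. \<forall>\<xi>\<in>elts \<alpha>. \<exists>i\<in>elts (cf \<alpha>). \<xi> \<le> f i"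
proof -
  have "Ord (cf \<alpha>) \<and> (\<exists>f\<in>elts (cf \<alpha>) \<rightarrow> elts \<alpha>. \<forall>\<xi>\<in>elts \<alpha>. \<exists>i\<in>elts (cf \<alpha>). \<xi> \<le> f i)"
    unfolding cf_def
    \<comment> \<open>\<alpha> itself is a candidate, witnessed by the identity map.\<close>
    by (rule Ord_least(1)[where P = "\<lambda>\<gamma>. Ord \<gamma> \<and> (\<exists>f\<in>elts \<gamma> \<rightarrow> elts \<alpha>. \<forall>\<xi>\<in>elts \<alpha>. \<exists>i\<in>elts \<gamma>. \<xi> \<le> f i)" and \<gamma> = \<alpha>])
      (use assms in \<open>auto intro!: bexI[of _ "\<lambda>x. x"]\<close>)
  then show "Ord (cf \<alpha>)" "\<exists>f\<in>elts (cf \<alpha>) \<rightarrow> elts \<alpha>. \<forall>\<xi>\<in>elts \<alpha>. \<exists>i\<in>elts (cf \<alpha>). \<xi> \<le> f i"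
    by auto
qed

text \<open>If \<open>f\<close> were unbounded, composing it with the inverse of an injection of
  \<open>J\<close> into \<Lambda> would give a cofinal map from \<Lambda>, against \<Lambda> < cf
  \<alpha>. The index set \<open>J\<close> is arbitrary so that it can be a set of tree
  nodes.\<close>

lemma lt_cf_bounded:
  assumes "Ord \<alpha>" and J: "J \<lesssim> elts \<Lambda>" and \<Lambda>: "Ord \<Lambda>" "\<Lambda> < cf \<alpha>"
    and f: "\<And>j. j \<in> J \<Longrightarrow> f j \<in> elts \<alpha>" and "elts \<alpha> \<noteq> {}"
  shows "\<exists>\<xi>\<in>elts \<alpha>. \<forall>j\<in>J. f j \<in> elts \<xi>"
proof (rule ccontr)
  assume neg: "\<not> ?thesis"
  obtain h where h: "inj_on h J" "h ` J \<subseteq> elts \<Lambda>"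
    using J unfolding lepoll_def by blast
  obtain \<zeta> where \<zeta>: "\<zeta> \<in> elts \<alpha>"
    using \<open>elts \<alpha> \<noteq> {}\<close> by blast
  \<comment> \<open>Indices outside the image of \<open>J\<close> get the filler \<zeta>, which
    exists because \<alpha> is nonempty.\<close>
  define g where "g i = (if i \<in> h ` J then f (inv_into J h i) else \<zeta>)" for i
  have "g \<in> elts \<Lambda> \<rightarrow> elts \<alpha>"
    using f \<zeta> unfolding g_def by (auto simp: h inv_into_f_f)
  moreover have "\<exists>i\<in>elts \<Lambda>. \<xi> \<le> g i" if \<xi>: "\<xi> \<in> elts \<alpha>" for \<xi>
  proof -
    obtain j where "j \<in> J" "f j \<notin> elts \<xi>"
      using neg \<xi> by blast
    then have "\<xi> \<le> f j"
      using Ord_not_le Ord_in \<open>Ord \<alpha>\<close> f \<xi> by metis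
    then have "\<xi> \<le> g (h j)"
      unfolding g_def using \<open>j \<in> J\<close> h by (simp add: inv_into_f_f)
    then show ?thesis
      using h \<open>j \<in> J\<close> by blast
  qed
  ultimately have "cf \<alpha> \<le> \<Lambda>"
    using cf_le \<Lambda>(1) by blast
  then show False
    using \<Lambda>(2) by simp
qed

text \<open>Stated by covering, without a successor operation, in the same shape in which
  unboundedness and accumulation are used throughout.\<close>

definition limit :: "'k hset \<Rightarrow> bool" where
  "limit \<alpha> \<longleftrightarrow> Ord \<alpha> \<and> elts \<alpha> \<noteq> {} \<and> (\<forall>\<xi>\<in>elts \<alpha>. \<exists>\<eta>\<in>elts \<alpha>. \<xi> \<in> elts \<eta>)"

section \<open>Comparison of cardinalities\<close>

lemma lepoll_infinite_imp_infinite: "infinite A \<Longrightarrow> A \<lesssim> B \<Longrightarrow> infinite B"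
  unfolding lepoll_def using inj_on_finite by metis

lemma lepoll_iff_card_of: "A \<lesssim> B \<longleftrightarrow> ordLeq2 (card_of A) (card_of B)"
  unfolding lepoll_def by (rule card_of_ordLeq)

text \<open>Comparability of cardinals, carried over from the cardinal order on
  \<open>card_of\<close>.\<close>

lemma not_lepoll_iff: "\<not> A \<lesssim> B \<longleftrightarrow> B \<prec> A"
proof
  assume neg: "\<not> A \<lesssim> B"
  then have "ordLess2 (card_of B) (card_of A)"
    unfolding lepoll_def card_of_ordLess .
  then have "B \<lesssim> A"
    unfolding lepoll_iff_card_of by (rule ordLess_imp_ordLeq)
  then show "B \<prec> A"
    using neg eqpoll_imp_lepoll eqpoll_sym lepoll_iff_leqpoll by blast
next
  assume "B \<prec> A"
  then show "\<not> A \<lesssim> B"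
    using lesspoll_trans2 lesspoll_not_refl by blast
qed

lemma infinite_Times_self: "infinite K \<Longrightarrow> K \<times> K \<lesssim> K"
  unfolding lepoll_iff_card_of using card_of_Times_same_infinite ordIso_imp_ordLeq by blast

lemma Times_lepoll_infinite:
  assumes "A \<lesssim> K" "B \<lesssim> K" "infinite K"
  shows "A \<times> B \<lesssim> K"
  using times_lepoll_mono[OF assms(1,2)] infinite_Times_self[OF assms(3)] lepoll_trans by blast

text \<open>If one factor is infinite, the larger one absorbs the product; two finite factors have a
  finite product, and \<open>K\<close> is infinite.\<close>

lemma Times_lesspoll_infinite:
  assumes A: "A \<prec> K" and B: "B \<prec> K" and "infinite K"
  shows "A \<times> B \<prec> K"
proof -
  have AB: "A \<lesssim> B \<or> B \<lesssim> A"
    using not_lepoll_iff[of A B] lesspoll_imp_lepoll[of B A] by blast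
  show ?thesis
  proof (cases "finite A \<and> finite B")
    case True
    then show ?thesis
      using \<open>infinite K\<close> by (simp add: finite_lesspoll_infinite)
  next
    case False
    show ?thesis
    proof (cases "A \<lesssim> B")
      case True
      then have "infinite B"
        using False lepoll_infinite_imp_infinite by blast
      then show ?thesis
        using Times_lepoll_infinite[OF True lepoll_refl] B lesspoll_trans1 by blast
    next
      case nle: False
      then have "B \<lesssim> A" "infinite A"
        using AB False lepoll_infinite_imp_infinite by blast+
      then show ?thesis
        using Times_lepoll_infinite[OF lepoll_refl] A lesspoll_trans1 by blast
    qed
  qed
qed

lemma UN_lepoll_Times:
  assumes "\<And>i. i \<in> I \<Longrightarrow> A i \<lesssim> B"
  shows "(\<Union>i\<in>I. A i) \<lesssim> I \<times> B"
proof -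
  obtain f where f: "\<And>i. i \<in> I \<Longrightarrow> A i \<subseteq> f i ` B"
    using assms unfolding lepoll_iff by metis
  have "(\<Union>i\<in>I. A i) \<subseteq> (\<lambda>(i, b). f i b) ` (I \<times> B)"
    using f by fastforce
  then show ?thesis
    by (rule subset_image_lepoll)
qed

lemma elts_zero [simp]: "elts (set_of {}) = {}"
  by (simp add: elts_set_of)

lemma Ord_zero: "Ord (set_of {})"
  by (simp add: Ord_def)

text \<open>\<open>set_of A\<close> has the intended elements only when \<open>A\<close> is small
  enough for the type. Subsets of an existing set are, and so are images of one; these are the usual
  reasons why sets formed later exist.\<close>

lemma elts_set_of_subset: "A \<subseteq> elts x \<Longrightarrow> elts (set_of A) = A"
  by (rule elts_set_of[OF lepoll_trans[OF subset_imp_lepoll elts_lepoll]])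

lemma elts_set_of_image: "elts (set_of ((f :: 'k hset \<Rightarrow> 'k hset) ` elts x)) = f ` elts x"
  by (rule elts_set_of[OF lepoll_trans[OF image_lepoll elts_lepoll]])

lemma set_of_elts [simp]: "set_of (elts x) = x"
  using elts_set_of_subset[of "elts x" x] elts_inject by blast

section \<open>Suprema, order types and consecutive club points\<close>

lemma elts_osup:
  assumes "Ord \<delta>" "A \<subseteq> elts \<delta>"
  shows "elts (osup A) = (\<Union>x\<in>A. elts x)"
  unfolding osup_def using assms Ord_trans by (intro elts_set_of_subset[of _ \<delta>]) blast

text \<open>The elements of \<open>A\<close> are below \<alpha>, so their union is included in
  \<alpha> by transitivity and only the other inclusion carries information. Hypotheses about
  suprema of clubs are used in this covering form.\<close>

lemma osup_eq_iff:
  assumes "Ord \<alpha>" "A \<subseteq> elts \<alpha>"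
  shows "osup A = \<alpha> \<longleftrightarrow> (\<forall>\<xi>\<in>elts \<alpha>. \<exists>a\<in>A. \<xi> \<in> elts a)"
proof -
  have "osup A = \<alpha> \<longleftrightarrow> elts (osup A) = elts \<alpha>"
    by (simp add: elts_inject)
  also have "\<dots> \<longleftrightarrow> (\<forall>\<xi>\<in>elts \<alpha>. \<exists>a\<in>A. \<xi> \<in> elts a)"
    unfolding elts_osup[OF assms] using assms Ord_trans by blast
  finally show ?thesis .
qed

lemma Ord_osup:
  assumes "Ord \<delta>" "A \<subseteq> elts \<delta>"
  shows "Ord (osup A)"
proof (rule OrdI)
  fix x y
  assume x: "x \<in> elts (osup A)"
  then obtain a where "a \<in> A" "x \<in> elts a"
    using elts_osup[OF assms] by blast
  then show "Ord x"
    using assms Ord_in by blast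
  assume "y \<in> elts x"
  then have "y \<in> elts a"
    using Ord_trans Ord_in assms \<open>a \<in> A\<close> \<open>x \<in> elts a\<close> by blast
  then show "y \<in> elts (osup A)"
    using elts_osup[OF assms] \<open>a \<in> A\<close> by blast
qed

lemma osup_le:
  assumes "Ord \<delta>" "A \<subseteq> elts \<delta>" "Ord \<gamma>" "\<And>a. a \<in> A \<Longrightarrow> a \<le> \<gamma>"
  shows "osup A \<le> \<gamma>"
  using assms(4) unfolding less_eq_hset_def elts_osup[OF assms(1,2)] by blast

lemma le_osup:
  assumes "Ord \<delta>" "A \<subseteq> elts \<delta>" "a \<in> A"
  shows "a \<le> osup A"
  using assms(3) unfolding less_eq_hset_def elts_osup[OF assms(1,2)] by blast

lemma acc_pts_iff:
  assumes "Ord \<alpha>"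
  shows "\<alpha> \<in> acc_pts D \<longleftrightarrow> \<alpha> \<in> D \<and> elts \<alpha> \<noteq> {} \<and> (\<forall>\<xi>\<in>elts \<alpha>. \<exists>d\<in>D. d \<in> elts \<alpha> \<and> \<xi> \<in> elts d)"
  unfolding acc_pts_def using osup_eq_iff[OF assms, of "D \<inter> elts \<alpha>"] by auto

lemma acc_pts_elts: "Ord \<kappa> \<Longrightarrow> acc_pts (elts \<kappa>) = {\<alpha> \<in> elts \<kappa>. limit \<alpha>}"
proof (rule set_eqI)
  fix \<alpha>
  assume \<kappa>: "Ord \<kappa>"
  have "\<alpha> \<in> acc_pts (elts \<kappa>) \<longleftrightarrow> \<alpha> \<in> elts \<kappa> \<and> limit \<alpha>" if \<alpha>: "\<alpha> \<in> elts \<kappa>"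
    using acc_pts_iff[OF Ord_in[OF \<kappa> \<alpha>], of "elts \<kappa>"] Ord_in[OF \<kappa> \<alpha>] Ord_trans[OF \<kappa> \<alpha>] \<alpha>
    unfolding limit_def by blast
  then show "\<alpha> \<in> acc_pts (elts \<kappa>) \<longleftrightarrow> \<alpha> \<in> {\<alpha> \<in> elts \<kappa>. limit \<alpha>}"
    unfolding acc_pts_def by blast
qed

text \<open>An order isomorphism of ordinals preserves membership, and a membership-preserving
  bijection between transitive sets is the identity by induction on membership.\<close>

lemma iso_Ord_eq:
  assumes "Ord \<mu>" "Ord \<nu>" "bij_betw h (elts \<mu>) (elts \<nu>)"
    and iso: "\<forall>x\<in>elts \<mu>. \<forall>y\<in>elts \<mu>. x < y \<longleftrightarrow> h x < h y"
  shows "\<mu> = \<nu>"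
proof -
  have mem: "x \<in> elts y \<longleftrightarrow> h x \<in> elts (h y)" if "x \<in> elts \<mu>" "y \<in> elts \<mu>" for x y
    using iso that Ord_less_iff Ord_in assms(1,2) bij_betwE[OF assms(3)] by metis
  have "h x = x" if "x \<in> elts \<mu>" for x
    using that
  proof (induction x rule: elts_induct)
    case (step x)
    have "elts (h x) \<subseteq> elts x"
    proof
      fix z
      assume z: "z \<in> elts (h x)"
      then have "z \<in> elts \<nu>"
        using step.prems Ord_trans assms(2) bij_betwE[OF assms(3)] by metis
      then obtain y where y: "y \<in> elts \<mu>" "z = h y"
        using assms(3) by (metis bij_betw_def imageE)
      then have "y \<in> elts x"
        using mem step.prems z by blast
      then show "z \<in> elts x"
        using step.IH y by simp
    qed
    moreover have "elts x \<subseteq> elts (h x)"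
      using mem step Ord_trans[OF assms(1)] by (metis subsetI)
    ultimately show ?case
      using elts_inject by blast
  qed
  then have "elts \<mu> = elts \<nu>"
    using assms(3) unfolding bij_betw_def by force
  then show ?thesis
    by (simp add: elts_inject)
qed

text \<open>The Mostowski collapse \<pi> of membership on \<open>A\<close>; its inverse is the
  required enumeration.\<close>

lemma collapse_ex:
  fixes A :: "'k hset set"
  assumes \<delta>: "Ord \<delta>" "A \<subseteq> elts \<delta>"
  shows "\<exists>(\<mu> :: 'k hset) f. Ord \<mu> \<and> bij_betw f (elts \<mu>) A \<and> (\<forall>x\<in>elts \<mu>. \<forall>y\<in>elts \<mu>. x < y \<longleftrightarrow> f x < f y)"
proof -
  define \<pi> :: "'k hset \<Rightarrow> 'k hset" where "\<pi> = wfrec {(x, y). x \<in> elts y} (\<lambda>g a. set_of (g ` (A \<inter> elts a)))"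
  have "\<pi> a = set_of (\<pi> ` (A \<inter> elts a))" for a
    unfolding \<pi>_def by (subst wfrec[OF wf_elts]) (auto simp: cut_apply intro!: arg_cong[where f = set_of])
  then have \<pi>: "elts (\<pi> a) = \<pi> ` (A \<inter> elts a)" for a
    using elts_set_of_image[of \<pi> "set_of (A \<inter> elts a)"] elts_set_of_subset[of "A \<inter> elts a" a]
    by (metis Int_lower2)
  have ordA: "Ord a" if "a \<in> A" for a
    using that \<delta> Ord_in by blast
  have ord\<pi>: "Ord (\<pi> a)" if "a \<in> A" for a
    using that
  proof (induction a rule: elts_induct)
    case (step a)
    show ?case
    proof (rule OrdI)
      fix x y
      assume "x \<in> elts (\<pi> a)"
      then obtain b where b: "b \<in> A" "b \<in> elts a" "x = \<pi> b"
        using \<pi> by blast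
      then show "Ord x"
        using step.IH by blast
      show "y \<in> elts (\<pi> a)" if "y \<in> elts x"
        using that b \<pi> step.prems ordA Ord_trans by blast
    qed
  qed
  have mono: "\<pi> a \<in> elts (\<pi> b)" if "a \<in> A" "b \<in> A" "a \<in> elts b" for a b
    using that \<pi> by blast
  have inj: "inj_on \<pi> A"
    by (rule inj_onI) (metis Ord_linear elts_irrefl mono ordA)
  define \<mu> where "\<mu> = set_of (\<pi> ` A)"
  have \<mu>: "elts \<mu> = \<pi> ` A"
    unfolding \<mu>_def using elts_set_of_image[of \<pi> "set_of A"] elts_set_of_subset[OF \<delta>(2)] by simp
  have "Ord \<mu>"
    by (rule OrdI) (auto simp: \<mu> \<pi> ord\<pi>)
  moreover have bij: "bij_betw (inv_into A \<pi>) (elts \<mu>) A"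
    unfolding \<mu> using inj by (simp add: bij_betw_inv_into inj_on_imp_bij_betw)
  moreover have "\<forall>x\<in>elts \<mu>. \<forall>y\<in>elts \<mu>. x < y \<longleftrightarrow> inv_into A \<pi> x < inv_into A \<pi> y"
  proof (intro ballI)
    fix x y
    assume "x \<in> elts \<mu>" "y \<in> elts \<mu>"
    then obtain a b where ab: "a \<in> A" "x = \<pi> a" "b \<in> A" "y = \<pi> b"
      using \<mu> by blast
    have "\<pi> a \<in> elts (\<pi> b) \<longleftrightarrow> a \<in> elts b"
      using mono[of a b] mono[of b a] ab Ord_linear[of a b] ordA ord\<pi> Ord_trans elts_irrefl by metis
    then show "x < y \<longleftrightarrow> inv_into A \<pi> x < inv_into A \<pi> y"
      using ab inj by (simp add: Ord_less_iff ordA ord\<pi>)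
  qed
  ultimately show ?thesis
    by blast
qed

text \<open>Makes the description in \<open>otp\<close> usable: two enumerations of \<open>A\<close>
  compose to an isomorphism of ordinals, which forces equality.\<close>

lemma otp_eqI:
  fixes \<mu> :: "'k hset" and A :: "'k hset set"
  assumes "Ord \<mu>" "bij_betw f (elts \<mu>) A" "\<forall>x\<in>elts \<mu>. \<forall>y\<in>elts \<mu>. x < y \<longleftrightarrow> f x < f y"
  shows "otp A = \<mu>"
  unfolding otp_def
proof (rule the_equality)
  fix \<nu> :: "'k hset"
  assume \<nu>: "Ord \<nu> \<and> (\<exists>f. bij_betw f (elts \<nu>) A \<and> (\<forall>x\<in>elts \<nu>. \<forall>y\<in>elts \<nu>. x < y \<longleftrightarrow> f x < f y))"
  then obtain g where g: "bij_betw g (elts \<nu>) A" "\<forall>x\<in>elts \<nu>. \<forall>y\<in>elts \<nu>. x < y \<longleftrightarrow> g x < g y"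
    by blast
  define h where "h = inv_into (elts \<mu>) f \<circ> g"
  have bij: "bij_betw h (elts \<nu>) (elts \<mu>)"
    unfolding h_def using g(1) assms(2) bij_betw_inv_into bij_betw_trans by blast
  have "f (h x) = g x" if "x \<in> elts \<nu>" for x
    unfolding h_def using that g(1) assms(2) by (metis bij_betwE bij_betw_inv_into_right comp_apply)
  then have "\<forall>x\<in>elts \<nu>. \<forall>y\<in>elts \<nu>. x < y \<longleftrightarrow> h x < h y"
    using g(2) assms(3) bij_betwE[OF bij] by metis
  then show "\<nu> = \<mu>"
    using iso_Ord_eq bij \<nu> assms(1) by blast
qed (use assms in blast)

lemma otp_iso:
  assumes "Ord \<delta>" "A \<subseteq> elts \<delta>"
  shows "Ord (otp A)" "\<exists>f. bij_betw f (elts (otp A)) A"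
  using collapse_ex[OF assms] otp_eqI by metis+

definition next_in :: "'k hset set \<Rightarrow> 'k hset \<Rightarrow> 'k hset \<Rightarrow> bool" where
  "next_in D b c \<longleftrightarrow> b \<in> D \<and> c \<in> D \<and> b \<in> elts c \<and> (\<forall>d\<in>D. d \<in> elts c \<longrightarrow> d \<le> b)"

text \<open>Take \<open>b\<close> as the supremum of \<open>D\<close> below \<open>c\<close>. If
  \<open>b = c\<close>, then \<open>c\<close> is a limit of points of \<open>D\<close>; otherwise
  closure puts \<open>b\<close> into \<open>D\<close>. The point \<open>e\<close> makes
  \<open>D\<close> nonempty below \<open>c\<close> and guarantees that the predecessor
  \<open>b\<close> does not precede the start of a thread.\<close>

lemma club_next_or_acc:
  assumes "Ord \<alpha>" and D: "club_in D \<alpha>" and e: "e \<in> D" "e \<in> elts c" and c: "c \<in> D"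
  shows "(\<exists>b. next_in D b c \<and> e \<le> b) \<or> (\<forall>\<xi>\<in>elts c. \<exists>d\<in>D. d \<in> elts c \<and> \<xi> \<in> elts d)"
proof -
  have D\<alpha>: "D \<subseteq> elts \<alpha>"
    and cl: "\<And>\<beta>. \<beta> \<in> elts \<alpha> \<Longrightarrow> elts \<beta> \<noteq> {} \<Longrightarrow> osup (D \<inter> elts \<beta>) = \<beta> \<Longrightarrow> \<beta> \<in> D"
    using D unfolding club_in_def by auto
  have ordc: "Ord c"
    using c D\<alpha> \<open>Ord \<alpha>\<close> Ord_in by blast
  define b where "b = osup (D \<inter> elts c)"
  have sub: "D \<inter> elts c \<subseteq> elts c"
    by blast
  have ordb: "Ord b"
    unfolding b_def using Ord_osup ordc sub by blast
  have "b \<le> c"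
    unfolding b_def using osup_le[OF ordc sub] ordc Ord_in_imp_le by blast
  then consider "b = c" | "b \<in> elts c"
    using Ord_le_iff ordb ordc by blast
  then show ?thesis
  proof cases
    case 1
    then show ?thesis
      using osup_eq_iff[OF ordc sub] unfolding b_def by blast
  next
    case 2
    have le: "d \<le> b" if "d \<in> D" "d \<in> elts c" for d
      using le_osup[OF ordc sub] that unfolding b_def by blast
    have "b \<in> D"
    proof (rule ccontr)
      assume nb: "b \<notin> D"
      have "d \<in> elts b" if "d \<in> D" "d \<in> elts c" for d
        using le[OF that] that nb Ord_le_iff ordb ordc Ord_in by metis
      then have eq: "D \<inter> elts b = D \<inter> elts c"
        using 2 ordc Ord_trans by blast
      have "e \<in> elts b"
        using e eq by blast
      then have "elts b \<noteq> {}"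
        by blast
      moreover have "osup (D \<inter> elts b) = b"
        using eq b_def by simp
      moreover have "b \<in> elts \<alpha>"
        using 2 c D\<alpha> \<open>Ord \<alpha>\<close> Ord_trans by blast
      ultimately show False
        using cl nb by blast
    qed
    then show ?thesis
      using 2 le e c unfolding next_in_def by blast
  qed
qed

section \<open>Arithmetic below a regular cardinal\<close>

locale regular_cardinal =
  fixes \<kappa> :: "'k hset"
  assumes regular: "regular_card \<kappa>"
begin

lemma Ord_\<kappa>: "Ord \<kappa>" and infinite_\<kappa>: "infinite (elts \<kappa>)" and elts_lesspoll_\<kappa>: "\<alpha> \<in> elts \<kappa> \<Longrightarrow> elts \<alpha> \<prec> elts \<kappa>"
  using regular unfolding regular_card_def inf_card_def Card_def by auto

text \<open>An infinite \<kappa> exists only if the branching type is infinite. Therefore finite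
  sets and one-point extensions exist, on which ordered pairs and successors rely.\<close>

lemma infinite_type: "infinite (UNIV :: 'k set)"
  using lepoll_infinite_imp_infinite[OF infinite_\<kappa> elts_lepoll] .

lemma elts_finite: "finite A \<Longrightarrow> elts (set_of (A :: 'k hset set)) = A"
  by (rule elts_set_of[OF finite_lepoll_infinite[OF infinite_type]])

lemma elts_insert: "elts (set_of (insert a (elts x))) = insert a (elts (x :: 'k hset))"
proof (cases "finite (elts x)")
  case True
  then show ?thesis
    using elts_finite by simp
next
  case False
  then have "insert a (elts x) \<lesssim> elts x"
    by (simp add: infinite_insert_lepoll)
  then show ?thesis
    by (rule elts_set_of[OF lepoll_trans[OF _ elts_lepoll]])
qed

lemma elts_osucc [simp]: "elts (osucc (\<alpha> :: 'k hset)) = insert \<alpha> (elts \<alpha>)"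
  unfolding osucc_def by (rule elts_insert)

lemma Ord_osucc: "Ord \<alpha> \<Longrightarrow> Ord (osucc (\<alpha> :: 'k hset))"
  unfolding Ord_def elts_osucc by blast

lemma Ord_cases:
  assumes "Ord (\<alpha> :: 'k hset)"
  obtains "\<alpha> = set_of {}" | \<beta> where "Ord \<beta>" "\<alpha> = osucc \<beta>" | "limit \<alpha>"
proof (cases "limit \<alpha>")
  case False
  then consider "elts \<alpha> = {}" | \<xi> where "\<xi> \<in> elts \<alpha>" "\<forall>\<eta>\<in>elts \<alpha>. \<xi> \<notin> elts \<eta>"
    using assms unfolding limit_def by blast
  then show ?thesis
  proof cases
    case 1
    then have "\<alpha> = set_of {}"
      by (metis elts_zero elts_inject)
    then show ?thesis
      using that by blast
  next
    case 2
    have \<xi>: "Ord \<xi>"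
      using 2 assms Ord_in by blast
    have "elts \<alpha> \<subseteq> insert \<xi> (elts \<xi>)"
      using 2 assms \<xi> by (metis Ord_in Ord_linear insertCI subsetI)
    moreover have "insert \<xi> (elts \<xi>) \<subseteq> elts \<alpha>"
      using 2 assms Ord_trans by blast
    ultimately have "\<alpha> = osucc \<xi>"
      by (metis elts_osucc elts_inject subset_antisym)
    then show ?thesis
      using that \<xi> by blast
  qed
qed (use that in blast)

lemma limit_osucc: "limit (\<alpha> :: 'k hset) \<Longrightarrow> \<beta> \<in> elts \<alpha> \<Longrightarrow> osucc \<beta> \<in> elts \<alpha>"
proof -
  assume \<alpha>: "limit \<alpha>" "\<beta> \<in> elts \<alpha>"
  obtain \<eta> where \<eta>: "\<eta> \<in> elts \<alpha>" "\<beta> \<in> elts \<eta>"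
    using \<alpha> unfolding limit_def by blast
  have ord: "Ord \<alpha>" "Ord \<eta>" "Ord (osucc \<beta>)"
    using \<alpha> \<eta> unfolding limit_def by (metis Ord_in Ord_osucc)+
  have "osucc \<beta> \<le> \<eta>"
    using \<eta> ord Ord_trans unfolding less_eq_hset_def by auto
  then show ?thesis
    using Ord_le_in[OF ord(1,3)] \<eta>(1) by blast
qed

lemma not_limit_osucc: "\<not> limit (osucc (\<alpha> :: 'k hset))"
proof
  assume \<alpha>: "limit (osucc \<alpha>)"
  have "\<alpha> \<in> elts (osucc \<alpha>)"
    by simp
  then have "osucc \<alpha> \<in> elts (osucc \<alpha>)"
    using limit_osucc \<alpha> by blast
  then show False
    using elts_irrefl by blast
qed

lemma not_limit_zero: "\<not> limit (set_of {})"
  unfolding limit_def by simp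

lemma osucc_inject: "Ord \<alpha> \<Longrightarrow> Ord \<beta> \<Longrightarrow> osucc \<alpha> = osucc (\<beta> :: 'k hset) \<longleftrightarrow> \<alpha> = \<beta>"
proof
  assume ord: "Ord \<alpha>" "Ord \<beta>" and eq: "osucc \<alpha> = osucc \<beta>"
  then have "insert \<alpha> (elts \<alpha>) = insert \<beta> (elts \<beta>)"
    by (metis elts_osucc)
  then have "\<alpha> \<in> insert \<beta> (elts \<beta>)" "\<beta> \<in> insert \<alpha> (elts \<alpha>)"
    by (metis insertI1)+
  then show "\<alpha> = \<beta>"
    using Ord_trans[OF ord(1)] elts_irrefl[of \<alpha>] by (metis insertE)
qed simp

text \<open>The cofinality of zero is zero, and that of a successor is at most one, witnessed by its
  largest element.\<close>

lemma limit_infinite_cf: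
  assumes "Ord (\<alpha> :: 'k hset)" "infinite (elts \<chi>)" "\<chi> \<le> cf \<alpha>"
  shows "limit \<alpha>"
  using assms(1)
proof (cases rule: Ord_cases)
  case 1
  have "cf \<alpha> \<le> set_of {}"
    by (rule cf_le) (auto simp: 1 Ord_zero)
  then have "elts \<chi> \<subseteq> {}"
    using assms(3) unfolding less_eq_hset_def by auto
  then show ?thesis
    using assms(2) by auto
next
  case (2 \<beta>)
  have "cf \<alpha> \<le> osucc (set_of {})"
    by (rule cf_le[where f = "\<lambda>_. \<beta>"]) (auto simp: 2 Ord_zero Ord_osucc intro: Ord_in_imp_le)
  then have "elts \<chi> \<subseteq> {set_of {}}"
    using assms(3) unfolding less_eq_hset_def by auto
  then show ?thesis
    using assms(2) finite_subset by auto
qed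

lemma limit_\<kappa>: "limit \<kappa>"
  using limit_infinite_cf[OF Ord_\<kappa> infinite_\<kappa>] regular unfolding regular_card_def by simp

lemma osucc_\<kappa>: "\<alpha> \<in> elts \<kappa> \<Longrightarrow> osucc \<alpha> \<in> elts \<kappa>"
  using limit_osucc limit_\<kappa> by blast

lemma zero_\<kappa>: "set_of {} \<in> elts \<kappa>"
  using Ord_\<kappa> Ord_linear Ord_zero infinite_\<kappa> by (metis elts_zero empty_iff finite.emptyI)

lemma next_in_ex:
  assumes "limit (\<alpha> :: 'k hset)" "D \<subseteq> elts \<alpha>" "\<forall>\<xi>\<in>elts \<alpha>. \<exists>a\<in>D. \<xi> \<in> elts a" "b \<in> D"
  shows "\<exists>c. next_in D b c"
proof -
  define P where "P c \<longleftrightarrow> c \<in> D \<and> b \<in> elts c" for c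
  obtain c0 where c0: "P c0"
    unfolding P_def using assms by blast
  have ord: "Ord c" if "P c" for c
    using that assms Ord_in unfolding P_def limit_def by blast
  have min: "P (Least P)" "\<And>d. P d \<Longrightarrow> Least P \<le> d"
    using Ord_least[of P] c0 ord by blast+
  have "d \<le> b" if "d \<in> D" "d \<in> elts (Least P)" for d
  proof (rule ccontr)
    assume "\<not> d \<le> b"
    moreover have "Ord d" "Ord b"
      using that assms Ord_in unfolding limit_def by blast+
    ultimately have "P d"
      unfolding P_def using that Ord_not_le by blast
    then show False
      using min(2) that(2) elts_irrefl unfolding less_eq_hset_def by blast
  qed
  then show ?thesis
    using min(1) assms(4) unfolding next_in_def P_def by blast
qed

text \<open>\<open>D - elts b\<close> begins with \<open>b\<close> itself, so index zero belongs to
  \<open>b\<close> and index \<open>osucc (set_of {})\<close> to the next point \<open>c\<close>.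
  This is how a good point of the principle turns its successor in the club into a guessing
  point.\<close>

lemma succ_n_1:
  assumes \<delta>: "Ord (\<delta> :: 'k hset)" "D \<subseteq> elts \<delta>" and bc: "next_in D b c"
  shows "c \<in> succ_n 1 (D - elts b)"
proof -
  let ?D = "D - elts b" and ?one = "osucc (set_of {}) :: 'k hset"
  have ordD: "Ord d" if "d \<in> D" for d
    using that \<delta> Ord_in by blast
  have mem: "b \<in> ?D" "c \<in> ?D" "b \<in> elts c"
    using bc elts_irrefl ordD Ord_trans unfolding next_in_def by blast+
  have one: "elts ?one = {set_of {}}"
    by simp
  \<comment> \<open>Index one means that exactly one element lies below; that only \<open>c\<close>
    has it is what the description in \<open>nth_elt\<close> requires.\<close>
  have otp1: "otp {g \<in> ?D. g < d} = ?one \<longleftrightarrow> d = c" if d: "d \<in> ?D" for d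
  proof
    assume "d = c"
    have "{g \<in> ?D. g < c} = {b}"
    proof -
      have "g = b" if "g \<in> ?D" "g < c" for g
        using that bc mem ordD Ord_less_iff Ord_le_iff unfolding next_in_def by (metis DiffD1 DiffD2)
      then show ?thesis
        using mem Ord_less_iff ordD by blast
    qed
    then show "otp {g \<in> ?D. g < d} = ?one"
      unfolding \<open>d = c\<close>
      by (intro otp_eqI[where f = "\<lambda>_. b"]) (auto simp: Ord_zero Ord_osucc bij_betw_def)
  next
    assume eq: "otp {g \<in> ?D. g < d} = ?one"
    have "{g \<in> ?D. g < d} \<subseteq> elts \<delta>"
      using \<delta> by blast
    then obtain f where "bij_betw f (elts ?one) {g \<in> ?D. g < d}"
      using otp_iso(2)[OF \<delta>(1)] eq by metis
    then obtain a where a: "{g \<in> ?D. g < d} = {a}"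
      unfolding one bij_betw_def by auto
    then have ad: "a \<in> ?D" "a < d"
      by blast+
    have "b \<in> elts d"
    proof -
      have "a \<in> elts d"
        using ad d ordD Ord_less_iff by blast
      then have "d \<noteq> b"
        using ad by blast
      then show ?thesis
        using Ord_linear[of b d] ordD d mem by blast
    qed
    then have "b < d"
      using Ord_less_iff ordD d mem by blast
    then have "b \<in> {g \<in> ?D. g < d}"
      using mem by blast
    then have "a = b"
      unfolding a by blast
    moreover have "d \<notin> elts c"
      using bc d \<open>b \<in> elts d\<close> ordD unfolding next_in_def by (metis DiffD1 Ord_not_le)
    moreover have "c \<notin> elts d"
    proof
      assume "c \<in> elts d"
      then have "c < d"
        using Ord_less_iff ordD d mem by blast
      then have "c \<in> {g \<in> ?D. g < d}"
        using mem by blast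
      then have "c = b"
        unfolding a \<open>a = b\<close> by blast
      then show False
        using mem elts_irrefl by blast
    qed
    ultimately show "d = c"
      using ordD d mem Ord_linear by blast
  qed
  have nth: "nth_elt ?D ?one = c"
    unfolding nth_elt_def using otp1 mem by (intro the_equality) auto
  have "?D \<subseteq> elts \<delta>"
    using \<delta> by blast
  then obtain f where ordo: "Ord (otp ?D)" and f: "bij_betw f (elts (otp ?D)) ?D"
    using otp_iso[OF \<delta>(1)] by metis
  \<comment> \<open>The order type exceeds one, since both \<open>b\<close> and \<open>c\<close>
    belong to the set.\<close>
  have "?one \<in> elts (otp ?D)"
  proof (rule ccontr)
    assume "\<not> ?one \<in> elts (otp ?D)"
    then have "otp ?D \<le> ?one"
      using ordo Ord_linear[of "otp ?D" ?one] Ord_zero Ord_osucc Ord_le_iff by blast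
    then have "elts (otp ?D) \<subseteq> {set_of {}}"
      unfolding less_eq_hset_def by simp
    then have "?D \<subseteq> {f (set_of {})}"
      using f unfolding bij_betw_def by blast
    then show False
      using mem elts_irrefl by blast
  qed
  then show ?thesis
    unfolding succ_n_def using nth by (auto intro!: exI[of _ "set_of {}"])
qed

text \<open>Collapse a copy of \<open>A\<close> inside \<kappa>: the resulting ordinal has the size
  of \<open>A\<close>, so it cannot reach \<kappa>.\<close>

lemma lesspoll_\<kappa>_ex:
  assumes "A \<prec> elts \<kappa>"
  shows "\<exists>\<mu>\<in>elts \<kappa>. A \<lesssim> elts \<mu>"
proof -
  obtain f where f: "inj_on f A" "f ` A \<subseteq> elts \<kappa>"
    using assms unfolding lesspoll_def lepoll_def by blast
  obtain \<mu> :: "'k hset" and g where \<mu>: "Ord \<mu>" "bij_betw g (elts \<mu>) (f ` A)"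
    using collapse_ex[OF Ord_\<kappa> f(2)] by blast
  have "elts \<mu> \<approx> f ` A"
    using \<mu>(2) unfolding eqpoll_def by blast
  then have eq: "elts \<mu> \<approx> A"
    using eqpoll_trans[OF _ inj_on_image_eqpoll_self[OF f(1)]] by blast
  have "\<not> \<kappa> \<le> \<mu>"
    using eq_lesspoll_trans[OF eq assms] not_lepoll_iff subset_imp_lepoll
    unfolding less_eq_hset_def by blast
  then have "\<mu> \<in> elts \<kappa>"
    using Ord_not_le Ord_\<kappa> \<mu>(1) by blast
  then show ?thesis
    using eq eqpoll_sym eqpoll_imp_lepoll by blast
qed

lemma bounded_\<kappa>:
  assumes "A \<prec> elts \<kappa>" "\<And>a. a \<in> A \<Longrightarrow> f a \<in> elts \<kappa>"
  shows "\<exists>\<xi>\<in>elts \<kappa>. \<forall>a\<in>A. f a \<in> elts \<xi>"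
proof -
  obtain \<mu> where \<mu>: "\<mu> \<in> elts \<kappa>" "A \<lesssim> elts \<mu>"
    using lesspoll_\<kappa>_ex assms(1) by blast
  moreover have "cf \<kappa> = \<kappa>"
    using regular unfolding regular_card_def by blast
  ultimately show ?thesis
    using lt_cf_bounded[OF Ord_\<kappa>, of A \<mu> f] assms(2) infinite_\<kappa> Ord_in[OF Ord_\<kappa> \<mu>(1)]
      Ord_less_iff[OF Ord_in[OF Ord_\<kappa> \<mu>(1)] Ord_\<kappa>] by auto
qed

text \<open>By regularity one \<xi> < \<kappa> bounds the sizes of all pieces, so the union embeds
  into \<open>I \<times> elts \<xi>\<close>.\<close>

lemma UN_lesspoll_\<kappa>:
  assumes "I \<prec> elts \<kappa>" "\<And>i. i \<in> I \<Longrightarrow> A i \<prec> elts \<kappa>"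
  shows "(\<Union>i\<in>I. A i) \<prec> elts \<kappa>"
proof -
  have "\<forall>i\<in>I. \<exists>\<mu>. \<mu> \<in> elts \<kappa> \<and> A i \<lesssim> elts \<mu>"
    using assms(2) lesspoll_\<kappa>_ex by blast
  then obtain m where m: "\<And>i. i \<in> I \<Longrightarrow> m i \<in> elts \<kappa> \<and> A i \<lesssim> elts (m i)"
    by metis
  obtain \<xi> where \<xi>: "\<xi> \<in> elts \<kappa>" "\<forall>i\<in>I. m i \<in> elts \<xi>"
    using bounded_\<kappa>[OF assms(1), of m] m by blast
  have "A i \<lesssim> elts \<xi>" if "i \<in> I" for i
  proof -
    have "elts (m i) \<subseteq> elts \<xi>"
      using \<xi> that Ord_\<kappa> Ord_in Ord_trans by blast
    then show ?thesis
      using m that lepoll_trans subset_imp_lepoll by blast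
  qed
  then have "(\<Union>i\<in>I. A i) \<lesssim> I \<times> elts \<xi>"
    by (rule UN_lepoll_Times)
  moreover have "I \<times> elts \<xi> \<prec> elts \<kappa>"
    using Times_lesspoll_infinite assms(1) \<xi>(1) elts_lesspoll_\<kappa> infinite_\<kappa> by blast
  ultimately show ?thesis
    using lesspoll_trans1 by blast
qed

lemma finite_lesspoll_\<kappa>: "finite A \<Longrightarrow> A \<prec> elts \<kappa>"
  using finite_lesspoll_infinite infinite_\<kappa> by blast

lemma Un_lesspoll_\<kappa>: "A \<prec> elts \<kappa> \<Longrightarrow> B \<prec> elts \<kappa> \<Longrightarrow> A \<union> B \<prec> elts \<kappa>"
  using UN_lesspoll_\<kappa>[of "{A, B}" "\<lambda>x. x"] finite_lesspoll_\<kappa>[of "{A, B}"] by auto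

end

section \<open>Functions as sets\<close>

lemma hrestrict_elts: "elts (hrestrict f \<alpha>) = {z \<in> elts f. \<exists>x\<in>elts \<alpha>. \<exists>y. z = hpair x y}"
  unfolding hrestrict_def by (rule elts_set_of_subset) blast

lemma hrestrict_mem: "hpair x y \<in> elts (hrestrict f \<alpha>) \<longleftrightarrow> hpair x y \<in> elts f \<and> (\<exists>x'\<in>elts \<alpha>. \<exists>y'. hpair x y = hpair x' y')"
  unfolding hrestrict_elts by blast

context regular_cardinal
begin

lemma hpair_elts: "elts (hpair a b) = {set_of {a}, set_of {a, b :: 'k hset}}"
  unfolding hpair_def by (simp add: elts_finite)

lemma elts_sing: "elts (set_of {a :: 'k hset}) = {a}" and elts_pair: "elts (set_of {a, b :: 'k hset}) = {a, b}"
  by (simp_all add: elts_finite)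

lemma hpair_inject [simp]: "hpair a b = hpair c (d :: 'k hset) \<longleftrightarrow> a = c \<and> b = d"
proof
  assume "hpair a b = hpair c d"
  then have eq: "{set_of {a}, set_of {a, b}} = {set_of {c}, set_of {c, d}}"
    by (metis hpair_elts)
  have "{{a}, {a, b}} = {{c}, {c, d}}"
  proof -
    have "elts ` {set_of {a}, set_of {a, b}} = elts ` {set_of {c}, set_of {c, d}}"
      using eq by (rule arg_cong)
    then show ?thesis
      by (simp add: elts_sing elts_pair)
  qed
  then show "a = c \<and> b = d"
    by (simp add: doubleton_eq_iff) blast
qed simp

lemma hrestrict_mem': "hpair x y \<in> elts (hrestrict f \<alpha>) \<longleftrightarrow> hpair x y \<in> elts f \<and> x \<in> elts (\<alpha> :: 'k hset)"
  unfolding hrestrict_mem by auto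

lemma happ_eq: "hfun f \<Longrightarrow> hpair x y \<in> elts f \<Longrightarrow> happ f x = (y :: 'k hset)"
  unfolding happ_def hfun_def by blast

lemma hrestrict_happ:
  assumes "x \<in> elts \<alpha>" "hfun f" "x \<in> hdom f"
  shows "happ (hrestrict f \<alpha>) x = happ f (x :: 'k hset)"
proof -
  have "hpair x y \<in> elts (hrestrict f \<alpha>) \<longleftrightarrow> hpair x y \<in> elts f" for y
    using assms hrestrict_mem' by blast
  then show ?thesis
    unfolding happ_def by simp
qed

lemma hfun_eqI:
  assumes "hfun f" "hfun g" "\<And>x y. hpair x y \<in> elts f \<longleftrightarrow> hpair x y \<in> elts (g :: 'k hset)"
  shows "f = g"
proof -
  have pairs: "\<exists>x y. z = hpair x y" if "z \<in> elts f \<or> z \<in> elts g" for z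
    using that assms(1,2) unfolding hfun_def by blast
  have "elts f = elts g"
  proof (rule set_eqI)
    fix z
    show "z \<in> elts f \<longleftrightarrow> z \<in> elts g"
      using pairs[of z] assms(3) by metis
  qed
  then show ?thesis
    by (simp add: elts_inject)
qed

lemma hfun_hrestrict: "hfun f \<Longrightarrow> hfun (hrestrict f (\<alpha> :: 'k hset))"
  unfolding hfun_def hrestrict_elts by blast

lemma hdom_hrestrict: "hdom (hrestrict f \<alpha>) = hdom f \<inter> elts (\<alpha> :: 'k hset)"
  unfolding hdom_def hrestrict_mem' by auto

lemma hran_hrestrict: "hran (hrestrict f \<alpha>) \<subseteq> hran (f :: 'k hset)"
  unfolding hran_def hrestrict_mem' by blast

lemma hrestrict_seqs: "t \<in> seqs \<alpha> A \<Longrightarrow> \<beta> \<le> \<alpha> \<Longrightarrow> hrestrict t \<beta> \<in> seqs (\<beta> :: 'k hset) A"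
  unfolding seqs_def using hfun_hrestrict hdom_hrestrict hran_hrestrict
  by (auto simp: less_eq_hset_def subset_iff)

lemma hrestrict_id: "t \<in> seqs \<alpha> A \<Longrightarrow> \<alpha> \<le> \<beta> \<Longrightarrow> hrestrict t \<beta> = (t :: 'k hset)"
  by (rule hfun_eqI) (auto simp: seqs_def hfun_hrestrict hrestrict_mem' less_eq_hset_def hdom_def)

lemma hrestrict_self: "t \<in> seqs \<alpha> A \<Longrightarrow> hrestrict t \<alpha> = (t :: 'k hset)"
  by (rule hrestrict_id) auto

lemma hrestrict_hrestrict: "\<gamma> \<le> \<beta> \<Longrightarrow> hfun t \<Longrightarrow> hrestrict (hrestrict t \<beta>) \<gamma> = hrestrict (t :: 'k hset) \<gamma>"
  by (rule hfun_eqI) (auto simp: hfun_hrestrict hrestrict_mem' less_eq_hset_def)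

lemma seqs_hfun: "t \<in> seqs \<alpha> A \<Longrightarrow> hfun t" and seqs_hdom: "t \<in> seqs \<alpha> A \<Longrightarrow> hdom t = elts \<alpha>"
  unfolding seqs_def by auto

lemma seqs_hdom_iff: "t \<in> seqs \<alpha> A \<Longrightarrow> hdom t = elts \<beta> \<longleftrightarrow> \<alpha> = \<beta>"
  unfolding seqs_def by (auto simp: elts_inject)

lemma hrestrict_le: "hrestrict t \<alpha> \<le> t"
  unfolding less_eq_hset_def hrestrict_elts by blast

text \<open>The order of the type is inclusion, so nodes are compared as graphs; a function included
  in \<open>t\<close> with domain \<beta> is the restriction of \<open>t\<close> to \<beta>.
  Questions about the tree order thus become equations between restrictions.\<close>

lemma seqs_le_iff:
  assumes s: "s \<in> seqs \<beta> A" and t: "t \<in> seqs \<alpha> B"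
  shows "s \<le> t \<longleftrightarrow> \<beta> \<le> \<alpha> \<and> hrestrict t \<beta> = (s :: 'k hset)"
proof
  assume st: "s \<le> t"
  have sub: "elts s \<subseteq> elts t"
    using st unfolding less_eq_hset_def .
  have "hdom s \<subseteq> hdom t"
    using sub unfolding hdom_def by blast
  then have le: "\<beta> \<le> \<alpha>"
    using seqs_hdom s t unfolding less_eq_hset_def by blast
  have "hrestrict t \<beta> = s"
  proof (rule hfun_eqI)
    fix x y
    show "hpair x y \<in> elts (hrestrict t \<beta>) \<longleftrightarrow> hpair x y \<in> elts s"
    proof
      assume "hpair x y \<in> elts (hrestrict t \<beta>)"
      then have xy: "hpair x y \<in> elts t" "x \<in> elts \<beta>"
        unfolding hrestrict_mem' by auto
      then obtain y' where y': "hpair x y' \<in> elts s"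
        using seqs_hdom[OF s] unfolding hdom_def by blast
      then have "y' = y"
        using sub xy(1) seqs_hfun[OF t] unfolding hfun_def by blast
      then show "hpair x y \<in> elts s"
        using y' by simp
    next
      assume xy: "hpair x y \<in> elts s"
      then have "x \<in> elts \<beta>"
        using seqs_hdom[OF s] unfolding hdom_def by blast
      then show "hpair x y \<in> elts (hrestrict t \<beta>)"
        using sub xy unfolding hrestrict_mem' by blast
    qed
  qed (use seqs_hfun s t hfun_hrestrict in blast)+
  then show "\<beta> \<le> \<alpha> \<and> hrestrict t \<beta> = s"
    using le by simp
qed (use hrestrict_le in blast)

lemma seqs_less_iff:
  assumes s: "s \<in> seqs \<beta> A" and t: "t \<in> seqs \<alpha> B" and "Ord \<alpha>" "Ord \<beta>"
  shows "s < t \<longleftrightarrow> \<beta> \<in> elts \<alpha> \<and> hrestrict t \<beta> = (s :: 'k hset)"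
proof -
  have "s = t" if "\<beta> = \<alpha>" "hrestrict t \<beta> = s"
    using that hrestrict_self t by metis
  moreover have "s \<noteq> t" if "\<beta> \<in> elts \<alpha>"
    using that s t seqs_hdom elts_irrefl by (metis elts_inject)
  ultimately show ?thesis
    unfolding less_le seqs_le_iff[OF s t] using Ord_le_iff[OF \<open>Ord \<beta>\<close> \<open>Ord \<alpha>\<close>] by blast
qed

lemma seqs_eqI:
  assumes s: "s \<in> seqs \<alpha> A" and t: "t \<in> seqs \<alpha> B"
    and cov: "\<forall>\<xi>\<in>elts \<alpha>. \<exists>d\<in>D. \<xi> \<in> elts d" and eq: "\<And>d. d \<in> D \<Longrightarrow> hrestrict s d = hrestrict (t :: 'k hset) d"
  shows "s = t"
proof (rule hfun_eqI)
  fix x y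
  have "hpair x y \<in> elts s \<longleftrightarrow> hpair x y \<in> elts t" if x: "x \<in> elts \<alpha>"
  proof -
    obtain d where d: "d \<in> D" "x \<in> elts d"
      using cov x by blast
    then have "hpair x y \<in> elts (hrestrict s d) \<longleftrightarrow> hpair x y \<in> elts (hrestrict t d)"
      using eq by simp
    then show ?thesis
      unfolding hrestrict_mem' using d by simp
  qed
  moreover have "x \<in> elts \<alpha>" if "hpair x y \<in> elts s \<or> hpair x y \<in> elts t"
    using that seqs_hdom[OF s] seqs_hdom[OF t] unfolding hdom_def by blast
  ultimately show "hpair x y \<in> elts s \<longleftrightarrow> hpair x y \<in> elts t"
    by blast
qed (use seqs_hfun s t in blast)+

lemma elts_hgraph: "elts (set_of ((\<lambda>x. hpair x (h x)) ` elts \<alpha>)) = (\<lambda>x. hpair x (h x)) ` elts (\<alpha> :: 'k hset)"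
  by (rule elts_set_of_image)

lemma hgraph_seqs:
  assumes "\<And>x. x \<in> elts \<alpha> \<Longrightarrow> h x \<in> A"
  shows "set_of ((\<lambda>x. hpair x (h x)) ` elts (\<alpha> :: 'k hset)) \<in> seqs \<alpha> A"
proof -
  have e: "elts (set_of ((\<lambda>x. hpair x (h x)) ` elts \<alpha>)) = (\<lambda>x. hpair x (h x)) ` elts \<alpha>"
    by (rule elts_hgraph)
  show ?thesis
    unfolding seqs_def hfun_def hdom_def hran_def e mem_Collect_eq using assms by auto
qed

text \<open>Gluing. Coherence makes any two pieces agree where both are defined, so the union is a
  function, and the covering makes it total on \<alpha>. Limits of threads and completeness both
  rest on this.\<close>

lemma seqs_union:
  assumes \<alpha>: "Ord (\<alpha> :: 'k hset)" and D: "D \<subseteq> elts \<alpha>" and cov: "\<forall>\<xi>\<in>elts \<alpha>. \<exists>d\<in>D. \<xi> \<in> elts d"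
    and s: "\<And>d. d \<in> D \<Longrightarrow> s d \<in> seqs d A"
    and coh: "\<And>d d'. d \<in> D \<Longrightarrow> d' \<in> D \<Longrightarrow> d \<in> elts d' \<Longrightarrow> hrestrict (s d') d = s d"
  shows "\<exists>t\<in>seqs \<alpha> A. \<forall>d\<in>D. hrestrict t d = s d"
proof -
  have ordD: "Ord d" if "d \<in> D" for d
    using that D \<alpha> Ord_in by blast
  have agree: "hpair x y \<in> elts (s d) \<longleftrightarrow> hpair x y \<in> elts (s d')"
    if "d \<in> D" "d' \<in> D" "x \<in> elts d" "x \<in> elts d'" for d d' x y
    using Ord_linear[OF ordD[OF that(1)] ordD[OF that(2)]] coh[OF that(1,2)] coh[OF that(2,1)]
      that(3,4) hrestrict_mem'[of x y] by metis
  define U where "U = (\<Union>d\<in>D. elts (s d))"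
  define h where "h x = (THE y. hpair x y \<in> U)" for x
  have U: "hpair x y \<in> U \<longleftrightarrow> hpair x y \<in> elts (s d)" if "d \<in> D" "x \<in> elts d" for x y d
  proof
    assume "hpair x y \<in> U"
    then obtain d' where d': "d' \<in> D" "hpair x y \<in> elts (s d')"
      unfolding U_def by blast
    then have "x \<in> elts d'"
      using seqs_hdom[OF s[OF d'(1)]] unfolding hdom_def by blast
    then show "hpair x y \<in> elts (s d)"
      using agree that d' by blast
  qed (use that in \<open>auto simp: U_def\<close>)
  have h: "hpair x (h x) \<in> U" "hpair x y \<in> U \<Longrightarrow> y = h x" if x: "x \<in> elts \<alpha>" for x y
  proof -
    obtain d where d: "d \<in> D" "x \<in> elts d"
      using cov x by blast
    obtain y' where y': "hpair x y' \<in> elts (s d)"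
      using seqs_hdom[OF s[OF d(1)]] d(2) unfolding hdom_def by blast
    have uniq: "y = y'" if "hpair x y \<in> U" for y
    proof -
      have "hpair x y \<in> elts (s d)"
        using that U[OF d] by simp
      then show ?thesis
        using y' seqs_hfun[OF s[OF d(1)]] unfolding hfun_def by blast
    qed
    have y'U: "hpair x y' \<in> U"
      using y' U[OF d] by simp
    have "h x = y'"
      unfolding h_def by (rule the_equality, fact y'U, erule uniq)
    then show "hpair x (h x) \<in> U" "hpair x y \<in> U \<Longrightarrow> y = h x"
      using y'U uniq[of y] by simp_all
  qed
  \<comment> \<open>The union is rebuilt as the graph of \<open>h\<close> over \<alpha>, an image of
    an existing set, so that it exists in the type.\<close>
  define t where "t = set_of ((\<lambda>x. hpair x (h x)) ` elts \<alpha>)"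
  have hA: "h x \<in> A" if x: "x \<in> elts \<alpha>" for x
  proof -
    obtain d where d: "d \<in> D" "x \<in> elts d"
      using cov x by blast
    then have "hpair x (h x) \<in> elts (s d)"
      using h(1)[OF x] U by blast
    then show ?thesis
      using s[OF d(1)] unfolding seqs_def hran_def by blast
  qed
  have t: "t \<in> seqs \<alpha> A"
    unfolding t_def by (rule hgraph_seqs[OF hA])
  have mem: "hpair x y \<in> elts t \<longleftrightarrow> x \<in> elts \<alpha> \<and> hpair x y \<in> U" for x y
  proof -
    have e: "elts t = (\<lambda>x. hpair x (h x)) ` elts \<alpha>"
      unfolding t_def by (rule elts_hgraph)
    have "hpair x y \<in> elts t \<longleftrightarrow> x \<in> elts \<alpha> \<and> y = h x"
      unfolding e by auto
    then show ?thesis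
      using h[of x] by blast
  qed
  have "hrestrict t d = s d" if d: "d \<in> D" for d
  proof (rule hfun_eqI)
    fix x y
    have d\<alpha>: "elts d \<subseteq> elts \<alpha>"
      using d D \<alpha> Ord_trans by blast
    have "x \<in> elts d" if "hpair x y \<in> elts (s d)"
      using that seqs_hdom[OF s[OF d]] unfolding hdom_def by blast
    then show "hpair x y \<in> elts (hrestrict t d) \<longleftrightarrow> hpair x y \<in> elts (s d)"
      unfolding hrestrict_mem' mem using U[OF d] d\<alpha> by blast
  qed (use seqs_hfun[OF t] seqs_hfun[OF s[OF d]] hfun_hrestrict in blast)+
  then show ?thesis
    using t by blast
qed

lemma elts_snoc: "elts (snoc \<alpha> t i) = insert (hpair \<alpha> i) (elts (t :: 'k hset))"
  unfolding snoc_def by (rule elts_insert)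

lemma snoc_seqs:
  assumes t: "t \<in> seqs \<alpha> A" and "i \<in> A"
  shows "snoc \<alpha> t i \<in> seqs (osucc (\<alpha> :: 'k hset)) A"
proof -
  have "hpair \<alpha> y \<notin> elts t" for y
    using seqs_hdom[OF t] elts_irrefl unfolding hdom_def by blast
  then have "hfun (snoc \<alpha> t i)"
    using seqs_hfun[OF t] unfolding hfun_def elts_snoc by auto
  moreover have "hdom (snoc \<alpha> t i) = insert \<alpha> (hdom t)" "hran (snoc \<alpha> t i) = insert i (hran t)"
    unfolding hdom_def hran_def elts_snoc by auto
  ultimately show ?thesis
    using assms unfolding seqs_def by auto
qed

lemma hrestrict_snoc:
  assumes t: "t \<in> seqs \<alpha> A"
  shows "hrestrict (snoc \<alpha> t i) \<alpha> = (t :: 'k hset)"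
proof (rule hfun_eqI)
  fix x y
  show "hpair x y \<in> elts (hrestrict (snoc \<alpha> t i) \<alpha>) \<longleftrightarrow> hpair x y \<in> elts t"
    using seqs_hdom[OF t] elts_irrefl[of \<alpha>] unfolding hrestrict_mem' elts_snoc hdom_def by auto
next
  have "snoc \<alpha> t i \<in> seqs (osucc \<alpha>) UNIV"
    using t by (intro snoc_seqs) (auto simp: seqs_def)
  then show "hfun (hrestrict (snoc \<alpha> t i) \<alpha>)"
    using seqs_hfun hfun_hrestrict by blast
qed (use seqs_hfun[OF t] in blast)

lemma hrestrict_snoc_le:
  assumes t: "t \<in> seqs \<alpha> A" and "\<beta> \<le> \<alpha>"
  shows "hrestrict (snoc \<alpha> t i) \<beta> = hrestrict t (\<beta> :: 'k hset)"
proof -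
  have "snoc \<alpha> t i \<in> seqs (osucc \<alpha>) UNIV"
    using t by (intro snoc_seqs) (auto simp: seqs_def)
  then show ?thesis
    using hrestrict_hrestrict[OF assms(2)] seqs_hfun hrestrict_snoc[OF t] by metis
qed

lemma snoc_inject:
  assumes t: "t \<in> seqs \<alpha> A" and s: "s \<in> seqs \<alpha> B"
  shows "snoc \<alpha> t i = snoc \<alpha> s j \<longleftrightarrow> t = s \<and> i = (j :: 'k hset)"
proof
  assume eq: "snoc \<alpha> t i = snoc \<alpha> s j"
  then have "t = s"
    using hrestrict_snoc[OF t] hrestrict_snoc[OF s] by metis
  moreover have "hpair \<alpha> i \<in> insert (hpair \<alpha> j) (elts s)"
    using eq elts_snoc by (metis insertI1)
  then have "i = j"
    using seqs_hdom[OF s] elts_irrefl unfolding hdom_def by auto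
  ultimately show "t = s \<and> i = j"
    by simp
qed simp

section \<open>Hereditary cardinality\<close>

lemma trcl_unfold: "trcl x = elts x \<union> (\<Union>y\<in>elts x. trcl (y :: 'k hset))"
proof -
  have "(y, x) \<in> {(u, v). u \<in> elts v}\<^sup>+ \<longleftrightarrow> y \<in> elts x \<or> (\<exists>z\<in>elts x. (y, z) \<in> {(u, v). u \<in> elts v}\<^sup>+)" for y
    by (subst trancl.simps) auto
  then show ?thesis
    unfolding trcl_def by auto
qed

text \<open>The transitive closure is a union of fewer than \<kappa> sets, each of size less than
  \<kappa>; regularity applies.\<close>

lemma heredI:
  assumes "elts x \<subseteq> hered \<kappa>" "elts x \<prec> elts \<kappa>"
  shows "x \<in> hered \<kappa>"
  unfolding hered_def mem_Collect_eq
  by (subst trcl_unfold, rule Un_lesspoll_\<kappa>, fact assms(2), rule UN_lesspoll_\<kappa>, fact assms(2))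
    (use assms(1) in \<open>auto simp: hered_def\<close>)

lemma hered_finite: "finite A \<Longrightarrow> A \<subseteq> hered \<kappa> \<Longrightarrow> set_of A \<in> hered \<kappa>"
  by (rule heredI) (auto simp: elts_finite finite_lesspoll_\<kappa>)

lemma hered_hpair: "a \<in> hered \<kappa> \<Longrightarrow> b \<in> hered \<kappa> \<Longrightarrow> hpair a b \<in> hered \<kappa>"
  unfolding hpair_def by (intro hered_finite) (auto intro!: hered_finite)

lemma hered_Ord: "\<alpha> \<in> elts \<kappa> \<Longrightarrow> \<alpha> \<in> hered \<kappa>"
proof (induction \<alpha> rule: elts_induct)
  case (step \<alpha>)
  then show ?case
    using heredI elts_lesspoll_\<kappa> Ord_trans[OF Ord_\<kappa>] by blast
qed

text \<open>Places the tree inside \<open>hered \<kappa>\<close>, which makes its subsets admissible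
  as guessed sets \<Omega>.\<close>

lemma seqs_hered:
  assumes "\<alpha> \<in> elts \<kappa>" "t \<in> seqs \<alpha> (hered \<kappa>)"
  shows "t \<in> hered \<kappa>"
proof (rule heredI)
  have sub: "elts t \<subseteq> (\<lambda>x. hpair x (happ t x)) ` elts \<alpha>"
  proof
    fix z
    assume z: "z \<in> elts t"
    then obtain x y where xy: "z = hpair x y"
      using seqs_hfun[OF assms(2)] unfolding hfun_def by blast
    then have "x \<in> elts \<alpha>" "happ t x = y"
      using seqs_hdom[OF assms(2)] seqs_hfun[OF assms(2)] z happ_eq unfolding hdom_def by blast+
    then show "z \<in> (\<lambda>x. hpair x (happ t x)) ` elts \<alpha>"
      using xy by blast
  qed
  then show "elts t \<prec> elts \<kappa>"
    using lesspoll_trans1[OF subset_image_lepoll elts_lesspoll_\<kappa>[OF assms(1)]] by blast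
  show "elts t \<subseteq> hered \<kappa>"
  proof
    fix z
    assume z: "z \<in> elts t"
    then obtain x y where xy: "z = hpair x y"
      using seqs_hfun[OF assms(2)] unfolding hfun_def by blast
    then have "x \<in> elts \<alpha>" "y \<in> hered \<kappa>"
      using assms(2) z unfolding seqs_def hdom_def hran_def by blast+
    then show "z \<in> hered \<kappa>"
      unfolding xy using hered_hpair hered_Ord Ord_trans[OF Ord_\<kappa> assms(1)] by blast
  qed
qed

text \<open>Here the transitive closures may have size \<kappa> itself, so the bound comes from the
  square of \<kappa> having size \<kappa>.\<close>

lemma hered_plusI:
  assumes "elts x \<subseteq> hered_plus \<kappa>" "elts x \<lesssim> elts \<kappa>"
  shows "x \<in> hered_plus \<kappa>"
proof -
  have "(\<Union>y\<in>elts x. trcl y) \<lesssim> elts x \<times> elts \<kappa>"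
    by (rule UN_lepoll_Times) (use assms in \<open>auto simp: hered_plus_def\<close>)
  then have U: "(\<Union>y\<in>elts x. trcl y) \<lesssim> elts \<kappa>"
    using lepoll_trans[OF _ Times_lepoll_infinite[OF assms(2) lepoll_refl infinite_\<kappa>]] by blast
  have "(\<Union>A\<in>{elts x, \<Union>y\<in>elts x. trcl y}. A) \<lesssim> {elts x, \<Union>y\<in>elts x. trcl y} \<times> elts \<kappa>"
    by (rule UN_lepoll_Times) (use assms U in auto)
  moreover have "{elts x, \<Union>y\<in>elts x. trcl y} \<lesssim> elts \<kappa>"
    by (rule finite_lepoll_infinite[OF infinite_\<kappa>]) simp
  ultimately have "(\<Union>A\<in>{elts x, \<Union>y\<in>elts x. trcl y}. A) \<lesssim> elts \<kappa>"
    using lepoll_trans[OF _ Times_lepoll_infinite[OF _ lepoll_refl infinite_\<kappa>]] by blast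
  then show ?thesis
    unfolding hered_plus_def mem_Collect_eq by (subst trcl_unfold) simp
qed

lemma hered_plus_in: "x \<in> hered_plus \<kappa> \<Longrightarrow> y \<in> elts x \<Longrightarrow> y \<in> hered_plus \<kappa>"
proof -
  assume "x \<in> hered_plus \<kappa>" "y \<in> elts x"
  then have "trcl y \<subseteq> trcl x"
    by (subst trcl_unfold[of x]) blast
  then show ?thesis
    using \<open>x \<in> hered_plus \<kappa>\<close> lepoll_trans[OF subset_imp_lepoll] unfolding hered_plus_def by blast
qed

lemma hered_plus_finite: "finite A \<Longrightarrow> A \<subseteq> hered_plus \<kappa> \<Longrightarrow> set_of A \<in> hered_plus \<kappa>"
  by (rule hered_plusI) (auto simp: elts_finite finite_lepoll_infinite infinite_\<kappa>)

lemma hered_plus_hpair: "a \<in> hered_plus \<kappa> \<Longrightarrow> b \<in> hered_plus \<kappa> \<Longrightarrow> hpair a b \<in> hered_plus \<kappa>"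
  unfolding hpair_def by (intro hered_plus_finite) (auto intro!: hered_plus_finite)

lemma hered_imp_hered_plus: "x \<in> hered \<kappa> \<Longrightarrow> x \<in> hered_plus \<kappa>"
  unfolding hered_def hered_plus_def using lesspoll_imp_lepoll by blast

section \<open>Elementary submodels\<close>

definition Fall :: "nat \<Rightarrow> fm \<Rightarrow> fm" where "Fall n \<phi> = Neg (Exi n (Neg \<phi>))"
definition Fiff :: "fm \<Rightarrow> fm \<Rightarrow> fm" where "Fiff \<phi> \<psi> = Conj (Neg (Conj \<phi> (Neg \<psi>))) (Neg (Conj \<psi> (Neg \<phi>)))"
definition For :: "fm \<Rightarrow> fm \<Rightarrow> fm" where "For \<phi> \<psi> = Neg (Conj (Neg \<phi>) (Neg \<psi>))"

lemma sat_connectives [simp]: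
  "sat A (Fall n \<phi>) v \<longleftrightarrow> (\<forall>x\<in>A. sat A \<phi> (v(n := x)))"
  "sat A (Fiff \<phi> \<psi>) v \<longleftrightarrow> (sat A \<phi> v \<longleftrightarrow> sat A \<psi> v)"
  "sat A (For \<phi> \<psi>) v \<longleftrightarrow> sat A \<phi> v \<or> sat A \<psi> v"
  unfolding Fall_def Fiff_def For_def by auto

text \<open>The variables 8 and 9 are scratch: \<open>Fpair z x y\<close> is meant for \<open>z, x, y < 8\<close>.\<close>

definition Fpair :: "nat \<Rightarrow> nat \<Rightarrow> nat \<Rightarrow> fm" where
  "Fpair z x y = Fall 8 (Fiff (Mem 8 z) (For (Fall 9 (Fiff (Mem 9 8) (Eql 9 x)))
     (Fall 9 (Fiff (Mem 9 8) (For (Eql 9 x) (Eql 9 y))))))"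

text \<open>Quantifying over \<open>hered_plus \<kappa>\<close> only loses nothing: it is
  transitive, so it contains all elements of \<open>v z\<close>, and it contains the singleton and
  the pair that the formula describes.\<close>

lemma sat_Fpair:
  assumes "z < 8" "x < 8" "y < 8" and v: "v z \<in> hered_plus \<kappa>" "v x \<in> hered_plus \<kappa>" "v y \<in> hered_plus \<kappa>"
  shows "sat (hered_plus \<kappa>) (Fpair z x y) v \<longleftrightarrow> v z = hpair (v x) (v y)"
proof -
  have ne: "z \<noteq> 8" "x \<noteq> 8" "y \<noteq> 8" "x \<noteq> 9" "y \<noteq> 9"
    using assms by auto
  have sing: "(\<forall>w\<in>hered_plus \<kappa>. w \<in> elts u \<longleftrightarrow> w = v x) \<longleftrightarrow> u = set_of {v x}" if u: "u \<in> hered_plus \<kappa>" for u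
  proof -
    have "(\<forall>w\<in>hered_plus \<kappa>. w \<in> elts u \<longleftrightarrow> w = v x) \<longleftrightarrow> elts u = {v x}"
      using hered_plus_in[OF u] v by blast
    also have "\<dots> \<longleftrightarrow> u = set_of {v x}"
      using elts_sing elts_inject by metis
    finally show ?thesis .
  qed
  have pair: "(\<forall>w\<in>hered_plus \<kappa>. w \<in> elts u \<longleftrightarrow> w = v x \<or> w = v y) \<longleftrightarrow> u = set_of {v x, v y}" if u: "u \<in> hered_plus \<kappa>" for u
  proof -
    have "(\<forall>w\<in>hered_plus \<kappa>. w \<in> elts u \<longleftrightarrow> w = v x \<or> w = v y) \<longleftrightarrow> elts u = {v x, v y}"
      using hered_plus_in[OF u] v by blast
    also have "\<dots> \<longleftrightarrow> u = set_of {v x, v y}"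
      using elts_pair elts_inject by metis
    finally show ?thesis .
  qed
  have "sat (hered_plus \<kappa>) (Fpair z x y) v \<longleftrightarrow>
    (\<forall>u\<in>hered_plus \<kappa>. u \<in> elts (v z) \<longleftrightarrow> (\<forall>w\<in>hered_plus \<kappa>. w \<in> elts u \<longleftrightarrow> w = v x) \<or> (\<forall>w\<in>hered_plus \<kappa>. w \<in> elts u \<longleftrightarrow> w = v x \<or> w = v y))"
    using ne by (simp add: Fpair_def)
  also have "\<dots> \<longleftrightarrow> (\<forall>u\<in>hered_plus \<kappa>. u \<in> elts (v z) \<longleftrightarrow> u = set_of {v x} \<or> u = set_of {v x, v y})"
    by (rule ball_cong[OF refl], subst sing, assumption, subst pair, assumption, rule refl)
  also have "\<dots> \<longleftrightarrow> elts (v z) = {set_of {v x}, set_of {v x, v y}}"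
  proof -
    have "set_of {v x} \<in> hered_plus \<kappa>" "set_of {v x, v y} \<in> hered_plus \<kappa>"
      using v by (auto intro!: hered_plus_finite)
    then show ?thesis
      using hered_plus_in[OF v(1)] by blast
  qed
  also have "\<dots> \<longleftrightarrow> v z = hpair (v x) (v y)"
    using hpair_elts elts_inject by metis
  finally show ?thesis .
qed

text \<open>The functions \<open>F\<close> and \<open>g\<close> are coded into the single parameter \<open>p\<close>, so that every
  elementary submodel containing \<open>p\<close> is closed under both.\<close>

lemma elem_submodel_closed:
  assumes M: "elem_submodel M (hered_plus \<kappa>)"
    and F: "\<And>\<xi>. \<xi> \<in> elts \<kappa> \<Longrightarrow> F \<xi> \<in> hered_plus \<kappa>" and g: "\<And>\<xi>. \<xi> \<in> elts \<kappa> \<Longrightarrow> g \<xi> \<in> hered_plus \<kappa>"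
    and p: "set_of ((\<lambda>\<xi>. hpair \<xi> (hpair (F \<xi>) (g \<xi>))) ` elts \<kappa>) \<in> M"
    and \<xi>: "\<xi> \<in> elts \<kappa>" "\<xi> \<in> M"
  shows "F \<xi> \<in> M \<and> g \<xi> \<in> M"
proof -
  let ?H = "hered_plus \<kappa>" and ?p = "set_of ((\<lambda>\<xi>. hpair \<xi> (hpair (F \<xi>) (g \<xi>))) ` elts \<kappa>)"
  \<comment> \<open>The formula says that the pair of variable 1 with the pair of variables 2 and 3
    belongs to variable 0. Variable 0 holds the code and 1 holds \<xi>; 4 and 5 are the outer and
    the inner pair.\<close>
  define \<phi> where "\<phi> = Exi 4 (Conj (Mem 4 0) (Exi 5 (Conj (Fpair 5 2 3) (Fpair 4 1 5))))"
  \<comment> \<open>Variable 1 must denote \<xi>; giving \<xi> to all the others too keeps the range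
    of the assignment in \<open>M\<close>.\<close>
  define v where "v n = (if n = (0::nat) then ?p else \<xi>)" for n
  have sub: "M \<subseteq> ?H" and el: "\<And>\<psi> v. range v \<subseteq> M \<Longrightarrow> sat M \<psi> v \<longleftrightarrow> sat ?H \<psi> v"
    using M unfolding elem_submodel_def by auto
  have pH: "?p \<in> ?H" and \<xi>H: "\<xi> \<in> ?H"
    using p \<xi> sub by blast+
  have elp: "elts ?p = (\<lambda>\<xi>. hpair \<xi> (hpair (F \<xi>) (g \<xi>))) ` elts \<kappa>"
    by (rule elts_hgraph)
  have dec: "sat ?H \<phi> (v(2 := x, 3 := y)) \<longleftrightarrow> x = F \<xi> \<and> y = g \<xi>" if xy: "x \<in> ?H" "y \<in> ?H" for x y
  proof -
    have "sat ?H \<phi> (v(2 := x, 3 := y)) \<longleftrightarrow> (\<exists>z\<in>?H. z \<in> elts ?p \<and> (\<exists>w\<in>?H. w = hpair x y \<and> z = hpair \<xi> w))"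
      unfolding \<phi>_def using xy \<xi>H
      by (simp add: sat_Fpair v_def cong: conj_cong bex_cong)
    also have "\<dots> \<longleftrightarrow> hpair \<xi> (hpair x y) \<in> elts ?p"
      using hered_plus_in[OF pH] hered_plus_hpair[OF xy] by blast
    also have "\<dots> \<longleftrightarrow> x = F \<xi> \<and> y = g \<xi>"
      unfolding elp using \<xi>(1) by auto
    finally show ?thesis .
  qed
  have rv: "range v \<subseteq> M"
    unfolding v_def using p \<xi> by auto
  \<comment> \<open>The existential statement goes down to \<open>M\<close>; the witnesses found
    there go back up, where they can only be the two values because the coded relation is
    functional.\<close>
  have "sat ?H (Exi 2 (Exi 3 \<phi>)) v"
    using dec F[OF \<xi>(1)] g[OF \<xi>(1)] by auto
  then have "sat M (Exi 2 (Exi 3 \<phi>)) v"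
    using el[OF rv] by blast
  then obtain x y where xy: "x \<in> M" "y \<in> M" "sat M \<phi> (v(2 := x, 3 := y))"
    by auto
  moreover have "range (v(2 := x, 3 := y)) \<subseteq> M"
    using rv xy(1,2) by auto
  ultimately have "sat ?H \<phi> (v(2 := x, 3 := y))"
    using el by blast
  then show ?thesis
    using dec xy sub by blast
qed

lemma hgraph2_hered_plus:
  assumes F: "\<And>\<xi>. \<xi> \<in> elts \<kappa> \<Longrightarrow> F \<xi> \<in> hered_plus \<kappa>" and g: "\<And>\<xi>. \<xi> \<in> elts \<kappa> \<Longrightarrow> g \<xi> \<in> hered_plus \<kappa>"
  shows "set_of ((\<lambda>\<xi>. hpair \<xi> (hpair (F \<xi>) (g \<xi>))) ` elts \<kappa>) \<in> hered_plus \<kappa>"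
proof (rule hered_plusI)
  show "elts (set_of ((\<lambda>\<xi>. hpair \<xi> (hpair (F \<xi>) (g \<xi>))) ` elts \<kappa>)) \<subseteq> hered_plus \<kappa>"
    unfolding elts_hgraph using hered_plus_hpair F g hered_imp_hered_plus[OF hered_Ord] by blast
  show "elts (set_of ((\<lambda>\<xi>. hpair \<xi> (hpair (F \<xi>) (g \<xi>))) ` elts \<kappa>)) \<lesssim> elts \<kappa>"
    unfolding elts_hgraph by (rule image_lepoll)
qed

end

section \<open>The tree\<close>

text \<open>The principle in the form in which it is consumed: one target \<Omega> with one
  parameter, one block \<open>B0\<close> of the partition, and only the first point after \<gamma>.
  The condition of having fewer than two members is spelled out as equality of any two members of
  \<open>CC \<alpha>\<close>.\<close>

locale tree_data = regular_cardinal \<kappa> for \<kappa> :: "'k hset" +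
  fixes \<chi> \<sigma> lam :: "'k hset" and CC :: "'k hset \<Rightarrow> 'k hset set" and B0 :: "'k hset set"
  assumes \<chi>_regular: "regular_card \<chi>" and \<chi>_\<kappa>: "\<chi> \<in> elts \<kappa>" and closed: "lt_closed \<chi> \<kappa>"
    and \<sigma>_\<kappa>: "\<sigma> \<in> elts \<kappa>" and lam_card: "inf_card lam" and lam_\<kappa>: "lam \<in> elts \<kappa>"
    and CC: "\<alpha> \<in> elts \<kappa> \<Longrightarrow> limit \<alpha> \<Longrightarrow>
      CC \<alpha> \<subseteq> {C \<in> clubfuns \<kappa>. alpha_of C = \<alpha>} \<and> CC \<alpha> \<noteq> {} \<and> CC \<alpha> \<prec> elts \<kappa> \<and>
      (\<forall>C\<in>CC \<alpha>. \<forall>\<alpha>'\<in>acc_pts (hdom C). \<exists>D\<in>CC \<alpha>'. sqsub \<chi> D C)"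
    and guess: "\<Omega> \<subseteq> hered \<kappa> \<Longrightarrow> p \<in> hered_plus \<kappa> \<Longrightarrow> \<Lambda> \<in> elts lam \<Longrightarrow>
      stationary_in {\<alpha> \<in> E_ge \<kappa> \<chi> \<inter> E_gt \<kappa> \<Lambda>. (\<forall>C\<in>CC \<alpha>. \<forall>D\<in>CC \<alpha>. C = D) \<and>
        (\<forall>C\<in>CC \<alpha>. osup {\<gamma> \<in> hdom C. succ_n 1 (hdom C - elts \<gamma>) \<subseteq> guessing_set \<kappa> B0 \<Omega> p C} = \<alpha>)} \<kappa>"
begin

lemma Ord_below: "\<alpha> \<in> elts \<kappa> \<Longrightarrow> Ord \<alpha>"
  using Ord_\<kappa> Ord_in by blast

lemma below_trans: "\<alpha> \<in> elts \<kappa> \<Longrightarrow> \<beta> \<in> elts \<alpha> \<Longrightarrow> \<beta> \<in> elts \<kappa>"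
  using Ord_\<kappa> Ord_trans by blast

lemma finite_Ord_lam:
  assumes "Ord \<alpha>" "finite (elts \<alpha>)"
  shows "\<alpha> \<in> elts lam"
proof (rule ccontr)
  have ord: "Ord lam" and inf: "infinite (elts lam)"
    using lam_card unfolding inf_card_def Card_def by auto
  assume "\<alpha> \<notin> elts lam"
  then have "lam \<le> \<alpha>"
    using Ord_not_le[OF ord assms(1)] by blast
  then show False
    using inf assms(2) finite_subset unfolding less_eq_hset_def by blast
qed

text \<open>Zero and one serve as labels of successors, one and two as sizes of the families of
  nodes that are sealed together.\<close>

lemma zero_lam: "set_of {} \<in> elts lam" and one_lam: "osucc (set_of {}) \<in> elts lam"
  and two_lam: "osucc (osucc (set_of {})) \<in> elts lam"
  by (rule finite_Ord_lam; simp add: Ord_zero Ord_osucc)+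

lemma CC_club:
  assumes "\<alpha> \<in> elts \<kappa>" "limit \<alpha>" "C \<in> CC \<alpha>"
  shows "hfun C" "club_in (hdom C) \<alpha>" "hdom C \<subseteq> elts \<alpha>" "\<forall>\<xi>\<in>elts \<alpha>. \<exists>d\<in>hdom C. \<xi> \<in> elts d"
proof -
  have C: "C \<in> clubfuns \<kappa>" "osup (hdom C) = \<alpha>"
    using CC[OF assms(1,2)] assms(3) unfolding alpha_of_def by blast+
  then show "hfun C" and club: "club_in (hdom C) \<alpha>"
    unfolding clubfuns_def by auto
  then show sub: "hdom C \<subseteq> elts \<alpha>"
    unfolding club_in_def by blast
  show "\<forall>\<xi>\<in>elts \<alpha>. \<exists>d\<in>hdom C. \<xi> \<in> elts d"
    using osup_eq_iff[OF Ord_below[OF assms(1)] sub] C(2) by blast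
qed

text \<open>\<open>W\<close> stands for the tree up to level \<open>c\<close>; levels are recognised
  by the domains of their nodes, since this is used while the levels are still being defined. The
  order of quantifiers matters: \<open>g\<close> comes before \<open>y\<close> in the premise as in
  the conclusion, so that all nodes of level \<open>b\<close> avoid \<open>X\<close> at the same
  level.\<close>

definition stepspec :: "'k hset set \<Rightarrow> 'k hset \<Rightarrow> 'k hset \<Rightarrow> 'k hset set \<Rightarrow> ('k hset \<Rightarrow> 'k hset) \<Rightarrow> bool" where
  "stepspec W b c X N \<longleftrightarrow>
    (\<forall>y. y \<in> W \<and> hdom y = elts b \<longrightarrow> N y \<in> W \<and> hdom (N y) = elts c \<and> y \<le> N y) \<and>
    ((\<exists>g\<in>elts c. b \<in> elts g \<and>
        (\<forall>y. y \<in> W \<and> hdom y = elts b \<longrightarrow> (\<exists>z. z \<in> W \<and> hdom z = elts g \<and> y \<le> z \<and> z \<notin> X))) \<longrightarrow>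
     (\<exists>g\<in>elts c. b \<in> elts g \<and> (\<forall>y. y \<in> W \<and> hdom y = elts b \<longrightarrow> hrestrict (N y) g \<notin> X)))"

definition stepf :: "'k hset set \<Rightarrow> 'k hset \<Rightarrow> 'k hset \<Rightarrow> 'k hset set \<Rightarrow> 'k hset \<Rightarrow> 'k hset" where
  "stepf W b c X = (SOME N. stepspec W b c X N)"

text \<open>\<open>U\<close> is the part of the tree built so far, of which a step to
  \<open>c\<close> consults only nodes of length at most \<open>c\<close>. The clause
  \<open>elts c \<subseteq> hdom t\<close> confines the condition to steps completed within
  \<open>t\<close>, so that it applies to initial segments of a thread as well.\<close>

definition follows :: "'k hset set \<Rightarrow> 'k hset \<Rightarrow> 'k hset \<Rightarrow> 'k hset \<Rightarrow> bool" where
  "follows U C e t \<longleftrightarrow> (\<forall>b c. next_in (hdom C) b c \<and> e \<le> b \<and> elts c \<subseteq> hdom t \<longrightarrow>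
     hrestrict t c = stepf {u \<in> U. hdom u \<subseteq> elts c} b c (elts (happ C c)) (hrestrict t b))"

text \<open>\<open>elts \<alpha>\<close>, together with \<omega> inside \<open>elts lam\<close>,
  gives prolificness; \<sigma> gives splitting; and \<open>lam\<close> gives every node more
  immediate successors than an ascending path of smaller width can occupy on one level.\<close>

definition succ_vals :: "'k hset \<Rightarrow> 'k hset set" where
  "succ_vals \<alpha> = elts \<alpha> \<union> elts \<sigma> \<union> elts lam"

text \<open>The root is the empty sequence, which is the empty set. Since \<open>U\<close> is the
  undivided union of the lower levels, the successor case finds the preceding level by matching
  \<open>\<alpha> = osucc \<beta>\<close> and \<open>hdom y = elts \<beta>\<close>.\<close>

definition lstep :: "'k hset \<Rightarrow> 'k hset set \<Rightarrow> 'k hset set" where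
  "lstep \<alpha> U = (if \<alpha> = set_of {} then {set_of {}}
     else if limit \<alpha> then {t \<in> seqs \<alpha> (hered \<kappa>). (\<forall>\<beta>\<in>elts \<alpha>. hrestrict t \<beta> \<in> U) \<and>
       (cf \<alpha> < \<chi> \<or> (\<exists>C\<in>CC \<alpha>. \<exists>e\<in>hdom C. follows U C e t))}
     else {snoc \<beta> y i | \<beta> y i. Ord \<beta> \<and> \<alpha> = osucc \<beta> \<and> y \<in> U \<and> hdom y = elts \<beta> \<and> i \<in> succ_vals \<beta>})"

definition L :: "'k hset \<Rightarrow> 'k hset set" where
  "L = wfrec {(x, y). x \<in> elts y} (\<lambda>f \<alpha>. lstep \<alpha> (\<Union>\<beta>\<in>elts \<alpha>. f \<beta>))"

definition T :: "'k hset set" where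
  "T = (\<Union>\<alpha>\<in>elts \<kappa>. L \<alpha>)"

section \<open>Recursion equations of the levels\<close>

lemma L_unfold: "L \<alpha> = lstep \<alpha> (\<Union>\<beta>\<in>elts \<alpha>. L \<beta>)"
proof -
  have "L \<alpha> = lstep \<alpha> (\<Union>\<beta>\<in>elts \<alpha>. cut L {(x, y). x \<in> elts y} \<alpha> \<beta>)"
    unfolding L_def by (subst wfrec[OF wf_elts]) simp
  also have "(\<Union>\<beta>\<in>elts \<alpha>. cut L {(x, y). x \<in> elts y} \<alpha> \<beta>) = (\<Union>\<beta>\<in>elts \<alpha>. L \<beta>)"
    by (rule SUP_cong) (auto simp: cut_apply)
  finally show ?thesis .
qed

lemma L_zero: "L (set_of {}) = {set_of {}}"
  by (subst L_unfold) (simp add: lstep_def)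

lemma succ_vals_\<kappa>:
  assumes "\<alpha> \<in> elts \<kappa>"
  shows "succ_vals \<alpha> \<subseteq> elts \<kappa>" "succ_vals \<alpha> \<prec> elts \<kappa>"
  unfolding succ_vals_def using below_trans assms \<sigma>_\<kappa> lam_\<kappa>
  by (blast, auto intro!: Un_lesspoll_\<kappa> elts_lesspoll_\<kappa>)

lemma L_seqs: "\<alpha> \<in> elts \<kappa> \<Longrightarrow> L \<alpha> \<subseteq> seqs \<alpha> (hered \<kappa>)"
proof (induction \<alpha> rule: elts_induct)
  case (step \<alpha>)
  have IH: "L \<beta> \<subseteq> seqs \<beta> (hered \<kappa>)" if "\<beta> \<in> elts \<alpha>" for \<beta>
    using step that below_trans by blast
  show ?case
    using Ord_below[OF step.prems]
  proof (cases rule: Ord_cases)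
    case 1
    have "set_of {} \<in> seqs (set_of {}) (hered \<kappa>)"
      unfolding seqs_def hfun_def hdom_def hran_def by simp
    then show ?thesis
      using L_zero 1 by simp
  next
    case (2 \<beta>)
    have neq: "\<alpha> \<noteq> set_of {}" "\<not> limit \<alpha>"
      using 2 not_limit_osucc by (metis elts_osucc elts_zero insert_not_empty, simp)
    show ?thesis
    proof
      fix t
      assume "t \<in> L \<alpha>"
      then have "t \<in> {snoc \<beta> y i | \<beta> y i. Ord \<beta> \<and> \<alpha> = osucc \<beta> \<and> y \<in> (\<Union>\<beta>\<in>elts \<alpha>. L \<beta>) \<and> hdom y = elts \<beta> \<and> i \<in> succ_vals \<beta>}"
        using neq by (subst (asm) L_unfold) (simp only: lstep_def if_False)
      then obtain \<gamma> y i where y: "Ord \<gamma>" "\<alpha> = osucc \<gamma>" "t = snoc \<gamma> y i" "y \<in> (\<Union>\<beta>\<in>elts \<alpha>. L \<beta>)" "hdom y = elts \<gamma>"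
        "i \<in> succ_vals \<gamma>"
        by blast
      then obtain \<beta>' where \<beta>': "\<beta>' \<in> elts \<alpha>" "y \<in> L \<beta>'"
        by blast
      then have "y \<in> seqs \<beta>' (hered \<kappa>)"
        using IH by blast
      then have y': "y \<in> seqs \<gamma> (hered \<kappa>)"
        using y(5) seqs_hdom_iff by metis
      have "\<gamma> \<in> elts \<alpha>"
        using y(2) by simp
      then have "\<gamma> \<in> elts \<kappa>"
        using below_trans step.prems by blast
      then have "i \<in> hered \<kappa>"
        using y(6) succ_vals_\<kappa>(1) hered_Ord by blast
      then show "t \<in> seqs \<alpha> (hered \<kappa>)"
        unfolding y(2,3) using snoc_seqs[OF y'] by blast
    qed
  next
    case 3
    then have "\<alpha> \<noteq> set_of {}"
      using not_limit_zero by metis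
    then show ?thesis
      using 3 by (subst L_unfold) (auto simp: lstep_def)
  qed
qed

lemma L_hdom: "\<alpha> \<in> elts \<kappa> \<Longrightarrow> t \<in> L \<alpha> \<Longrightarrow> hdom t = elts \<alpha>"
  using L_seqs seqs_hdom by blast

lemma L_hfun: "\<alpha> \<in> elts \<kappa> \<Longrightarrow> t \<in> L \<alpha> \<Longrightarrow> hfun t"
  using L_seqs seqs_hfun by blast

lemma L_self: "\<alpha> \<in> elts \<kappa> \<Longrightarrow> t \<in> L \<alpha> \<Longrightarrow> hrestrict t \<alpha> = t"
  using L_seqs hrestrict_self by blast

lemma L_unique: "\<alpha> \<in> elts \<kappa> \<Longrightarrow> \<beta> \<in> elts \<kappa> \<Longrightarrow> t \<in> L \<alpha> \<Longrightarrow> t \<in> L \<beta> \<Longrightarrow> \<alpha> = \<beta>"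
  using L_hdom elts_inject by metis

lemma UN_L_hdom:
  assumes "A \<subseteq> elts \<kappa>" "hdom t = elts \<beta>"
  shows "t \<in> (\<Union>\<alpha>\<in>A. L \<alpha>) \<longleftrightarrow> \<beta> \<in> A \<and> t \<in> L \<beta>"
proof
  assume "t \<in> (\<Union>\<alpha>\<in>A. L \<alpha>)"
  then obtain \<alpha> where \<alpha>: "\<alpha> \<in> A" "t \<in> L \<alpha>"
    by blast
  then have "elts \<alpha> = elts \<beta>"
    using L_hdom assms by blast
  then show "\<beta> \<in> A \<and> t \<in> L \<beta>"
    using \<alpha> elts_inject by metis
qed blast

lemma T_hdom: "hdom t = elts \<beta> \<Longrightarrow> t \<in> T \<longleftrightarrow> \<beta> \<in> elts \<kappa> \<and> t \<in> L \<beta>"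
  unfolding T_def by (rule UN_L_hdom) auto

lemma L_succ:
  assumes "\<alpha> \<in> elts \<kappa>"
  shows "L (osucc \<alpha>) = {snoc \<alpha> y i | y i. y \<in> L \<alpha> \<and> i \<in> succ_vals \<alpha>}"
proof -
  have neq: "osucc \<alpha> \<noteq> set_of {}" "\<not> limit (osucc \<alpha>)"
    using not_limit_osucc by (metis elts_osucc elts_zero insert_not_empty, simp)
  have sub: "elts (osucc \<alpha>) \<subseteq> elts \<kappa>"
    using below_trans assms by auto
  have "L (osucc \<alpha>) = {snoc \<beta> y i | \<beta> y i. Ord \<beta> \<and> osucc \<alpha> = osucc \<beta> \<and> y \<in> (\<Union>\<beta>\<in>elts (osucc \<alpha>). L \<beta>) \<and> hdom y = elts \<beta> \<and> i \<in> succ_vals \<beta>}"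
    by (subst L_unfold) (use neq in \<open>simp only: lstep_def if_False\<close>)
  also have "\<dots> = {snoc \<alpha> y i | y i. y \<in> (\<Union>\<beta>\<in>elts (osucc \<alpha>). L \<beta>) \<and> hdom y = elts \<alpha> \<and> i \<in> succ_vals \<alpha>}"
    using osucc_inject Ord_below[OF assms] by blast
  also have "\<dots> = {snoc \<alpha> y i | y i. y \<in> L \<alpha> \<and> i \<in> succ_vals \<alpha>}"
  proof -
    have *: "y \<in> (\<Union>\<beta>\<in>elts (osucc \<alpha>). L \<beta>) \<and> hdom y = elts \<alpha> \<longleftrightarrow> y \<in> L \<alpha>" for y
      using UN_L_hdom[OF sub, of y \<alpha>] L_hdom[OF assms] by auto
    show ?thesis
      by (simp only: conj_assoc[symmetric] *)
  qed
  finally show ?thesis .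
qed

lemma T_below:
  assumes "c \<in> elts \<alpha>" "\<alpha> \<in> elts \<kappa>"
  shows "{u \<in> (\<Union>\<beta>\<in>elts \<alpha>. L \<beta>). hdom u \<subseteq> elts c} = {u \<in> T. hdom u \<subseteq> elts c}"
proof -
  have "\<beta> \<in> elts \<alpha>" if "\<beta> \<in> elts \<kappa>" "u \<in> L \<beta>" "hdom u \<subseteq> elts c" for u \<beta>
  proof -
    have "\<beta> \<le> c"
      using that L_hdom unfolding less_eq_hset_def by blast
    then show ?thesis
      using Ord_le_in Ord_below assms that(1) by blast
  qed
  then show ?thesis
    unfolding T_def using below_trans assms by blast
qed

text \<open>Every club point is below \<alpha>, and the tree up to that point is already complete
  when level \<alpha> is formed. This frees the limit condition from its stage in the
  recursion.\<close>

lemma follows_T: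
  assumes "\<alpha> \<in> elts \<kappa>" "hdom C \<subseteq> elts \<alpha>"
  shows "follows (\<Union>\<beta>\<in>elts \<alpha>. L \<beta>) C e t \<longleftrightarrow> follows T C e t"
proof -
  have "{u \<in> (\<Union>\<beta>\<in>elts \<alpha>. L \<beta>). hdom u \<subseteq> elts c} = {u \<in> T. hdom u \<subseteq> elts c}" if "next_in (hdom C) b c" for b c
    by (rule T_below) (use that assms in \<open>auto simp: next_in_def\<close>)
  then show ?thesis
    unfolding follows_def by (metis (no_types, lifting))
qed

lemma L_limit:
  assumes "\<alpha> \<in> elts \<kappa>" "limit \<alpha>"
  shows "t \<in> L \<alpha> \<longleftrightarrow> t \<in> seqs \<alpha> (hered \<kappa>) \<and> (\<forall>\<beta>\<in>elts \<alpha>. hrestrict t \<beta> \<in> L \<beta>) \<and>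
    (cf \<alpha> < \<chi> \<or> (\<exists>C\<in>CC \<alpha>. \<exists>e\<in>hdom C. follows T C e t))"
proof -
  have sub: "elts \<alpha> \<subseteq> elts \<kappa>"
    using below_trans assms by blast
  have "\<alpha> \<noteq> set_of {}"
    using not_limit_zero assms by metis
  then have "t \<in> L \<alpha> \<longleftrightarrow> t \<in> seqs \<alpha> (hered \<kappa>) \<and> (\<forall>\<beta>\<in>elts \<alpha>. hrestrict t \<beta> \<in> (\<Union>\<beta>\<in>elts \<alpha>. L \<beta>)) \<and>
    (cf \<alpha> < \<chi> \<or> (\<exists>C\<in>CC \<alpha>. \<exists>e\<in>hdom C. follows (\<Union>\<beta>\<in>elts \<alpha>. L \<beta>) C e t))"
    by (subst L_unfold) (use assms in \<open>simp add: lstep_def\<close>)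
  moreover have "hrestrict t \<beta> \<in> (\<Union>\<beta>\<in>elts \<alpha>. L \<beta>) \<longleftrightarrow> hrestrict t \<beta> \<in> L \<beta>"
    if "t \<in> seqs \<alpha> (hered \<kappa>)" "\<beta> \<in> elts \<alpha>" for \<beta>
  proof -
    have "\<beta> \<le> \<alpha>"
      using that Ord_in_imp_le Ord_below assms by blast
    then have "hdom (hrestrict t \<beta>) = elts \<beta>"
      using hrestrict_seqs seqs_hdom that by blast
    then show ?thesis
      using UN_L_hdom[OF sub] that by blast
  qed
  moreover have "follows (\<Union>\<beta>\<in>elts \<alpha>. L \<beta>) C e t \<longleftrightarrow> follows T C e t" if "C \<in> CC \<alpha>" for C e
    using follows_T CC_club(3)[OF assms that] assms(1) by blast
  ultimately show ?thesis
    by (metis (no_types, lifting))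
qed

lemma L_restrict: "\<alpha> \<in> elts \<kappa> \<Longrightarrow> t \<in> L \<alpha> \<Longrightarrow> \<beta> \<in> elts \<alpha> \<Longrightarrow> hrestrict t \<beta> \<in> L \<beta>"
proof (induction \<alpha> arbitrary: t rule: elts_induct)
  case (step \<alpha>)
  show ?case
    using Ord_below[OF step.prems(1)]
  proof (cases rule: Ord_cases)
    case 1
    then show ?thesis
      using step.prems by simp
  next
    case (2 \<gamma>)
    have \<gamma>: "\<gamma> \<in> elts \<alpha>" "\<gamma> \<in> elts \<kappa>"
      using 2 below_trans step.prems(1) by auto
    obtain y i where y: "t = snoc \<gamma> y i" "y \<in> L \<gamma>"
      using step.prems(2) L_succ[OF \<gamma>(2)] 2 by blast
    have ys: "y \<in> seqs \<gamma> (hered \<kappa>)"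
      using L_seqs \<gamma> y by blast
    have "\<beta> \<le> \<gamma>"
      using step.prems(3) 2 Ord_in_imp_le[OF Ord_below[OF \<gamma>(2)]] by auto
    then have eq: "hrestrict t \<beta> = hrestrict y \<beta>"
      unfolding y(1) using hrestrict_snoc_le[OF ys] by blast
    show ?thesis
    proof (cases "\<beta> = \<gamma>")
      case True
      then show ?thesis
        using eq y(2) L_self \<gamma> by simp
    next
      case False
      then have "\<beta> \<in> elts \<gamma>"
        using step.prems(3) 2 by simp
      then show ?thesis
        unfolding eq using step.IH \<gamma> y(2) by blast
    qed
  next
    case 3
    then show ?thesis
      using L_limit step.prems by blast
  qed
qed

lemma L_restrict_le:
  assumes "\<alpha> \<in> elts \<kappa>" "t \<in> L \<alpha>" "Ord \<beta>" "\<beta> \<le> \<alpha>"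
  shows "hrestrict t \<beta> \<in> L \<beta>"
  using L_restrict[OF assms(1,2)] L_self[OF assms(1,2)] Ord_le_iff[OF assms(3) Ord_below[OF assms(1)]] assms(2,4)
  by metis

lemma L_le_iff:
  assumes "\<alpha> \<in> elts \<kappa>" "t \<in> L \<alpha>" "\<beta> \<in> elts \<kappa>" "s \<in> L \<beta>"
  shows "s \<le> t \<longleftrightarrow> \<beta> \<le> \<alpha> \<and> hrestrict t \<beta> = s"
  using seqs_le_iff L_seqs assms by blast

lemma L_less_iff:
  assumes "\<alpha> \<in> elts \<kappa>" "t \<in> L \<alpha>" "\<beta> \<in> elts \<kappa>" "s \<in> L \<beta>"
  shows "s < t \<longleftrightarrow> \<beta> \<in> elts \<alpha> \<and> hrestrict t \<beta> = s"
  using seqs_less_iff[OF _ _ Ord_below[OF assms(1)] Ord_below[OF assms(3)]] L_seqs assms by blast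

lemma L_hrestrict_hrestrict:
  assumes "\<alpha> \<in> elts \<kappa>" "t \<in> L \<alpha>" "\<gamma> \<le> \<beta>"
  shows "hrestrict (hrestrict t \<beta>) \<gamma> = hrestrict t \<gamma>"
  using hrestrict_hrestrict assms L_hfun by blast

subsection \<open>Threads through a club\<close>

text \<open>Induction along the club: at a successor point both threads apply the same step function
  to the same node, and at an accumulation point they are unions of the same pieces. It makes
  partial threads cohere and later bounds the number of threads.\<close>

lemma follows_unique:
  assumes \<alpha>: "\<alpha> \<in> elts \<kappa>" "limit \<alpha>" "C \<in> CC \<alpha>" and e: "e \<in> hdom C"
    and t: "t \<in> seqs \<beta> A" "follows T C e t" and s: "s \<in> seqs \<gamma> A'" "follows T C e s"
    and eq: "hrestrict t e = hrestrict s e"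
  shows "c \<in> hdom C \<Longrightarrow> e \<le> c \<Longrightarrow> c \<le> \<beta> \<Longrightarrow> c \<le> \<gamma> \<Longrightarrow> hrestrict t c = hrestrict s c"
proof (induction c rule: elts_induct)
  case (step c)
  note club = CC_club[OF \<alpha>]
  have ord: "Ord d" if "d \<in> hdom C" for d
    using that club(3) Ord_below below_trans \<alpha>(1) by blast
  have ordc: "Ord c"
    using ord step.prems by blast
  have below: "d \<le> c" if "d \<in> elts c" for d
    using Ord_in_imp_le[OF ordc that] .
  show ?case
  proof (cases "e = c")
    case True
    then show ?thesis
      using eq by simp
  next
    case False
    then have ec: "e \<in> elts c"
      using Ord_le_iff[OF ord[OF e] ordc] step.prems by blast
    have IH: "hrestrict t d = hrestrict s d" if "d \<in> hdom C" "d \<in> elts c" "e \<le> d" for d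
      using step.IH[OF that(2,1,3)] below[OF that(2)] step.prems(3,4) by (meson order_trans)
    consider b where "next_in (hdom C) b c" "e \<le> b" | "\<forall>\<xi>\<in>elts c. \<exists>d\<in>hdom C. d \<in> elts c \<and> \<xi> \<in> elts d"
      using club_next_or_acc[OF Ord_below[OF \<alpha>(1)] club(2) e ec step.prems(1)] by blast
    then show ?thesis
    proof cases
      case 1
      then have b: "b \<in> hdom C" "b \<in> elts c"
        unfolding next_in_def by auto
      have sub: "elts c \<subseteq> hdom t" "elts c \<subseteq> hdom s"
        using step.prems(3,4) seqs_hdom[OF t(1)] seqs_hdom[OF s(1)] unfolding less_eq_hset_def by auto
      have "hrestrict t c = stepf {u \<in> T. hdom u \<subseteq> elts c} b c (elts (happ C c)) (hrestrict t b)"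
        using t(2) 1 sub(1) unfolding follows_def by blast
      moreover have "hrestrict s c = stepf {u \<in> T. hdom u \<subseteq> elts c} b c (elts (happ C c)) (hrestrict s b)"
        using s(2) 1 sub(2) unfolding follows_def by blast
      ultimately show ?thesis
        using IH[OF b 1(2)] by simp
    next
      case 2
      show ?thesis
      proof (rule seqs_eqI[where D = "{d \<in> hdom C. d \<in> elts c \<and> e \<le> d}"])
        show "hrestrict t c \<in> seqs c A" "hrestrict s c \<in> seqs c A'"
          using hrestrict_seqs t(1) s(1) step.prems by blast+
        show "\<forall>\<xi>\<in>elts c. \<exists>d\<in>{d \<in> hdom C. d \<in> elts c \<and> e \<le> d}. \<xi> \<in> elts d"
        proof
          fix \<xi>
          assume \<xi>: "\<xi> \<in> elts c"
          then obtain d where d: "d \<in> hdom C" "d \<in> elts c" "\<xi> \<in> elts d"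
            using 2 by blast
          show "\<exists>d\<in>{d \<in> hdom C. d \<in> elts c \<and> e \<le> d}. \<xi> \<in> elts d"
          proof (cases "e \<le> d")
            case True
            then show ?thesis
              using d by blast
          next
            case False
            \<comment> \<open>Club points before \<open>e\<close> are absorbed by \<open>e\<close>
              itself, where the two threads agree by assumption.\<close>
            then have "d \<in> elts e"
              using Ord_not_le ord e d(1) by blast
            then have "\<xi> \<in> elts e"
              using Ord_trans[OF ord[OF e]] d(3) by blast
            then show ?thesis
              using e ec by blast
          qed
        qed
        fix d
        assume d: "d \<in> {d \<in> hdom C. d \<in> elts c \<and> e \<le> d}"
        then have "hrestrict t d = hrestrict s d" "d \<le> c"
          using IH below by blast+
        then show "hrestrict (hrestrict t c) d = hrestrict (hrestrict s c) d"
          using hrestrict_hrestrict seqs_hfun[OF t(1)] seqs_hfun[OF s(1)] by metis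
      qed
    qed
  qed
qed

text \<open>Choose a thread for every club point from \<open>e\<close> up to \<open>c\<close>; by
  \<open>follows_unique\<close> they cohere and can be glued. The result follows \<open>C\<close>
  because no step ends at \<open>c\<close>: being a limit of smaller club points, \<open>c\<close>
  has no immediate predecessor in the club.\<close>

lemma thread_union:
  assumes \<alpha>: "\<alpha> \<in> elts \<kappa>" "limit \<alpha>" "C \<in> CC \<alpha>" and e: "e \<in> hdom C" "e \<in> elts c"
    and c: "Ord c" "c \<le> \<alpha>" and cov: "\<forall>\<xi>\<in>elts c. \<exists>d\<in>hdom C. d \<in> elts c \<and> \<xi> \<in> elts d"
    and thr: "\<And>d. d \<in> hdom C \<Longrightarrow> d \<in> elts c \<Longrightarrow> e \<le> d \<Longrightarrow> \<exists>s\<in>L d. hrestrict s e = x \<and> follows T C e s"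
  shows "\<exists>s\<in>seqs c (hered \<kappa>). hrestrict s e = x \<and> follows T C e s \<and> (\<forall>\<beta>\<in>elts c. hrestrict s \<beta> \<in> L \<beta>)"
proof -
  note club = CC_club[OF \<alpha>]
  have ord: "Ord d" and \<kappa>: "d \<in> elts \<kappa>" if "d \<in> hdom C" for d
    using that club(3) Ord_below below_trans \<alpha>(1) by blast+
  define D where "D = {d \<in> hdom C. d \<in> elts c \<and> e \<le> d}"
  obtain f where f: "\<And>d. d \<in> D \<Longrightarrow> f d \<in> L d \<and> hrestrict (f d) e = x \<and> follows T C e (f d)"
    using thr unfolding D_def mem_Collect_eq by metis
  have D\<kappa>: "d \<in> elts \<kappa>" "d \<in> hdom C" "e \<le> d" "d \<in> elts c" if "d \<in> D" for d
    using that \<kappa> unfolding D_def by blast+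
  have fs: "f d \<in> seqs d (hered \<kappa>)" if "d \<in> D" for d
    using f[OF that] L_seqs D\<kappa>[OF that] by blast
  have cov': "\<forall>\<xi>\<in>elts c. \<exists>d\<in>D. \<xi> \<in> elts d"
  proof
    fix \<xi>
    assume "\<xi> \<in> elts c"
    then obtain d where d: "d \<in> hdom C" "d \<in> elts c" "\<xi> \<in> elts d"
      using cov by blast
    show "\<exists>d\<in>D. \<xi> \<in> elts d"
    proof (cases "e \<le> d")
      case True
      then show ?thesis
        using d unfolding D_def by blast
    next
      case False
      then have "d \<in> elts e"
        using Ord_not_le ord e(1) d(1) by blast
      then have "\<xi> \<in> elts e"
        using Ord_trans[OF ord[OF e(1)]] d(3) by blast
      then show ?thesis
        using e unfolding D_def by blast
    qed
  qed
  have coh: "hrestrict (f d') d = f d" if "d \<in> D" "d' \<in> D" "d \<in> elts d'" for d d'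
  proof -
    have "d \<le> d'"
      using Ord_in_imp_le ord D\<kappa> that by blast
    then have "hrestrict (f d') d = hrestrict (f d) d"
      using follows_unique[OF \<alpha> e(1) fs[OF that(2)] _ fs[OF that(1)]] f that D\<kappa> by auto
    then show ?thesis
      using hrestrict_self[OF fs[OF that(1)]] by simp
  qed
  have "D \<subseteq> elts c"
    unfolding D_def by blast
  then obtain s where s: "s \<in> seqs c (hered \<kappa>)" "\<forall>d\<in>D. hrestrict s d = f d"
    using seqs_union[OF c(1) _ cov' fs coh] by blast
  have "e \<in> D"
    unfolding D_def using e by simp
  then have "hrestrict s e = f e"
    using s(2) by blast
  then have se: "hrestrict s e = x"
    using f[OF \<open>e \<in> D\<close>] hrestrict_self[OF fs[OF \<open>e \<in> D\<close>]] by simp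
  have sL: "hrestrict s \<beta> \<in> L \<beta>" if \<beta>: "\<beta> \<in> elts c" for \<beta>
  proof -
    obtain d where d: "d \<in> D" "\<beta> \<in> elts d"
      using cov' \<beta> by blast
    then have "\<beta> \<le> d"
      using Ord_in_imp_le ord D\<kappa> by blast
    then have "hrestrict s \<beta> = hrestrict (f d) \<beta>"
      using hrestrict_hrestrict seqs_hfun[OF s(1)] s(2) d(1) by metis
    then show ?thesis
      using L_restrict f d D\<kappa> by metis
  qed
  have "follows T C e s"
    unfolding follows_def
  proof (intro allI impI)
    fix b c'
    assume bc: "next_in (hdom C) b c' \<and> e \<le> b \<and> elts c' \<subseteq> hdom s"
    then have b: "b \<in> hdom C" "c' \<in> hdom C" "b \<in> elts c'" "\<forall>d\<in>hdom C. d \<in> elts c' \<longrightarrow> d \<le> b"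
      unfolding next_in_def by auto
    have "c' \<le> c"
      using bc seqs_hdom[OF s(1)] unfolding less_eq_hset_def by simp
    moreover have "c' \<noteq> c"
    proof
      assume "c' = c"
      then obtain d where "d \<in> hdom C" "d \<in> elts c'" "b \<in> elts d"
        using cov b(3) by blast
      then show False
        using b(4) elts_irrefl unfolding less_eq_hset_def by blast
    qed
    ultimately have c': "c' \<in> elts c"
      using Ord_le_iff[OF ord[OF b(2)] c(1)] by blast
    have "b \<le> c'"
      using Ord_in_imp_le[OF ord[OF b(2)] b(3)] .
    then have D': "c' \<in> D"
      unfolding D_def using c' b(2) bc by auto
    have "elts c' \<subseteq> hdom (f c')"
      using seqs_hdom[OF fs[OF D']] by simp
    then have "hrestrict (f c') c' = stepf {u \<in> T. hdom u \<subseteq> elts c'} b c' (elts (happ C c')) (hrestrict (f c') b)"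
      using f[OF D'] bc unfolding follows_def by blast
    moreover have "hrestrict (f c') c' = hrestrict s c'"
      using hrestrict_self[OF fs[OF D']] s(2) D' by simp
    moreover have "hrestrict (f c') b = hrestrict s b"
      using s(2) D' hrestrict_hrestrict[OF \<open>b \<le> c'\<close> seqs_hfun[OF s(1)]] by simp
    ultimately show "hrestrict s c' = stepf {u \<in> T. hdom u \<subseteq> elts c'} b c' (elts (happ C c')) (hrestrict s b)"
      by simp
  qed
  then show ?thesis
    using s(1) se sL by blast
qed

lemma thread_union_in_L:
  assumes \<alpha>: "\<alpha> \<in> elts \<kappa>" "limit \<alpha>" "C \<in> CC \<alpha>" and e: "e \<in> hdom C" "e \<in> elts c"
    and c: "c = \<alpha> \<or> c \<in> hdom C" and cov: "\<forall>\<xi>\<in>elts c. \<exists>d\<in>hdom C. d \<in> elts c \<and> \<xi> \<in> elts d"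
    and thr: "\<And>d. d \<in> hdom C \<Longrightarrow> d \<in> elts c \<Longrightarrow> e \<le> d \<Longrightarrow> \<exists>s\<in>L d. hrestrict s e = x \<and> follows T C e s"
  shows "\<exists>s\<in>L c. hrestrict s e = x \<and> follows T C e s"
proof -
  note club = CC_club[OF \<alpha>]
  have c\<kappa>: "c \<in> elts \<kappa>"
    using c club(3) below_trans \<alpha>(1) by blast
  have cle: "c \<le> \<alpha>"
    using c club(3) Ord_in_imp_le[OF Ord_below[OF \<alpha>(1)]] by blast
  have ordc: "Ord c"
    using c\<kappa> Ord_below by blast
  obtain s where s: "s \<in> seqs c (hered \<kappa>)" "hrestrict s e = x" "follows T C e s" "\<forall>\<beta>\<in>elts c. hrestrict s \<beta> \<in> L \<beta>"
    using thread_union[OF \<alpha> e ordc cle cov thr] by blast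
  have lim: "limit c"
    unfolding limit_def using ordc e(2) cov by blast
  have "cf c < \<chi> \<or> (\<exists>D\<in>CC c. \<exists>e\<in>hdom D. follows T D e s)"
  proof (cases "c = \<alpha>")
    case True
    then show ?thesis
      using \<alpha>(3) e(1) s(3) by blast
  next
    case False
    then have "c \<in> hdom C"
      using c by blast
    then have "c \<in> acc_pts (hdom C)"
      using acc_pts_iff[OF ordc] e(2) cov by blast
    then obtain D where D: "D \<in> CC c" "sqsub \<chi> D C"
      using CC[OF \<alpha>(1,2)] \<alpha>(3) by blast
    have "alpha_of D = c"
      using CC[OF c\<kappa> lim] D(1) by blast
    then consider "D = hrestrict C c" | "cf c < \<chi>"
      using D(2) unfolding sqsub_def by auto
    then show ?thesis
    proof cases
      case 1
      have domD: "hdom D = hdom C \<inter> elts c"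
        unfolding 1 by (rule hdom_hrestrict)
      \<comment> \<open>\<open>hdom D\<close> is an initial segment of \<open>hdom C\<close>, so
        consecutive points of the former are consecutive in the latter and the steps
        coincide.\<close>
      have nxt: "next_in (hdom C) b d" if "next_in (hdom D) b d" for b d
        using that Ord_trans[OF ordc] unfolding next_in_def domD by blast
      have "follows T D e s"
        unfolding follows_def
      proof (intro allI impI)
        fix b d
        assume bd: "next_in (hdom D) b d \<and> e \<le> b \<and> elts d \<subseteq> hdom s"
        then have d: "d \<in> hdom C" "d \<in> elts c"
          unfolding next_in_def domD by blast+
        then have "happ D d = happ C d"
          unfolding 1 using hrestrict_happ club(1) by blast
        moreover have "hrestrict s d = stepf {u \<in> T. hdom u \<subseteq> elts d} b d (elts (happ C d)) (hrestrict s b)"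
          using s(3) nxt bd unfolding follows_def by blast
        ultimately show "hrestrict s d = stepf {u \<in> T. hdom u \<subseteq> elts d} b d (elts (happ D d)) (hrestrict s b)"
          by simp
      qed
      moreover have "e \<in> hdom D"
        unfolding domD using e by blast
      ultimately show ?thesis
        using D(1) by blast
    qed blast
  qed
  then have "s \<in> L c"
    using L_limit[OF c\<kappa> lim] s by blast
  then show ?thesis
    using s by blast
qed

section \<open>Step functions and normality\<close>

lemma stepspec_L:
  assumes "c \<in> elts \<kappa>" "b \<in> elts c"
  shows "stepspec {u \<in> T. hdom u \<subseteq> elts c} b c X N \<longleftrightarrow> (\<forall>y\<in>L b. N y \<in> L c \<and> y \<le> N y) \<and>
    ((\<exists>g\<in>elts c. b \<in> elts g \<and> (\<forall>y\<in>L b. \<exists>z\<in>L g. y \<le> z \<and> z \<notin> X)) \<longrightarrow>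
     (\<exists>g\<in>elts c. b \<in> elts g \<and> (\<forall>y\<in>L b. hrestrict (N y) g \<notin> X)))"
proof -
  have W: "y \<in> {u \<in> T. hdom u \<subseteq> elts c} \<and> hdom y = elts d \<longleftrightarrow> y \<in> L d" if "d \<in> elts c \<or> d = c" for d y
  proof
    assume "y \<in> L d"
    moreover have "d \<in> elts \<kappa>"
      using that assms below_trans by blast
    moreover have "elts d \<subseteq> elts c"
      using that Ord_trans[OF Ord_below[OF assms(1)]] by blast
    ultimately show "y \<in> {u \<in> T. hdom u \<subseteq> elts c} \<and> hdom y = elts d"
      using L_hdom[of d y] T_hdom[of y d] by simp
  qed (use T_hdom in blast)
  have Wb: "y \<in> {u \<in> T. hdom u \<subseteq> elts c} \<and> hdom y = elts b \<longleftrightarrow> y \<in> L b" for y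
    using W assms by blast
  have 1: "(\<forall>y. y \<in> {u \<in> T. hdom u \<subseteq> elts c} \<and> hdom y = elts b \<longrightarrow>
      N y \<in> {u \<in> T. hdom u \<subseteq> elts c} \<and> hdom (N y) = elts c \<and> y \<le> N y) \<longleftrightarrow> (\<forall>y\<in>L b. N y \<in> L c \<and> y \<le> N y)"
    by (simp only: conj_assoc[symmetric] Wb W[OF disjI2[OF refl]] Ball_def)
  have 2: "(\<exists>z. z \<in> {u \<in> T. hdom u \<subseteq> elts c} \<and> hdom z = elts g \<and> y \<le> z \<and> z \<notin> X) \<longleftrightarrow> (\<exists>z\<in>L g. y \<le> z \<and> z \<notin> X)"
    if "g \<in> elts c" for g y
    by (simp only: conj_assoc[symmetric] W[OF disjI1[OF that]] Bex_def)
  show ?thesis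
    unfolding stepspec_def unfolding 1 unfolding Wb by (simp only: Ball_def 2 cong: bex_cong)
qed

definition normal_at :: "'k hset \<Rightarrow> bool" where
  "normal_at \<alpha> \<longleftrightarrow> (\<forall>\<beta>\<in>elts \<alpha>. \<forall>y\<in>L \<beta>. \<exists>t\<in>L \<alpha>. y \<le> t)"

text \<open>Normality at \<open>c\<close> shows that the choice in \<open>stepf\<close> is from a
  nonempty set. If some level \<open>g\<close> allows all nodes to avoid \<open>X\<close>, first
  extend each node to such a \<open>g\<close> and then to \<open>c\<close>; otherwise any extension
  to \<open>c\<close> will do.\<close>

lemma stepf_stepspec:
  assumes c: "c \<in> elts \<kappa>" "b \<in> elts c" and norm: "normal_at c"
  shows "stepspec {u \<in> T. hdom u \<subseteq> elts c} b c X (stepf {u \<in> T. hdom u \<subseteq> elts c} b c X)"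
proof -
  have "\<exists>N. stepspec {u \<in> T. hdom u \<subseteq> elts c} b c X N"
  proof (cases "\<exists>g\<in>elts c. b \<in> elts g \<and> (\<forall>y\<in>L b. \<exists>z\<in>L g. y \<le> z \<and> z \<notin> X)")
    case True
    then obtain g where g: "g \<in> elts c" "b \<in> elts g" "\<forall>y\<in>L b. \<exists>z\<in>L g. y \<le> z \<and> z \<notin> X"
      by blast
    have g\<kappa>: "g \<in> elts \<kappa>"
      using below_trans[OF c(1) g(1)] .
    have "\<exists>t\<in>L c. y \<le> t \<and> hrestrict t g \<notin> X" if y: "y \<in> L b" for y
    proof -
      obtain z where z: "z \<in> L g" "y \<le> z" "z \<notin> X"
        using bspec[OF g(3) y] by blast
      then obtain t where t: "t \<in> L c" "z \<le> t"
        using norm g(1) unfolding normal_at_def by blast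
      then have "hrestrict t g = z"
        using L_le_iff c(1) g\<kappa> z(1) by blast
      then show ?thesis
        using z(2,3) t order_trans[OF z(2) t(2)] by auto
    qed
    then obtain N where "\<forall>y\<in>L b. N y \<in> L c \<and> y \<le> N y \<and> hrestrict (N y) g \<notin> X"
      by metis
    then have "stepspec {u \<in> T. hdom u \<subseteq> elts c} b c X N"
      unfolding stepspec_L[OF c] using g(1,2) by auto
    then show ?thesis
      by (intro exI[where x = N])
  next
    case False
    obtain N where N: "\<forall>y\<in>L b. N y \<in> L c \<and> y \<le> N y"
      using norm c(2) unfolding normal_at_def by metis
    have "stepspec {u \<in> T. hdom u \<subseteq> elts c} b c X N"
      unfolding stepspec_L[OF c] using N notE[OF False] by (intro conjI impI)
    then show ?thesis
      by (intro exI[where x = N])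
  qed
  then show ?thesis
    unfolding stepf_def by (rule someI_ex)
qed

lemma next_in_unique:
  assumes "next_in D b c" "next_in D b' c"
  shows "b = b'"
  using assms unfolding next_in_def by (meson order_antisym)

text \<open>A step to \<open>c\<close> needs normality at \<open>c\<close> only, and
  \<open>c\<close> is below \<alpha>. So threads up to \<alpha> can be used in the proof that level
  \<alpha> is normal, without a circle.\<close>

lemma thread_ex:
  assumes \<alpha>: "\<alpha> \<in> elts \<kappa>" "limit \<alpha>" "C \<in> CC \<alpha>" and norm: "\<And>c. c \<in> elts \<alpha> \<Longrightarrow> normal_at c"
    and e: "e \<in> hdom C" and x: "x \<in> L e"
  shows "c \<in> hdom C \<Longrightarrow> e \<le> c \<Longrightarrow> \<exists>s\<in>L c. hrestrict s e = x \<and> follows T C e s"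
proof (induction c rule: elts_induct)
  case (step c)
  note club = CC_club[OF \<alpha>]
  have ord: "Ord d" and \<kappa>: "d \<in> elts \<kappa>" if "d \<in> hdom C" for d
    using that club(3) Ord_below below_trans \<alpha>(1) by blast+
  show ?case
  proof (cases "e = c")
    case True
    \<comment> \<open>Vacuous: no step starting at \<open>e\<close> or later is completed within
      \<open>x\<close>, whose length is \<open>e\<close>.\<close>
    have "follows T C e x"
      unfolding follows_def
    proof (intro allI impI)
      fix b c'
      assume bc: "next_in (hdom C) b c' \<and> e \<le> b \<and> elts c' \<subseteq> hdom x"
      then have "b \<in> elts e"
        using L_hdom[OF \<kappa>[OF e] x] unfolding next_in_def by blast
      then have False
        using bc elts_irrefl unfolding less_eq_hset_def by blast
      then show "hrestrict x c' = stepf {u \<in> T. hdom u \<subseteq> elts c'} b c' (elts (happ C c')) (hrestrict x b)" ..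
    qed
    then show ?thesis
      using True x L_self \<kappa> e by metis
  next
    case False
    then have ec: "e \<in> elts c"
      using Ord_le_iff ord e step.prems by blast
    consider b where "next_in (hdom C) b c" "e \<le> b" | "\<forall>\<xi>\<in>elts c. \<exists>d\<in>hdom C. d \<in> elts c \<and> \<xi> \<in> elts d"
      using club_next_or_acc[OF Ord_below[OF \<alpha>(1)] club(2) e ec step.prems(1)] by blast
    then show ?thesis
    proof cases
      case 1
      then have b: "b \<in> hdom C" "b \<in> elts c" "\<forall>d\<in>hdom C. d \<in> elts c \<longrightarrow> d \<le> b"
        unfolding next_in_def by auto
      have c\<kappa>: "c \<in> elts \<kappa>" and b\<kappa>: "b \<in> elts \<kappa>"
        using \<kappa> step.prems b by blast+
      obtain s where s: "s \<in> L b" "hrestrict s e = x" "follows T C e s"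
        using step.IH b 1 by blast
      define N where "N = stepf {u \<in> T. hdom u \<subseteq> elts c} b c (elts (happ C c))"
      have "normal_at c"
        using norm club(3) step.prems by blast
      then have "stepspec {u \<in> T. hdom u \<subseteq> elts c} b c (elts (happ C c)) N"
        unfolding N_def using stepf_stepspec[OF c\<kappa> b(2)] by blast
      then have N: "N s \<in> L c" "s \<le> N s"
        unfolding stepspec_L[OF c\<kappa> b(2)] using s(1) by blast+
      then have Nb: "hrestrict (N s) b = s"
        using L_le_iff[OF c\<kappa> _ b\<kappa> s(1)] by blast
      have Nr: "hrestrict (N s) d = hrestrict s d" if "d \<le> b" for d
        using L_hrestrict_hrestrict[OF c\<kappa> N(1) that] Nb by simp
      \<comment> \<open>Steps ending at or before \<open>b\<close> are inherited from
        \<open>s\<close>; the only new step is the one from \<open>b\<close> to \<open>c\<close>,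
        taken by \<open>N\<close>.\<close>
      have "follows T C e (N s)"
        unfolding follows_def
      proof (intro allI impI)
        fix b' c'
        assume bc: "next_in (hdom C) b' c' \<and> e \<le> b' \<and> elts c' \<subseteq> hdom (N s)"
        then have b': "b' \<in> hdom C" "c' \<in> hdom C" "b' \<in> elts c'"
          unfolding next_in_def by auto
        have "c' \<le> c"
          using bc L_hdom[OF c\<kappa> N(1)] unfolding less_eq_hset_def by simp
        then consider "c' = c" | "c' \<in> elts c"
          using Ord_le_iff ord b' step.prems by blast
        then show "hrestrict (N s) c' = stepf {u \<in> T. hdom u \<subseteq> elts c'} b' c' (elts (happ C c')) (hrestrict (N s) b')"
        proof cases
          case c': 1
          then have "b' = b"
            using next_in_unique 1 bc by blast
          then show ?thesis
            using c' Nb N_def L_self[OF c\<kappa> N(1)] by simp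
        next
          case 2
          then have c'b: "c' \<le> b"
            using b b' by blast
          then have "elts c' \<subseteq> hdom s"
            using L_hdom[OF b\<kappa> s(1)] unfolding less_eq_hset_def by simp
          then have "hrestrict s c' = stepf {u \<in> T. hdom u \<subseteq> elts c'} b' c' (elts (happ C c')) (hrestrict s b')"
            using s(3) bc unfolding follows_def by blast
          moreover have "b' \<le> b"
            using c'b Ord_in_imp_le[OF ord[OF b'(2)] b'(3)] by (rule order_trans[rotated])
          ultimately show ?thesis
            using Nr c'b by simp
        qed
      qed
      moreover have "hrestrict (N s) e = x"
        using Nr 1(2) s(2) by simp
      ultimately show ?thesis
        using N(1) by blast
    next
      case 2
      show ?thesis
        by (rule thread_union_in_L[OF \<alpha> e ec _ 2]) (use step in blast)+
    qed
  qed
qed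

text \<open>At a limit, take any \<open>C\<close>, extend the node to a club point \<open>e\<close>
  above its level by induction, and run a thread along \<open>C\<close> from there. Limits of small
  cofinality are treated in the same way.\<close>

lemma normal: "\<alpha> \<in> elts \<kappa> \<Longrightarrow> normal_at \<alpha>"
proof (induction \<alpha> rule: elts_induct)
  case (step \<alpha>)
  have IH: "normal_at \<beta>" if "\<beta> \<in> elts \<alpha>" for \<beta>
    using step below_trans that by blast
  show ?case
    using Ord_below[OF step.prems]
  proof (cases rule: Ord_cases)
    case 1
    then show ?thesis
      unfolding normal_at_def by simp
  next
    case (2 \<gamma>)
    have \<gamma>: "\<gamma> \<in> elts \<alpha>" "\<gamma> \<in> elts \<kappa>"
      using 2 below_trans step.prems by auto
    have ext: "\<exists>t\<in>L \<alpha>. y \<le> t" if "y \<in> L \<gamma>" for y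
    proof -
      have "snoc \<gamma> y (set_of {}) \<in> L \<alpha>"
        unfolding 2 L_succ[OF \<gamma>(2)] succ_vals_def using that zero_lam by blast
      moreover have "y \<le> snoc \<gamma> y (set_of {})"
        unfolding less_eq_hset_def elts_snoc by blast
      ultimately show ?thesis
        by blast
    qed
    show ?thesis
      unfolding normal_at_def
    proof (intro ballI)
      fix \<beta> y
      assume \<beta>: "\<beta> \<in> elts \<alpha>" "y \<in> L \<beta>"
      have "\<exists>z\<in>L \<gamma>. y \<le> z"
      proof (cases "\<beta> = \<gamma>")
        case True
        then show ?thesis
          using \<beta> by blast
      next
        case False
        then have "\<beta> \<in> elts \<gamma>"
          using \<beta> 2 by simp
        then show ?thesis
          using IH[OF \<gamma>(1)] \<beta>(2) unfolding normal_at_def by blast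
      qed
      then show "\<exists>t\<in>L \<alpha>. y \<le> t"
        using ext order_trans by blast
    qed
  next
    case 3
    show ?thesis
      unfolding normal_at_def
    proof (intro ballI)
      fix \<beta> y
      assume \<beta>: "\<beta> \<in> elts \<alpha>" "y \<in> L \<beta>"
      obtain C where C: "C \<in> CC \<alpha>"
        using CC[OF step.prems 3] by blast
      note club = CC_club[OF step.prems 3 C]
      obtain e where e: "e \<in> hdom C" "\<beta> \<in> elts e"
        using club(4) \<beta>(1) by blast
      have e\<alpha>: "e \<in> elts \<alpha>"
        using e club(3) by blast
      obtain x where x: "x \<in> L e" "y \<le> x"
        using IH[OF e\<alpha>] \<beta>(2) e(2) unfolding normal_at_def by blast
      have "\<exists>s\<in>L \<alpha>. hrestrict s e = x \<and> follows T C e s"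
      proof (rule thread_union_in_L[OF step.prems 3 C e(1) e\<alpha>])
        show "\<forall>\<xi>\<in>elts \<alpha>. \<exists>d\<in>hdom C. d \<in> elts \<alpha> \<and> \<xi> \<in> elts d"
          using club(3,4) by blast
        show "\<exists>s\<in>L d. hrestrict s e = x \<and> follows T C e s" if "d \<in> hdom C" "e \<le> d" for d
          using thread_ex[OF step.prems 3 C IH e(1) x(1) that] by blast
      qed simp
      then obtain s where "s \<in> L \<alpha>" "hrestrict s e = x"
        by blast
      then show "\<exists>t\<in>L \<alpha>. y \<le> t"
        using x(2) hrestrict_le order_trans by metis
    qed
  qed
qed

lemma L_extend:
  assumes "\<alpha> \<in> elts \<kappa>" "\<beta> \<in> elts \<kappa>" "\<beta> \<le> \<alpha>" "y \<in> L \<beta>"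
  shows "\<exists>t\<in>L \<alpha>. y \<le> t"
  using normal[OF assms(1)] Ord_le_iff[OF Ord_below[OF assms(2)] Ord_below[OF assms(1)]] assms(3,4)
  unfolding normal_at_def by auto

lemma L_nonempty: "\<alpha> \<in> elts \<kappa> \<Longrightarrow> L \<alpha> \<noteq> {}"
proof -
  assume \<alpha>: "\<alpha> \<in> elts \<kappa>"
  have "set_of {} \<le> \<alpha>"
    unfolding less_eq_hset_def by simp
  then show ?thesis
    using L_extend[OF \<alpha> zero_\<kappa>] L_zero by blast
qed

section \<open>Sizes of the levels\<close>

lemma UN_L_small:
  assumes "\<alpha> \<in> elts \<kappa>" "\<And>\<beta>. \<beta> \<in> elts \<alpha> \<Longrightarrow> L \<beta> \<prec> elts \<kappa>"
  shows "(\<Union>\<beta>\<in>elts \<alpha>. L \<beta>) \<prec> elts \<kappa>"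
  using UN_lesspoll_\<kappa>[OF elts_lesspoll_\<kappa>[OF assms(1)]] assms(2) by blast

text \<open>A node is determined by its restrictions to a cofinal sequence of length
  \<open>cf \<alpha>\<close>. Coding lower nodes by ordinals below some \<mu> < \<kappa> turns these
  restrictions into a sequence of length less than \<chi> in \<mu>, and closure of \<kappa> bounds
  the number of such sequences.\<close>

lemma L_limit_small_cf:
  assumes \<alpha>: "\<alpha> \<in> elts \<kappa>" "limit \<alpha>" and U: "(\<Union>\<beta>\<in>elts \<alpha>. L \<beta>) \<prec> elts \<kappa>" and cf: "cf \<alpha> < \<chi>"
  shows "L \<alpha> \<prec> elts \<kappa>"
proof -
  obtain \<mu> where \<mu>: "\<mu> \<in> elts \<kappa>" "(\<Union>\<beta>\<in>elts \<alpha>. L \<beta>) \<lesssim> elts \<mu>"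
    using lesspoll_\<kappa>_ex[OF U] by blast
  obtain k where k: "inj_on k (\<Union>\<beta>\<in>elts \<alpha>. L \<beta>)" "k ` (\<Union>\<beta>\<in>elts \<alpha>. L \<beta>) \<subseteq> elts \<mu>"
    using \<mu>(2) unfolding lepoll_def by blast
  have ord: "Ord \<alpha>" "Ord \<chi>"
    using Ord_below \<alpha>(1) \<chi>_\<kappa> by blast+
  obtain f where f: "f \<in> elts (cf \<alpha>) \<rightarrow> elts \<alpha>" "\<forall>\<xi>\<in>elts \<alpha>. \<exists>i\<in>elts (cf \<alpha>). \<xi> \<le> f i"
    using cf_cofinal(2)[OF ord(1)] by blast
  have cf\<chi>: "cf \<alpha> \<in> elts \<chi>"
    using cf Ord_less_iff[OF cf_cofinal(1)[OF ord(1)] ord(2)] by blast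
  define \<Psi> where "\<Psi> t = set_of ((\<lambda>i. hpair i (k (hrestrict t (f i)))) ` elts (cf \<alpha>))" for t
  have el\<Psi>: "elts (\<Psi> t) = (\<lambda>i. hpair i (k (hrestrict t (f i)))) ` elts (cf \<alpha>)" for t
    unfolding \<Psi>_def by (rule elts_hgraph)
  have mem: "hrestrict t (f i) \<in> (\<Union>\<beta>\<in>elts \<alpha>. L \<beta>)" if "t \<in> L \<alpha>" "i \<in> elts (cf \<alpha>)" for t i
  proof -
    have "f i \<in> elts \<alpha>"
      using f(1) that(2) by (rule funcset_mem)
    then show ?thesis
      using L_restrict[OF \<alpha>(1) that(1)] by blast
  qed
  have "\<Psi> t \<in> seqs_below \<chi> (elts \<mu>)" if t: "t \<in> L \<alpha>" for t
  proof -
    have "\<Psi> t \<in> seqs (cf \<alpha>) (elts \<mu>)"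
      unfolding \<Psi>_def by (rule hgraph_seqs) (use mem[OF t] k(2) in blast)
    then show ?thesis
      unfolding seqs_below_def using cf\<chi> by blast
  qed
  then have "\<Psi> ` L \<alpha> \<subseteq> seqs_below \<chi> (elts \<mu>)"
    by blast
  moreover have "inj_on \<Psi> (L \<alpha>)"
  proof (rule inj_onI)
    fix s t
    assume st: "s \<in> L \<alpha>" "t \<in> L \<alpha>" and eq: "\<Psi> s = \<Psi> t"
    have rest: "hrestrict s (f i) = hrestrict t (f i)" if i: "i \<in> elts (cf \<alpha>)" for i
    proof -
      have "hpair i (k (hrestrict s (f i))) \<in> elts (\<Psi> t)"
        unfolding eq[symmetric] el\<Psi> using i by blast
      then have "k (hrestrict s (f i)) = k (hrestrict t (f i))"
        unfolding el\<Psi> by auto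
      then show ?thesis
        by (rule inj_onD[OF k(1) _ mem[OF st(1) i] mem[OF st(2) i]])
    qed
    show "s = t"
    proof (rule seqs_eqI[where D = "f ` elts (cf \<alpha>)"])
      show "s \<in> seqs \<alpha> (hered \<kappa>)" "t \<in> seqs \<alpha> (hered \<kappa>)"
        using st L_seqs \<alpha>(1) by blast+
      show "\<forall>\<xi>\<in>elts \<alpha>. \<exists>d\<in>f ` elts (cf \<alpha>). \<xi> \<in> elts d"
      proof
        fix \<xi>
        assume "\<xi> \<in> elts \<alpha>"
        then obtain \<eta> where \<eta>: "\<eta> \<in> elts \<alpha>" "\<xi> \<in> elts \<eta>"
          using \<alpha>(2) unfolding limit_def by blast
        then obtain i where i: "i \<in> elts (cf \<alpha>)" "\<eta> \<le> f i"
          using f(2) by blast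
        then have "\<xi> \<in> elts (f i)"
          using \<eta>(2) Ord_in_le by blast
        then show "\<exists>d\<in>f ` elts (cf \<alpha>). \<xi> \<in> elts d"
          using i(1) by blast
      qed
      show "hrestrict s d = hrestrict t d" if "d \<in> f ` elts (cf \<alpha>)" for d
        using that rest by blast
    qed
  qed
  ultimately have "L \<alpha> \<lesssim> seqs_below \<chi> (elts \<mu>)"
    unfolding lepoll_def by blast
  moreover have "seqs_below \<chi> (elts \<mu>) \<prec> elts \<kappa>"
    using closed \<mu>(1) unfolding lt_closed_def by blast
  ultimately show ?thesis
    by (rule lesspoll_trans1)
qed

text \<open>A node is determined by some \<open>C\<close> that it follows and by its restriction to
  the point \<open>e\<close> from which it does so.\<close>

lemma L_limit_small_club:
  assumes \<alpha>: "\<alpha> \<in> elts \<kappa>" "limit \<alpha>" and U: "(\<Union>\<beta>\<in>elts \<alpha>. L \<beta>) \<prec> elts \<kappa>" and cf: "\<not> cf \<alpha> < \<chi>"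
  shows "L \<alpha> \<prec> elts \<kappa>"
proof -
  have "\<forall>t\<in>L \<alpha>. \<exists>Ce. fst Ce \<in> CC \<alpha> \<and> snd Ce \<in> hdom (fst Ce) \<and> follows T (fst Ce) (snd Ce) t"
  proof
    fix t
    assume "t \<in> L \<alpha>"
    then obtain C e where "C \<in> CC \<alpha>" "e \<in> hdom C" "follows T C e t"
      using L_limit[OF \<alpha>] cf by blast
    then show "\<exists>Ce. fst Ce \<in> CC \<alpha> \<and> snd Ce \<in> hdom (fst Ce) \<and> follows T (fst Ce) (snd Ce) t"
      by (intro exI[of _ "(C, e)"]) simp
  qed
  from bchoice[OF this] obtain h where h: "\<forall>t\<in>L \<alpha>. fst (h t) \<in> CC \<alpha> \<and> snd (h t) \<in> hdom (fst (h t)) \<and> follows T (fst (h t)) (snd (h t)) t"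
    by blast
  define \<Psi> where "\<Psi> t = (fst (h t), hrestrict t (snd (h t)))" for t
  have e\<alpha>: "snd (h t) \<in> elts \<alpha>" if "t \<in> L \<alpha>" for t
    using h that CC_club(3)[OF \<alpha>] by blast
  have "\<Psi> ` L \<alpha> \<subseteq> CC \<alpha> \<times> (\<Union>\<beta>\<in>elts \<alpha>. L \<beta>)"
    unfolding \<Psi>_def using h L_restrict[OF \<alpha>(1)] e\<alpha> by blast
  moreover have "inj_on \<Psi> (L \<alpha>)"
  proof (rule inj_onI)
    fix s t
    assume st: "s \<in> L \<alpha>" "t \<in> L \<alpha>" and eq: "\<Psi> s = \<Psi> t"
    have ss: "s \<in> seqs \<alpha> (hered \<kappa>)" "t \<in> seqs \<alpha> (hered \<kappa>)"
      using st L_seqs \<alpha>(1) by blast+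
    define C where "C = fst (h t)"
    define e where "e = snd (h t)"
    have C: "C \<in> CC \<alpha>" "fst (h s) = C" "e \<in> hdom C"
      using h st eq unfolding C_def e_def \<Psi>_def by auto
    have rs: "hrestrict s (snd (h s)) = hrestrict t e"
      using eq unfolding \<Psi>_def e_def by simp
    have "hrestrict s (snd (h s)) \<in> L (snd (h s))" "hrestrict t e \<in> L e"
      using L_restrict[OF \<alpha>(1)] st e\<alpha> unfolding e_def by blast+
    \<comment> \<open>The point \<open>e\<close> is the length of the recorded restriction, so
      \<Psi> need not record it separately.\<close>
    then have e: "snd (h s) = e"
      using L_unique[of "snd (h s)" e "hrestrict t e"] rs below_trans[OF \<alpha>(1)] e\<alpha> st unfolding e_def by simp
    have fol: "follows T C e s" "follows T C e t"
      using h st C(2) e unfolding C_def e_def by auto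
    note club = CC_club[OF \<alpha> C(1)]
    have ord: "Ord d" if "d \<in> hdom C" for d
      using that club(3) Ord_below below_trans \<alpha>(1) by blast
    show "s = t"
    proof (rule seqs_eqI[where D = "{c \<in> hdom C. e \<le> c}"])
      show "s \<in> seqs \<alpha> (hered \<kappa>)" "t \<in> seqs \<alpha> (hered \<kappa>)"
        by (fact ss)+
      show "\<forall>\<xi>\<in>elts \<alpha>. \<exists>d\<in>{c \<in> hdom C. e \<le> c}. \<xi> \<in> elts d"
      proof
        fix \<xi>
        assume "\<xi> \<in> elts \<alpha>"
        then obtain d where d: "d \<in> hdom C" "\<xi> \<in> elts d"
          using club(4) by blast
        show "\<exists>d\<in>{c \<in> hdom C. e \<le> c}. \<xi> \<in> elts d"
        proof (cases "e \<le> d")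
          case True
          then show ?thesis
            using d by blast
        next
          case False
          then have "d \<in> elts e"
            using Ord_not_le ord C(3) d(1) by blast
          then have "\<xi> \<in> elts e"
            using Ord_trans[OF ord[OF C(3)]] d(2) by blast
          then show ?thesis
            using C(3) by blast
        qed
      qed
      show "hrestrict s c = hrestrict t c" if c: "c \<in> {c \<in> hdom C. e \<le> c}" for c
      proof -
        have "c \<le> \<alpha>"
          using c club(3) Ord_in_imp_le[OF Ord_below[OF \<alpha>(1)]] by blast
        then show ?thesis
          using follows_unique[OF \<alpha> C(1,3) ss(1) fol(1) ss(2) fol(2)] rs e c by simp
      qed
    qed
  qed
  ultimately have "L \<alpha> \<lesssim> CC \<alpha> \<times> (\<Union>\<beta>\<in>elts \<alpha>. L \<beta>)"
    unfolding lepoll_def by blast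
  moreover have "CC \<alpha> \<times> (\<Union>\<beta>\<in>elts \<alpha>. L \<beta>) \<prec> elts \<kappa>"
    using Times_lesspoll_infinite[OF _ U infinite_\<kappa>] CC[OF \<alpha>] by blast
  ultimately show ?thesis
    by (rule lesspoll_trans1)
qed

lemma L_small: "\<alpha> \<in> elts \<kappa> \<Longrightarrow> L \<alpha> \<prec> elts \<kappa>"
proof (induction \<alpha> rule: elts_induct)
  case (step \<alpha>)
  have IH: "L \<beta> \<prec> elts \<kappa>" if "\<beta> \<in> elts \<alpha>" for \<beta>
    using step.IH[OF that below_trans[OF step.prems that]] .
  show ?case
    using Ord_below[OF step.prems]
  proof (cases rule: Ord_cases)
    case 1
    then show ?thesis
      by (simp add: L_zero finite_lesspoll_\<kappa>)
  next
    case (2 \<gamma>)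
    have \<gamma>: "\<gamma> \<in> elts \<alpha>" "\<gamma> \<in> elts \<kappa>"
      using 2 below_trans step.prems by auto
    have "L \<alpha> \<subseteq> (\<lambda>(y, i). snoc \<gamma> y i) ` (L \<gamma> \<times> succ_vals \<gamma>)"
      unfolding 2 L_succ[OF \<gamma>(2)] by auto
    then have "L \<alpha> \<lesssim> L \<gamma> \<times> succ_vals \<gamma>"
      by (rule subset_image_lepoll)
    moreover have "L \<gamma> \<times> succ_vals \<gamma> \<prec> elts \<kappa>"
      by (rule Times_lesspoll_infinite[OF IH[OF \<gamma>(1)] succ_vals_\<kappa>(2)[OF \<gamma>(2)] infinite_\<kappa>])
    ultimately show ?thesis
      by (rule lesspoll_trans1)
  next
    case 3
    then show ?thesis
      using L_limit_small_cf L_limit_small_club step.prems UN_L_small[OF step.prems IH] by blast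
  qed
qed

lemma T_lepoll: "T \<lesssim> elts \<kappa>"
proof -
  have "T \<lesssim> elts \<kappa> \<times> elts \<kappa>"
    unfolding T_def by (rule UN_lepoll_Times) (use L_small lesspoll_imp_lepoll in blast)
  then show ?thesis
    using lepoll_trans infinite_Times_self[OF infinite_\<kappa>] by blast
qed

lemma T_hered: "T \<subseteq> hered \<kappa>"
  unfolding T_def using L_seqs seqs_hered by blast

subsection \<open>The sealing argument\<close>

text \<open>Lets the stationary set be met above a prescribed \<epsilon>. For rigidity, \<epsilon>
  will be the level of the moved node.\<close>

lemma club_above:
  assumes "\<epsilon> \<in> elts \<kappa>"
  shows "club_in {\<alpha> \<in> elts \<kappa>. \<epsilon> \<in> elts \<alpha>} \<kappa>"
proof -
  have "\<exists>a\<in>{\<alpha> \<in> elts \<kappa>. \<epsilon> \<in> elts \<alpha>}. \<xi> \<in> elts a" if "\<xi> \<in> elts \<kappa>" for \<xi>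
    using bounded_\<kappa>[of "{\<epsilon>, \<xi>}" "\<lambda>x. x"] finite_lesspoll_\<kappa>[of "{\<epsilon>, \<xi>}"] assms that by auto
  then have "osup {\<alpha> \<in> elts \<kappa>. \<epsilon> \<in> elts \<alpha>} = \<kappa>"
    using osup_eq_iff[OF Ord_\<kappa>, of "{\<alpha> \<in> elts \<kappa>. \<epsilon> \<in> elts \<alpha>}"] by blast
  moreover have "\<epsilon> \<in> elts \<beta>" if \<beta>: "\<beta> \<in> elts \<kappa>" "elts \<beta> \<noteq> {}" "osup ({\<alpha> \<in> elts \<kappa>. \<epsilon> \<in> elts \<alpha>} \<inter> elts \<beta>) = \<beta>" for \<beta>
  proof -
    have "\<exists>a\<in>{\<alpha> \<in> elts \<kappa>. \<epsilon> \<in> elts \<alpha>} \<inter> elts \<beta>. \<xi> \<in> elts a" if "\<xi> \<in> elts \<beta>" for \<xi>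
      using osup_eq_iff[OF Ord_below[OF \<beta>(1)], of "{\<alpha> \<in> elts \<kappa>. \<epsilon> \<in> elts \<alpha>} \<inter> elts \<beta>"] \<beta>(3) that by blast
    then obtain a where "\<epsilon> \<in> elts a" "a \<in> elts \<beta>"
      using \<beta>(2) by blast
    then show ?thesis
      using Ord_trans[OF Ord_below[OF \<beta>(1)]] by blast
  qed
  ultimately show ?thesis
    unfolding club_in_def by blast
qed

text \<open>The hypothesis \<open>dense\<close> asks for one level \<open>g\<close> serving all
  nodes of level \<alpha>, because this is the premise of \<open>stepspec\<close>. In the conclusion
  the level is common to all of \<open>J\<close>, because all its nodes pass through the same step,
  taken beyond the points from which they follow \<open>C\<close>. Such a step exists since
  \<open>J\<close> has at most \<Lambda> < cf \<alpha> nodes.\<close>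

lemma sealing:
  assumes \<Omega>: "\<Omega> \<subseteq> T"
    and dense: "\<And>\<alpha>. \<alpha> \<in> elts \<kappa> \<Longrightarrow> \<exists>g\<in>elts \<kappa>. \<alpha> \<in> elts g \<and> (\<forall>y\<in>L \<alpha>. \<exists>z\<in>L g. y \<le> z \<and> z \<notin> \<Omega>)"
    and \<Lambda>: "\<Lambda> \<in> elts lam" and \<epsilon>: "\<epsilon> \<in> elts \<kappa>"
  obtains \<alpha> where "\<alpha> \<in> elts \<kappa>" "\<epsilon> \<in> elts \<alpha>"
    "\<forall>J. J \<subseteq> L \<alpha> \<and> J \<lesssim> elts \<Lambda> \<longrightarrow> (\<exists>g\<in>elts \<alpha>. \<epsilon> \<in> elts g \<and> (\<forall>t\<in>J. hrestrict t g \<notin> \<Omega>))"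
proof -
  have "\<forall>\<alpha>\<in>elts \<kappa>. \<exists>g. g \<in> elts \<kappa> \<and> \<alpha> \<in> elts g \<and> (\<forall>y\<in>L \<alpha>. \<exists>z\<in>L g. y \<le> z \<and> z \<notin> \<Omega>)"
    using dense by blast
  from bchoice[OF this] obtain G where G: "\<forall>\<alpha>\<in>elts \<kappa>. G \<alpha> \<in> elts \<kappa> \<and> \<alpha> \<in> elts (G \<alpha>) \<and> (\<forall>y\<in>L \<alpha>. \<exists>z\<in>L (G \<alpha>). y \<le> z \<and> z \<notin> \<Omega>)"
    by blast
  have "\<Omega> \<lesssim> elts \<kappa>"
    using lepoll_trans[OF subset_imp_lepoll[OF \<Omega>] T_lepoll] .
  then obtain h where h: "\<Omega> \<subseteq> h ` elts \<kappa>"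
    unfolding lepoll_iff by blast
  \<comment> \<open>An enumeration of \<Omega> by \<kappa>; the default \<open>set_of {}\<close>
    keeps its values in \<open>hered_plus \<kappa>\<close> where \<open>h\<close> is outside
    \<Omega>.\<close>
  define g where "g \<xi> = (if h \<xi> \<in> \<Omega> then h \<xi> else set_of {})" for \<xi>
  have "\<forall>w\<in>\<Omega>. \<exists>\<xi>. \<xi> \<in> elts \<kappa> \<and> g \<xi> = w"
  proof
    fix w
    assume w: "w \<in> \<Omega>"
    then obtain \<xi> where "\<xi> \<in> elts \<kappa>" "h \<xi> = w"
      using h by blast
    then show "\<exists>\<xi>. \<xi> \<in> elts \<kappa> \<and> g \<xi> = w"
      unfolding g_def using w by auto
  qed
  from bchoice[OF this] obtain idx where idx: "\<forall>w\<in>\<Omega>. idx w \<in> elts \<kappa> \<and> g (idx w) = w"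
    by blast
  \<comment> \<open>\<open>F \<alpha>\<close> will exceed \<open>G \<alpha>\<close> and the indices
    of all elements of \<Omega> on level \<alpha>; it exists because levels are small. A submodel
    closed under \<open>F\<close> and \<open>g\<close> then sees, below its trace \<open>c\<close>,
    the level that \<open>dense\<close> provides and every element of \<Omega>.\<close>
  have "\<forall>\<alpha>\<in>elts \<kappa>. \<exists>\<delta>. \<delta> \<in> elts \<kappa> \<and> G \<alpha> \<in> elts \<delta> \<and> (\<forall>w\<in>\<Omega> \<inter> L \<alpha>. idx w \<in> elts \<delta>)"
  proof
    fix \<alpha>
    assume \<alpha>: "\<alpha> \<in> elts \<kappa>"
    have "idx ` (\<Omega> \<inter> L \<alpha>) \<prec> elts \<kappa>"
      by (rule lesspoll_trans1[OF lepoll_trans[OF image_lepoll subset_imp_lepoll] L_small[OF \<alpha>]]) blast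
    then have "{G \<alpha>} \<union> idx ` (\<Omega> \<inter> L \<alpha>) \<prec> elts \<kappa>"
      by (rule Un_lesspoll_\<kappa>[OF finite_lesspoll_\<kappa>, rotated]) simp
    moreover have "a \<in> elts \<kappa>" if "a \<in> {G \<alpha>} \<union> idx ` (\<Omega> \<inter> L \<alpha>)" for a
      using that G \<alpha> idx by blast
    ultimately have "\<exists>\<delta>\<in>elts \<kappa>. \<forall>a\<in>{G \<alpha>} \<union> idx ` (\<Omega> \<inter> L \<alpha>). a \<in> elts \<delta>"
      by (rule bounded_\<kappa>)
    then show "\<exists>\<delta>. \<delta> \<in> elts \<kappa> \<and> G \<alpha> \<in> elts \<delta> \<and> (\<forall>w\<in>\<Omega> \<inter> L \<alpha>. idx w \<in> elts \<delta>)"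
      by blast
  qed
  from bchoice[OF this] obtain F where F: "\<forall>\<alpha>\<in>elts \<kappa>. F \<alpha> \<in> elts \<kappa> \<and> G \<alpha> \<in> elts (F \<alpha>) \<and> (\<forall>w\<in>\<Omega> \<inter> L \<alpha>. idx w \<in> elts (F \<alpha>))"
    by blast
  have FH: "F \<xi> \<in> hered_plus \<kappa>" if "\<xi> \<in> elts \<kappa>" for \<xi>
    using F that hered_Ord hered_imp_hered_plus by blast
  have gH: "g \<xi> \<in> hered_plus \<kappa>" if "\<xi> \<in> elts \<kappa>" for \<xi>
    unfolding g_def using \<Omega> T_hered hered_imp_hered_plus hered_Ord[OF zero_\<kappa>] by auto
  define p where "p = set_of ((\<lambda>\<xi>. hpair \<xi> (hpair (F \<xi>) (g \<xi>))) ` elts \<kappa>)"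
  have pH: "p \<in> hered_plus \<kappa>"
    unfolding p_def by (rule hgraph2_hered_plus[OF FH gH])
  have \<Omega>H: "\<Omega> \<subseteq> hered \<kappa>"
    using \<Omega> T_hered by blast
  let ?good = "\<lambda>C. {\<gamma> \<in> hdom C. succ_n 1 (hdom C - elts \<gamma>) \<subseteq> guessing_set \<kappa> B0 \<Omega> p C}"
  obtain \<alpha> where \<alpha>: "\<alpha> \<in> E_ge \<kappa> \<chi> \<inter> E_gt \<kappa> \<Lambda>" "\<forall>C\<in>CC \<alpha>. \<forall>D\<in>CC \<alpha>. C = D"
      "\<forall>C\<in>CC \<alpha>. osup (?good C) = \<alpha>" "\<alpha> \<in> elts \<kappa>" "\<epsilon> \<in> elts \<alpha>"
    using guess[OF \<Omega>H pH \<Lambda>] club_above[OF \<epsilon>] unfolding stationary_in_def by blast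
  have cf\<alpha>: "\<chi> \<le> cf \<alpha>" "\<Lambda> < cf \<alpha>"
    using \<alpha>(1) unfolding E_ge_def E_gt_def by blast+
  have ord\<alpha>: "Ord \<alpha>"
    using \<alpha>(4) Ord_below by blast
  have lim: "limit \<alpha>"
    using limit_infinite_cf[OF ord\<alpha> _ cf\<alpha>(1)] \<chi>_regular unfolding regular_card_def inf_card_def by blast
  obtain C where C: "C \<in> CC \<alpha>"
    using CC[OF \<alpha>(4) lim] by blast
  note club = CC_club[OF \<alpha>(4) lim C]
  have good: "\<exists>\<gamma>\<in>?good C. \<xi> \<in> elts \<gamma>" if "\<xi> \<in> elts \<alpha>" for \<xi>
    using osup_eq_iff[OF ord\<alpha>, of "?good C"] club(3) \<alpha>(3) C that by blast
  have ordC: "Ord d" if "d \<in> hdom C" for d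
    using that club(3) ord\<alpha> Ord_in by blast
  have "\<And>J. J \<subseteq> L \<alpha> \<Longrightarrow> J \<lesssim> elts \<Lambda> \<Longrightarrow> \<exists>g\<in>elts \<alpha>. \<epsilon> \<in> elts g \<and> (\<forall>t\<in>J. hrestrict t g \<notin> \<Omega>)"
  proof -
    fix J
    assume J: "J \<subseteq> L \<alpha>" "J \<lesssim> elts \<Lambda>"
    have "\<forall>t\<in>J. \<exists>e. e \<in> hdom C \<and> follows T C e t"
    proof
      fix t
      assume "t \<in> J"
      then have "t \<in> L \<alpha>"
        using J by blast
      moreover have "\<not> cf \<alpha> < \<chi>"
        using cf\<alpha>(1) by auto
      ultimately obtain C' e where C': "C' \<in> CC \<alpha>" "e \<in> hdom C'" "follows T C' e t"
        using L_limit[OF \<alpha>(4) lim] by blast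
      \<comment> \<open>Uniqueness of the member of \<open>CC \<alpha>\<close> makes all nodes of
        the level follow the same \<open>C\<close>.\<close>
      have "C' = C"
        using \<alpha>(2) C C'(1) by blast
      then show "\<exists>e. e \<in> hdom C \<and> follows T C e t"
        using C' by blast
    qed
    from bchoice[OF this] obtain e where e: "\<forall>t\<in>J. e t \<in> hdom C \<and> follows T C (e t) t"
      by blast
    have "Ord \<Lambda>"
      using \<Lambda> lam_card Ord_in unfolding inf_card_def Card_def by blast
    moreover have "e t \<in> elts \<alpha>" if "t \<in> J" for t
      using e that club(3) by blast
    ultimately obtain \<xi> where \<xi>: "\<xi> \<in> elts \<alpha>" "\<forall>t\<in>J. e t \<in> elts \<xi>"
      using lt_cf_bounded[OF ord\<alpha> J(2) _ cf\<alpha>(2), of e] \<alpha>(5) by blast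
    have ord\<xi>\<epsilon>: "Ord \<xi>" "Ord \<epsilon>"
      using \<xi>(1) \<alpha>(5) ord\<alpha> Ord_in by blast+
    \<comment> \<open>The maximum of the two bounds: a step beyond \<zeta> is past all starting
      points and past \<epsilon>.\<close>
    define \<zeta> where "\<zeta> = (if \<xi> \<in> elts \<epsilon> then \<epsilon> else \<xi>)"
    have "\<zeta> \<in> elts \<alpha>"
      unfolding \<zeta>_def using \<xi>(1) \<alpha>(5) by simp
    then obtain b where b: "b \<in> ?good C" "\<zeta> \<in> elts b"
      using good by blast
    have bC: "b \<in> hdom C"
      using b by blast
    have \<xi>\<epsilon>: "\<xi> \<in> elts b" "\<epsilon> \<in> elts b"
    proof -
      show "\<xi> \<in> elts b"
        using b(2) Ord_trans[OF ordC[OF bC]] unfolding \<zeta>_def by (auto split: if_splits)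
      show "\<epsilon> \<in> elts b"
        using b(2) Ord_trans[OF ordC[OF bC]] Ord_linear[OF ord\<xi>\<epsilon>] unfolding \<zeta>_def by (auto split: if_splits)
    qed
    obtain c where c: "next_in (hdom C) b c"
      using next_in_ex[OF lim club(3,4) bC] by blast
    have cC: "c \<in> hdom C" and bc: "b \<in> elts c"
      using c unfolding next_in_def by auto
    have c\<alpha>: "c \<in> elts \<alpha>"
      using cC club(3) by blast
    have c\<kappa>: "c \<in> elts \<kappa>" and b\<kappa>: "b \<in> elts \<kappa>"
      using below_trans[OF \<alpha>(4)] c\<alpha> bC club(3) by blast+
    have "c \<in> guessing_set \<kappa> B0 \<Omega> p C"
      using succ_n_1[OF ord\<alpha> club(3) c] b(1) by blast
    then obtain M where M: "elem_submodel M (hered_plus \<kappa>)" "p \<in> M" "M \<inter> elts \<kappa> = elts c"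
        "M \<inter> \<Omega> = elts (happ C c)"
      unfolding guessing_set_def by blast
    have cl: "F \<eta> \<in> elts c" "g \<eta> \<in> M" if \<eta>: "\<eta> \<in> elts c" for \<eta>
    proof -
      have \<eta>\<kappa>: "\<eta> \<in> elts \<kappa>" "\<eta> \<in> M"
        using M(3) \<eta> by blast+
      have "F \<eta> \<in> M \<and> g \<eta> \<in> M"
        by (rule elem_submodel_closed[OF M(1) FH gH _ \<eta>\<kappa>]) (use M(2) in \<open>simp_all add: p_def\<close>)
      then show "F \<eta> \<in> elts c" "g \<eta> \<in> M"
        using M(3) F \<eta>\<kappa>(1) by blast+
    qed
    define X where "X = elts (happ C c)"
    have X\<Omega>: "X \<subseteq> \<Omega>"
      unfolding X_def using M(4) by blast
    \<comment> \<open>Below \<open>c\<close> the guess is complete: the index of \<open>w\<close> is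
      in \<open>F d\<close>, which is below \<open>c\<close>, so the index is in \<open>M\<close>,
      and so is its value \<open>w\<close> under \<open>g\<close>.\<close>
    have inX: "w \<in> X" if w: "w \<in> \<Omega>" "w \<in> L d" "d \<in> elts c" for w d
    proof -
      have "d \<in> elts \<kappa>"
        using below_trans[OF c\<kappa> w(3)] .
      then have "idx w \<in> elts (F d)"
        using F w by blast
      then have "idx w \<in> elts c"
        using Ord_trans[OF Ord_below[OF c\<kappa>] cl(1)[OF w(3)]] by blast
      then have "g (idx w) \<in> M"
        using cl(2) by blast
      then show ?thesis
        unfolding X_def using M(4) idx w(1) by auto
    qed
    define N where "N = stepf {u \<in> T. hdom u \<subseteq> elts c} b c X"
    \<comment> \<open>Since \<open>c\<close> is closed under \<open>F\<close>, level
      \<open>G b\<close> is available below \<open>c\<close>. Nodes avoiding \<Omega> there avoid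
      \<open>X\<close> too, which triggers the second clause of \<open>stepspec\<close>.\<close>
    have "G b \<in> elts c"
      using Ord_trans[OF Ord_below[OF c\<kappa>] cl(1)[OF bc]] F b\<kappa> by blast
    moreover have "b \<in> elts (G b)" "\<forall>y\<in>L b. \<exists>z\<in>L (G b). y \<le> z \<and> z \<notin> \<Omega>"
      using G b\<kappa> by blast+
    then have "b \<in> elts (G b)" "\<forall>y\<in>L b. \<exists>z\<in>L (G b). y \<le> z \<and> z \<notin> X"
      using X\<Omega> by blast+
    ultimately have ante: "\<exists>g\<in>elts c. b \<in> elts g \<and> (\<forall>y\<in>L b. \<exists>z\<in>L g. y \<le> z \<and> z \<notin> X)"
      by blast
    have "stepspec {u \<in> T. hdom u \<subseteq> elts c} b c X N"
      unfolding N_def by (rule stepf_stepspec[OF c\<kappa> bc normal[OF c\<kappa>]])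
    then have "\<exists>g\<in>elts c. b \<in> elts g \<and> (\<forall>y\<in>L b. hrestrict (N y) g \<notin> X)"
      unfolding stepspec_L[OF c\<kappa> bc] using ante by (elim conjE mp)
    then obtain g0 where g0: "g0 \<in> elts c" "b \<in> elts g0" "\<forall>y\<in>L b. hrestrict (N y) g0 \<notin> X"
      by blast
    have g0\<alpha>: "g0 \<in> elts \<alpha>"
      using Ord_trans[OF ord\<alpha> c\<alpha> g0(1)] .
    have "hrestrict t g0 \<notin> \<Omega>" if t: "t \<in> J" for t
    proof
      assume neg: "hrestrict t g0 \<in> \<Omega>"
      have tL: "t \<in> L \<alpha>"
        using J t by blast
      have "e t \<in> elts b"
        using \<xi>(2) t \<xi>\<epsilon>(1) Ord_trans[OF ordC[OF bC]] by blast
      then have "e t \<le> b"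
        using Ord_in_imp_le[OF ordC[OF bC]] by blast
      moreover have "elts c \<subseteq> hdom t"
        using L_hdom[OF \<alpha>(4) tL] Ord_trans[OF ord\<alpha> c\<alpha>] by blast
      \<comment> \<open>As \<open>t\<close> follows \<open>C\<close> from a point not after
        \<open>b\<close>, its step from \<open>b\<close> to \<open>c\<close> was taken by
        \<open>N\<close>.\<close>
      ultimately have "hrestrict t c = N (hrestrict t b)"
        using e t c unfolding follows_def N_def X_def by blast
      moreover have "hrestrict t b \<in> L b"
        using L_restrict[OF \<alpha>(4) tL] bC club(3) by blast
      ultimately have "hrestrict (hrestrict t c) g0 \<notin> X"
        using g0(3) by simp
      moreover have "hrestrict (hrestrict t c) g0 = hrestrict t g0"
        using L_hrestrict_hrestrict[OF \<alpha>(4) tL] Ord_in_imp_le[OF Ord_below[OF c\<kappa>] g0(1)] by blast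
      moreover have "hrestrict t g0 \<in> L g0"
        using L_restrict[OF \<alpha>(4) tL g0\<alpha>] .
      ultimately show False
        using inX[OF neg _ g0(1)] by simp
    qed
    moreover have "\<epsilon> \<in> elts g0"
      using Ord_trans[OF Ord_in[OF Ord_below[OF c\<kappa>] g0(1)] g0(2)] \<xi>\<epsilon>(2) by blast
    ultimately show "\<exists>g\<in>elts \<alpha>. \<epsilon> \<in> elts g \<and> (\<forall>t\<in>J. hrestrict t g \<notin> \<Omega>)"
      using g0\<alpha> by blast
  qed
  then show thesis
    by (intro that[OF \<alpha>(4,5)]) blast
qed

subsection \<open>Properties of the tree\<close>

lemma in_T: "\<alpha> \<in> elts \<kappa> \<Longrightarrow> t \<in> L \<alpha> \<Longrightarrow> t \<in> T"
  unfolding T_def by blast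

lemma T_E:
  assumes "t \<in> T"
  obtains \<alpha> where "\<alpha> \<in> elts \<kappa>" "t \<in> L \<alpha>"
  using assms unfolding T_def by blast

lemma level_T: "level \<kappa> T \<alpha> = (if \<alpha> \<in> elts \<kappa> then L \<alpha> else {})"
proof -
  have "t \<in> level \<kappa> T \<alpha> \<longleftrightarrow> \<alpha> \<in> elts \<kappa> \<and> t \<in> L \<alpha>" for t
  proof
    assume "t \<in> level \<kappa> T \<alpha>"
    then have "t \<in> T" "hdom t = elts \<alpha>"
      unfolding level_def using seqs_hdom by blast+
    then show "\<alpha> \<in> elts \<kappa> \<and> t \<in> L \<alpha>"
      using T_hdom by blast
  next
    assume "\<alpha> \<in> elts \<kappa> \<and> t \<in> L \<alpha>"
    then show "t \<in> level \<kappa> T \<alpha>"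
      unfolding level_def using in_T L_seqs by blast
  qed
  then show ?thesis
    by auto
qed

lemma level_L: "\<alpha> \<in> elts \<kappa> \<Longrightarrow> level \<kappa> T \<alpha> = L \<alpha>"
  by (simp add: level_T)

lemma streamlined_T: "streamlined \<kappa> T"
  unfolding streamlined_def
proof (intro conjI ballI allI impI)
  show "T \<subseteq> seqs_below \<kappa> (hered \<kappa>)"
    unfolding T_def seqs_below_def using L_seqs by blast
  fix t \<beta>
  assume t: "t \<in> T" and \<beta>: "Ord (\<beta> :: 'k hset)"
  obtain \<alpha> where \<alpha>: "\<alpha> \<in> elts \<kappa>" "t \<in> L \<alpha>"
    using T_E t by blast
  show "hrestrict t \<beta> \<in> T"
  proof (cases "\<beta> \<le> \<alpha>")
    case True
    then have "hrestrict t \<beta> \<in> L \<beta>" "\<beta> \<in> elts \<kappa>"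
      using L_restrict_le[OF \<alpha> \<beta>] Ord_le_in[OF Ord_\<kappa> \<beta> _ \<alpha>(1)] by blast+
    then show ?thesis
      using in_T by blast
  next
    case False
    then have "\<alpha> \<le> \<beta>"
      using Ord_le_linear[OF Ord_below[OF \<alpha>(1)] \<beta>] by blast
    then have "hrestrict t \<beta> = t"
      using hrestrict_id L_seqs \<alpha> by blast
    then show ?thesis
      using t by simp
  qed
qed

lemma height_T: "tree_height \<kappa> T = \<kappa>"
  unfolding tree_height_def
proof (rule Least_equality)
  show "Ord \<kappa> \<and> level \<kappa> T \<kappa> = {}"
    using Ord_\<kappa> by (simp add: level_T elts_irrefl)
  fix \<alpha>
  assume \<alpha>: "Ord \<alpha> \<and> level \<kappa> T \<alpha> = {}"
  then have "\<alpha> \<notin> elts \<kappa>"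
    using level_L L_nonempty by blast
  then show "\<kappa> \<le> \<alpha>"
    using Ord_not_le Ord_\<kappa> \<alpha> by blast
qed

lemma normal_T: "tree_normal \<kappa> T"
  unfolding tree_normal_def
proof (intro ballI impI)
  fix \<beta> \<alpha> s
  assume \<beta>: "\<beta> \<in> elts \<kappa>" and \<alpha>: "\<alpha> \<in> elts \<beta>" and s: "s \<in> level \<kappa> T \<alpha>"
  have \<alpha>\<kappa>: "\<alpha> \<in> elts \<kappa>"
    using below_trans[OF \<beta> \<alpha>] .
  have sL: "s \<in> L \<alpha>"
    using s level_L[OF \<alpha>\<kappa>] by simp
  obtain t where t: "t \<in> L \<beta>" "s \<le> t"
    using L_extend[OF \<beta> \<alpha>\<kappa> Ord_in_imp_le[OF Ord_below[OF \<beta>] \<alpha>] sL] by blast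
  then have "s < t"
    using L_less_iff[OF \<beta> _ \<alpha>\<kappa> sL] L_le_iff[OF \<beta> _ \<alpha>\<kappa> sL] \<alpha> by blast
  then show "\<exists>t\<in>level \<kappa> T \<beta>. s < t"
    using t(1) level_L[OF \<beta>] by blast
qed

lemma snoc_L: "\<alpha> \<in> elts \<kappa> \<Longrightarrow> y \<in> L \<alpha> \<Longrightarrow> i \<in> succ_vals \<alpha> \<Longrightarrow> snoc \<alpha> y i \<in> L (osucc \<alpha>)"
  using L_succ by blast

lemma ord_of_nat_lam: "ord_of_nat n \<in> elts lam"
proof -
  have "Ord (ord_of_nat n :: 'k hset) \<and> finite (elts (ord_of_nat n :: 'k hset))"
    by (induction n) (simp_all add: Ord_zero Ord_osucc)
  then show ?thesis
    using finite_Ord_lam by blast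
qed

lemma prolific_T: "tree_prolific \<kappa> T"
  unfolding tree_prolific_def
proof (intro ballI subsetI)
  fix \<alpha> t z
  assume \<alpha>: "\<alpha> \<in> elts \<kappa>" and t: "t \<in> level \<kappa> T \<alpha>"
    and z: "z \<in> {snoc \<alpha> t i | i. i \<in> range ord_of_nat \<union> elts \<alpha>}"
  obtain i where i: "z = snoc \<alpha> t i" "i \<in> range ord_of_nat \<union> elts \<alpha>"
    using z by blast
  have "i \<in> succ_vals \<alpha>"
    using i(2) ord_of_nat_lam unfolding succ_vals_def by blast
  then show "z \<in> level \<kappa> T (osucc \<alpha>)"
    unfolding i(1) level_L[OF osucc_\<kappa>[OF \<alpha>]] using snoc_L[OF \<alpha>] t level_L[OF \<alpha>] by blast
qed

lemma less_snoc: "\<alpha> \<in> elts \<kappa> \<Longrightarrow> y \<in> L \<alpha> \<Longrightarrow> i \<in> succ_vals \<alpha> \<Longrightarrow> y < snoc \<alpha> y i"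
  using L_less_iff[OF osucc_\<kappa> snoc_L] hrestrict_snoc L_seqs by (metis elts_osucc insertI1 subsetD)

lemma splitting_T: "tree_splitting \<sigma> T"
  unfolding tree_splitting_def
proof
  fix x
  assume "x \<in> T"
  then obtain \<alpha> where \<alpha>: "\<alpha> \<in> elts \<kappa>" "x \<in> L \<alpha>"
    using T_E by blast
  have xs: "x \<in> seqs \<alpha> (hered \<kappa>)"
    using L_seqs \<alpha> by blast
  have "inj_on (snoc \<alpha> x) (elts \<sigma>)"
    by (rule inj_onI) (use snoc_inject[OF xs xs] in blast)
  moreover have "snoc \<alpha> x i \<in> imm_succs T x" if "i \<in> elts \<sigma>" for i
  proof -
    have i: "i \<in> succ_vals \<alpha>"
      using that unfolding succ_vals_def by blast
    have "\<not> (x < z \<and> z < snoc \<alpha> x i)" if z: "z \<in> T" for z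
    proof
      assume xz: "x < z \<and> z < snoc \<alpha> x i"
      obtain \<gamma> where \<gamma>: "\<gamma> \<in> elts \<kappa>" "z \<in> L \<gamma>"
        using T_E z by blast
      have "\<alpha> \<in> elts \<gamma>"
        using L_less_iff[OF \<gamma> \<alpha>] xz by blast
      moreover have "\<gamma> \<in> elts (osucc \<alpha>)"
        using L_less_iff[OF osucc_\<kappa>[OF \<alpha>(1)] snoc_L[OF \<alpha> i] \<gamma>] xz by blast
      ultimately show False
        using Ord_trans[OF Ord_below[OF \<alpha>(1)]] elts_irrefl by auto
    qed
    then show ?thesis
      unfolding imm_succs_def using less_snoc[OF \<alpha> i] in_T[OF osucc_\<kappa>[OF \<alpha>(1)] snoc_L[OF \<alpha> i]] by blast
  qed
  ultimately show "elts \<sigma> \<lesssim> imm_succs T x"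
    unfolding lepoll_def by blast
qed

text \<open>If the sequence has a largest term, that term is the union. Otherwise the lengths have
  no maximum, and their supremum \<alpha> is a limit of cofinality at most \<delta> < \<chi>, where
  every branch is a node.\<close>

lemma complete_T: "tree_complete \<chi> T"
  unfolding tree_complete_def
proof (intro ballI impI)
  fix \<delta> s
  assume \<delta>: "\<delta> \<in> elts \<chi>" and s: "s \<in> elts \<delta> \<rightarrow> T" and inc: "\<forall>j\<in>elts \<delta>. \<forall>i\<in>elts j. s i < s j"
  have \<delta>\<kappa>: "\<delta> \<in> elts \<kappa>"
    using below_trans[OF \<chi>_\<kappa> \<delta>] .
  have ord\<delta>: "Ord \<delta>"
    using Ord_below[OF \<delta>\<kappa>] .
  let ?u = "\<Union>i\<in>elts \<delta>. elts (s i)"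
  have "\<forall>i\<in>elts \<delta>. \<exists>\<alpha>. \<alpha> \<in> elts \<kappa> \<and> s i \<in> L \<alpha>"
    using s T_E by blast
  from bchoice[OF this] obtain l where l: "\<forall>i\<in>elts \<delta>. l i \<in> elts \<kappa> \<and> s i \<in> L (l i)"
    by blast
  have l\<kappa>: "l i \<in> elts \<kappa>" and sL: "s i \<in> L (l i)" if "i \<in> elts \<delta>" for i
    using l that by blast+
  consider "elts \<delta> = {}" | j where "j \<in> elts \<delta>" "\<forall>i\<in>elts \<delta>. s i \<le> s j"
    | "elts \<delta> \<noteq> {}" "\<forall>j\<in>elts \<delta>. \<exists>i\<in>elts \<delta>. \<not> s i \<le> s j"
    by blast
  then show "set_of ?u \<in> T"
  proof cases
    case 1
    then have "set_of ?u = set_of {}"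
      by simp
    then show ?thesis
      using in_T[OF zero_\<kappa>] L_zero by simp
  next
    case 2
    then have "?u = elts (s j)"
      unfolding less_eq_hset_def by blast
    then have "set_of ?u = s j"
      by simp
    then show ?thesis
      using in_T l\<kappa> sL 2(1) by metis
  next
    case 3
    have up: "\<exists>i\<in>elts \<delta>. l j \<in> elts (l i)" if j: "j \<in> elts \<delta>" for j
    proof -
      obtain i where i: "i \<in> elts \<delta>" "\<not> s i \<le> s j"
        using 3(2) j by blast
      then have "i \<notin> elts j" "i \<noteq> j"
        using inc j less_imp_le[of "s i" "s j"] by (blast, blast)
      then have "j \<in> elts i"
        using Ord_linear[of i j] ord\<delta> Ord_in i(1) j by blast
      then have "s j < s i"
        using inc i(1) by blast
      then have "l j \<in> elts (l i)"
        using L_less_iff[OF l\<kappa>[OF i(1)] sL[OF i(1)] l\<kappa>[OF j] sL[OF j]] by blast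
      then show ?thesis
        using i(1) by blast
    qed
    obtain \<xi> where \<xi>: "\<xi> \<in> elts \<kappa>" "\<forall>i\<in>elts \<delta>. l i \<in> elts \<xi>"
      using bounded_\<kappa>[OF elts_lesspoll_\<kappa>[OF \<delta>\<kappa>], of l] l\<kappa> by blast
    have sub: "l ` elts \<delta> \<subseteq> elts \<xi>"
      using \<xi>(2) by blast
    define \<alpha> where "\<alpha> = osup (l ` elts \<delta>)"
    have el\<alpha>: "elts \<alpha> = (\<Union>i\<in>elts \<delta>. elts (l i))"
      unfolding \<alpha>_def elts_osup[OF Ord_below[OF \<xi>(1)] sub] by blast
    have ord\<alpha>: "Ord \<alpha>"
      unfolding \<alpha>_def by (rule Ord_osup[OF Ord_below[OF \<xi>(1)] sub])
    have "\<alpha> \<le> \<xi>"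
      unfolding less_eq_hset_def el\<alpha> using \<xi> Ord_trans[OF Ord_below[OF \<xi>(1)]] by blast
    then have \<alpha>\<kappa>: "\<alpha> \<in> elts \<kappa>"
      using Ord_le_in[OF Ord_\<kappa> ord\<alpha> _ \<xi>(1)] by blast
    have l\<alpha>: "l i \<in> elts \<alpha>" if "i \<in> elts \<delta>" for i
      unfolding el\<alpha> using up[OF that] by blast
    have lim: "limit \<alpha>"
      unfolding limit_def
    proof (intro conjI ballI)
      show "Ord \<alpha>"
        by (fact ord\<alpha>)
      show "elts \<alpha> \<noteq> {}"
        using 3(1) l\<alpha> by blast
      show "\<exists>\<eta>\<in>elts \<alpha>. \<zeta> \<in> elts \<eta>" if "\<zeta> \<in> elts \<alpha>" for \<zeta>
        using that l\<alpha> unfolding el\<alpha>[THEN eq_reflection] by blast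
    qed
    have "cf \<alpha> \<le> \<delta>"
    proof (rule cf_le[OF ord\<delta>])
      show "l \<in> elts \<delta> \<rightarrow> elts \<alpha>"
        using l\<alpha> by blast
      show "\<forall>\<zeta>\<in>elts \<alpha>. \<exists>i\<in>elts \<delta>. \<zeta> \<le> l i"
      proof
        fix \<zeta>
        assume "\<zeta> \<in> elts \<alpha>"
        then obtain i where i: "i \<in> elts \<delta>" "\<zeta> \<in> elts (l i)"
          unfolding el\<alpha> by blast
        then show "\<exists>i\<in>elts \<delta>. \<zeta> \<le> l i"
          using Ord_in_imp_le[OF Ord_below[OF l\<kappa>]] by blast
      qed
    qed
    moreover have "\<delta> < \<chi>"
      using Ord_less_iff[OF ord\<delta> Ord_below[OF \<chi>_\<kappa>]] \<delta> by blast
    ultimately have cf: "cf \<alpha> < \<chi>"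
      by simp
    have comp: "hrestrict (s j) (l i) = s i" if ij: "i \<in> elts \<delta>" "j \<in> elts \<delta>" "l i \<in> elts (l j)" for i j
    proof -
      have "i \<noteq> j"
        using ij elts_irrefl by blast
      then consider "i \<in> elts j" | "j \<in> elts i"
        using Ord_linear[of i j] ord\<delta> Ord_in ij by blast
      then show ?thesis
      proof cases
        case 1
        then have "s i < s j"
          using inc that by blast
        then show ?thesis
          using L_less_iff[OF l\<kappa> sL l\<kappa> sL] that by blast
      next
        case 2
        then have "s j < s i"
          using inc that by blast
        then have "l j \<in> elts (l i)"
          using L_less_iff[OF l\<kappa> sL l\<kappa> sL] that by blast
        then show ?thesis
          using that(3) Ord_trans[OF Ord_below[OF l\<kappa>[OF that(1)]]] elts_irrefl by blast
      qed
    qed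
    define r where "r d = (SOME i. i \<in> elts \<delta> \<and> l i = d)" for d
    have r: "r d \<in> elts \<delta>" "l (r d) = d" if d: "d \<in> l ` elts \<delta>" for d
    proof -
      have "\<exists>i. i \<in> elts \<delta> \<and> l i = d"
        using d by blast
      then have "r d \<in> elts \<delta> \<and> l (r d) = d"
        unfolding r_def by (rule someI_ex)
      then show "r d \<in> elts \<delta>" "l (r d) = d"
        by auto
    qed
    have "\<exists>t\<in>seqs \<alpha> (hered \<kappa>). \<forall>d\<in>l ` elts \<delta>. hrestrict t d = s (r d)"
    proof (rule seqs_union[OF ord\<alpha>])
      show "l ` elts \<delta> \<subseteq> elts \<alpha>"
        using l\<alpha> by blast
      show "\<forall>\<zeta>\<in>elts \<alpha>. \<exists>d\<in>l ` elts \<delta>. \<zeta> \<in> elts d"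
        unfolding el\<alpha> by blast
      show "s (r d) \<in> seqs d (hered \<kappa>)" if "d \<in> l ` elts \<delta>" for d
        using L_seqs[OF l\<kappa>[OF r(1)[OF that]]] sL[OF r(1)[OF that]] r(2)[OF that] by auto
      show "hrestrict (s (r d')) d = s (r d)" if "d \<in> l ` elts \<delta>" "d' \<in> l ` elts \<delta>" "d \<in> elts d'" for d d'
        using comp[OF r(1)[OF that(1)] r(1)[OF that(2)]] r(2)[OF that(1)] r(2)[OF that(2)] that(3) by simp
    qed
    then obtain t where t: "t \<in> seqs \<alpha> (hered \<kappa>)" "\<forall>d\<in>l ` elts \<delta>. hrestrict t d = s (r d)"
      by blast
    \<comment> \<open>Two terms of equal length cannot be strictly comparable, so the choice of an
      index by \<open>r\<close> does not matter.\<close>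
    have inj: "s (r (l i)) = s i" if i: "i \<in> elts \<delta>" for i
    proof (rule ccontr)
      assume neq: "s (r (l i)) \<noteq> s i"
      have li: "l i \<in> l ` elts \<delta>"
        using i by blast
      have ri: "r (l i) \<in> elts \<delta>" "l (r (l i)) = l i"
        using r[OF li] by blast+
      have "r (l i) \<noteq> i"
        using neq by auto
      then have "r (l i) \<in> elts i \<or> i \<in> elts (r (l i))"
        using Ord_linear[OF Ord_in[OF ord\<delta> i] Ord_in[OF ord\<delta> ri(1)]] by auto
      then have "s (r (l i)) < s i \<or> s i < s (r (l i))"
        using bspec[OF inc i] bspec[OF inc ri(1)] by blast
      then have "l i \<in> elts (l i)"
        using L_less_iff[OF l\<kappa>[OF i] sL[OF i] l\<kappa>[OF ri(1)] sL[OF ri(1)]]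
          L_less_iff[OF l\<kappa>[OF ri(1)] sL[OF ri(1)] l\<kappa>[OF i] sL[OF i]] ri(2) by auto
      then show False
        using elts_irrefl by blast
    qed
    have ts: "hrestrict t (l i) = s i" if i: "i \<in> elts \<delta>" for i
      using t(2) inj[OF i] i by simp
    have "t \<in> L \<alpha>"
    proof -
      have "hrestrict t \<beta> \<in> L \<beta>" if \<beta>: "\<beta> \<in> elts \<alpha>" for \<beta>
      proof -
        obtain i where i: "i \<in> elts \<delta>" "\<beta> \<in> elts (l i)"
          using \<beta> unfolding el\<alpha> by blast
        have "\<beta> \<le> l i"
          using Ord_in_imp_le[OF Ord_below[OF l\<kappa>[OF i(1)]] i(2)] .
        then have "hrestrict t \<beta> = hrestrict (s i) \<beta>"
          using hrestrict_hrestrict[OF _ seqs_hfun[OF t(1)]] ts[OF i(1)] by metis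
        then show ?thesis
          using L_restrict[OF l\<kappa>[OF i(1)] sL[OF i(1)] i(2)] by simp
      qed
      then show ?thesis
        using L_limit[OF \<alpha>\<kappa> lim] t(1) cf by blast
    qed
    moreover have "set_of ?u = t"
    proof -
      have "?u \<subseteq> elts t"
      proof (rule UN_least)
        fix i
        assume "i \<in> elts \<delta>"
        then show "elts (s i) \<subseteq> elts t"
          using ts hrestrict_le[of t "l i"] unfolding less_eq_hset_def by simp
      qed
      moreover have "elts t \<subseteq> ?u"
      proof
        fix z
        assume z: "z \<in> elts t"
        then obtain x y where xy: "z = hpair x y"
          using seqs_hfun[OF t(1)] unfolding hfun_def by blast
        then have "x \<in> elts \<alpha>"
          using z seqs_hdom[OF t(1)] unfolding hdom_def by blast
        then obtain i where i: "i \<in> elts \<delta>" "x \<in> elts (l i)"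
          unfolding el\<alpha> by blast
        have "z \<in> elts (hrestrict t (l i))"
          using hrestrict_mem' i(2) z xy by blast
        then show "z \<in> ?u"
          using ts[OF i(1)] i(1) by auto
      qed
      ultimately have "?u = elts t"
        by blast
      then show ?thesis
        by simp
    qed
    ultimately show ?thesis
      using in_T[OF \<alpha>\<kappa>] by simp
  qed
qed

section \<open>Antichains, branches, ascending paths and automorphisms\<close>

lemma large_subset_above:
  assumes A: "A \<subseteq> T" "A \<approx> elts \<kappa>" and \<alpha>: "\<alpha> \<in> elts \<kappa>"
  shows "\<exists>\<delta>\<in>elts \<kappa>. \<alpha> \<in> elts \<delta> \<and> (\<exists>a\<in>A. a \<in> L \<delta>)"
proof (rule ccontr)
  assume neg: "\<not> ?thesis"
  have "A \<subseteq> (\<Union>\<beta>\<in>elts (osucc \<alpha>). L \<beta>)"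
  proof
    fix a
    assume a: "a \<in> A"
    then obtain \<delta> where \<delta>: "\<delta> \<in> elts \<kappa>" "a \<in> L \<delta>"
      using A(1) T_E by blast
    then have "\<alpha> \<notin> elts \<delta>"
      using neg a by blast
    then have "\<delta> \<in> elts (osucc \<alpha>)"
      using Ord_linear[OF Ord_below[OF \<alpha>] Ord_below[OF \<delta>(1)]] by auto
    then show "a \<in> (\<Union>\<beta>\<in>elts (osucc \<alpha>). L \<beta>)"
      using \<delta>(2) by blast
  qed
  then have "A \<lesssim> (\<Union>\<beta>\<in>elts (osucc \<alpha>). L \<beta>)"
    by (rule subset_imp_lepoll)
  moreover have "(\<Union>\<beta>\<in>elts (osucc \<alpha>). L \<beta>) \<prec> elts \<kappa>"
    by (rule UN_L_small[OF osucc_\<kappa>[OF \<alpha>]]) (use L_small below_trans[OF osucc_\<kappa>[OF \<alpha>]] in blast)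
  ultimately have "A \<prec> elts \<kappa>"
    by (rule lesspoll_trans1)
  then show False
    using A(2) unfolding lesspoll_def by blast
qed

lemma sing_lepoll: "{t} \<lesssim> elts (osucc (set_of {} :: 'k hset))"
  unfolding elts_osucc by (rule singleton_lepoll)

text \<open>\<Omega> consists of the nodes that lie below \<open>A\<close> and have not yet passed
  an element of \<open>A\<close>. It can be left above any node, by climbing past an element of
  \<open>A\<close> where there is one. An \<open>a\<close> in \<open>A\<close> above the sealed
  level has an initial segment outside \<Omega>, so a member of \<open>A\<close> lies strictly below
  \<open>a\<close>.\<close>

lemma no_large_antichain: "\<not> (\<exists>A. tree_antichain T A \<and> A \<approx> elts \<kappa>)"
proof
  assume "\<exists>A. tree_antichain T A \<and> A \<approx> elts \<kappa>"
  then obtain A where A: "A \<subseteq> T" "\<forall>x\<in>A. \<forall>y\<in>A. \<not> x < y" "A \<approx> elts \<kappa>"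
    unfolding tree_antichain_def by blast
  define \<Omega> where "\<Omega> = {z \<in> T. (\<exists>a\<in>A. z \<le> a) \<and> \<not> (\<exists>a\<in>A. a \<le> z)}"
  have dense: "\<exists>g\<in>elts \<kappa>. \<alpha> \<in> elts g \<and> (\<forall>y\<in>L \<alpha>. \<exists>z\<in>L g. y \<le> z \<and> z \<notin> \<Omega>)" if \<alpha>: "\<alpha> \<in> elts \<kappa>" for \<alpha>
  proof -
    have "\<forall>y\<in>L \<alpha>. \<exists>\<gamma>. \<gamma> \<in> elts \<kappa> \<and> ((\<exists>a\<in>A. y \<le> a) \<longrightarrow> (\<exists>a\<in>A. y \<le> a \<and> a \<in> L \<gamma>))"
    proof
      fix y
      assume "y \<in> L \<alpha>"
      show "\<exists>\<gamma>. \<gamma> \<in> elts \<kappa> \<and> ((\<exists>a\<in>A. y \<le> a) \<longrightarrow> (\<exists>a\<in>A. y \<le> a \<and> a \<in> L \<gamma>))"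
      proof (cases "\<exists>a\<in>A. y \<le> a")
        case True
        then obtain a where a: "a \<in> A" "y \<le> a"
          by blast
        then obtain \<gamma> where "\<gamma> \<in> elts \<kappa>" "a \<in> L \<gamma>"
          using A(1) T_E by blast
        then show ?thesis
          using a by blast
      next
        case False
        then show ?thesis
          using \<alpha> by blast
      qed
    qed
    from bchoice[OF this] obtain l where
      l: "\<forall>y\<in>L \<alpha>. l y \<in> elts \<kappa> \<and> ((\<exists>a\<in>A. y \<le> a) \<longrightarrow> (\<exists>a\<in>A. y \<le> a \<and> a \<in> L (l y)))"
      by blast
    \<comment> \<open>The levels \<open>l y\<close> are chosen separately for each node; as the
      level \<alpha> is small they have a common bound, so one \<open>g\<close> serves all
      \<open>y\<close>.\<close>
    obtain \<xi> where \<xi>: "\<xi> \<in> elts \<kappa>" "\<forall>y\<in>L \<alpha>. l y \<in> elts \<xi>"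
      using bounded_\<kappa>[OF L_small[OF \<alpha>], of l] l by blast
    obtain g where g: "g \<in> elts \<kappa>" "\<xi> \<in> elts g" "\<alpha> \<in> elts g"
      using bounded_\<kappa>[of "{\<xi>, \<alpha>}" "\<lambda>x. x"] finite_lesspoll_\<kappa>[of "{\<xi>, \<alpha>}"] \<alpha> \<xi>(1) by auto
    have "\<exists>z\<in>L g. y \<le> z \<and> z \<notin> \<Omega>" if y: "y \<in> L \<alpha>" for y
    proof (cases "\<exists>a\<in>A. y \<le> a")
      case True
      then obtain a where a: "a \<in> A" "y \<le> a" "a \<in> L (l y)"
        using l y by blast
      have ly: "l y \<in> elts \<kappa>" "l y \<in> elts g"
        using l y \<xi>(2) Ord_trans[OF Ord_below[OF g(1)] g(2)] by blast+
      obtain z where z: "z \<in> L g" "a \<le> z"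
        using L_extend[OF g(1) ly(1) Ord_in_imp_le[OF Ord_below[OF g(1)] ly(2)] a(3)] by blast
      have "z \<notin> \<Omega>"
        unfolding \<Omega>_def using z(2) a(1) by blast
      then show ?thesis
        using z order_trans[OF a(2) z(2)] by blast
    next
      case False
      obtain z where z: "z \<in> L g" "y \<le> z"
        using L_extend[OF g(1) \<alpha> Ord_in_imp_le[OF Ord_below[OF g(1)] g(3)] y] by blast
      have "z \<notin> \<Omega>"
        unfolding \<Omega>_def using z(2) False order_trans by blast
      then show ?thesis
        using z by blast
    qed
    then show ?thesis
      using g by blast
  qed
  have \<Omega>T: "\<Omega> \<subseteq> T"
    unfolding \<Omega>_def by blast
  obtain \<alpha> where \<alpha>: "\<alpha> \<in> elts \<kappa>" "set_of {} \<in> elts \<alpha>"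
    "\<forall>J. J \<subseteq> L \<alpha> \<and> J \<lesssim> elts (osucc (set_of {} :: 'k hset)) \<longrightarrow> (\<exists>g\<in>elts \<alpha>. set_of {} \<in> elts g \<and> (\<forall>t\<in>J. hrestrict t g \<notin> \<Omega>))"
    by (rule sealing[OF \<Omega>T dense one_lam zero_\<kappa>], assumption, erule (2) that)
  obtain \<delta> a where \<delta>: "\<delta> \<in> elts \<kappa>" "\<alpha> \<in> elts \<delta>" "a \<in> A" "a \<in> L \<delta>"
    using large_subset_above[OF A(1,3) \<alpha>(1)] by blast
  have "{hrestrict a \<alpha>} \<subseteq> L \<alpha> \<and> {hrestrict a \<alpha>} \<lesssim> elts (osucc (set_of {} :: 'k hset))"
    using L_restrict[OF \<delta>(1,4,2)] sing_lepoll by simp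
  from \<alpha>(3)[rule_format, OF this] obtain g where g: "g \<in> elts \<alpha>" "hrestrict (hrestrict a \<alpha>) g \<notin> \<Omega>"
    by blast
  have g\<delta>: "g \<in> elts \<delta>" and g\<alpha>: "g \<le> \<alpha>"
    using Ord_trans[OF Ord_below[OF \<delta>(1)] \<delta>(2) g(1)] Ord_in_imp_le[OF Ord_below[OF \<alpha>(1)] g(1)] by blast+
  have g\<kappa>: "g \<in> elts \<kappa>"
    using below_trans[OF \<alpha>(1) g(1)] .
  have ag: "hrestrict a g \<notin> \<Omega>" "hrestrict a g \<in> L g"
    using g(2) L_hrestrict_hrestrict[OF \<delta>(1,4) g\<alpha>] L_restrict[OF \<delta>(1,4) g\<delta>] by simp_all
  have "hrestrict a g \<in> T" "hrestrict a g \<le> a"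
    using in_T[OF g\<kappa> ag(2)] hrestrict_le by blast+
  then obtain a' where a': "a' \<in> A" "a' \<le> hrestrict a g"
    using ag(1) \<delta>(3) unfolding \<Omega>_def by blast
  moreover have "hrestrict a g < a"
    using L_less_iff[OF \<delta>(1,4) g\<kappa> ag(2)] g\<delta> by blast
  ultimately have "a' < a"
    by (rule_tac order_le_less_trans)
  then show False
    using A(2) a'(1) \<delta>(3) by blast
qed

lemma same_level_eq:
  assumes "\<gamma> \<in> elts \<kappa>" "u \<in> L \<gamma>" "\<beta> \<in> elts \<kappa>" "s \<in> L \<beta>" "t \<in> L \<beta>" "s \<le> u" "t \<le> u"
  shows "s = t"
  using L_le_iff[OF assms(1-4)] L_le_iff[OF assms(1-3,5)] assms(6,7) by simp

lemma zero_one_vals: "set_of {} \<in> succ_vals \<alpha>" "osucc (set_of {}) \<in> succ_vals \<alpha>"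
  unfolding succ_vals_def using zero_lam one_lam by blast+

lemma zero_neq_one: "set_of {} \<noteq> osucc (set_of {} :: 'k hset)"
  by (metis elts_osucc elts_zero insert_not_empty)

text \<open>\<Omega> is the downward closure of the chain. Two immediate successors of a node cannot
  both be in it, so it can always be left; but a member of the chain above the sealed level never
  leaves it.\<close>

lemma no_large_branch: "\<not> (\<exists>b. tree_branch T b \<and> b \<approx> elts \<kappa>)"
proof
  assume "\<exists>b. tree_branch T b \<and> b \<approx> elts \<kappa>"
  then obtain b where b: "b \<subseteq> T" "\<forall>x\<in>b. \<forall>y\<in>b. x < y \<or> x = y \<or> y < x" "b \<approx> elts \<kappa>"
    unfolding tree_branch_def tree_chain_def by blast
  define \<Omega> where "\<Omega> = {z \<in> T. \<exists>u\<in>b. z \<le> u}"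
  have dense: "\<exists>g\<in>elts \<kappa>. \<alpha> \<in> elts g \<and> (\<forall>y\<in>L \<alpha>. \<exists>z\<in>L g. y \<le> z \<and> z \<notin> \<Omega>)" if \<alpha>: "\<alpha> \<in> elts \<kappa>" for \<alpha>
  proof -
    have "\<exists>z\<in>L (osucc \<alpha>). y \<le> z \<and> z \<notin> \<Omega>" if y: "y \<in> L \<alpha>" for y
    proof (rule ccontr)
      assume neg: "\<not> ?thesis"
      let ?z0 = "snoc \<alpha> y (set_of {})" and ?z1 = "snoc \<alpha> y (osucc (set_of {}))"
      have z: "?z0 \<in> L (osucc \<alpha>)" "?z1 \<in> L (osucc \<alpha>)"
        using snoc_L[OF \<alpha> y] zero_one_vals by blast+
      have "y \<le> ?z0" "y \<le> ?z1"
        using less_snoc[OF \<alpha> y] zero_one_vals less_imp_le by blast+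
      then have "?z0 \<in> \<Omega>" "?z1 \<in> \<Omega>"
        using neg z by blast+
      then obtain u0 u1 where u: "u0 \<in> b" "?z0 \<le> u0" "u1 \<in> b" "?z1 \<le> u1"
        unfolding \<Omega>_def by blast
      have "u0 \<le> u1 \<or> u1 \<le> u0"
        using b(2) u(1,3) less_imp_le by blast
      then obtain u where u': "u \<in> b" "?z0 \<le> u" "?z1 \<le> u"
        using u order_trans by blast
      then obtain \<gamma> where "\<gamma> \<in> elts \<kappa>" "u \<in> L \<gamma>"
        using b(1) T_E by blast
      then have "?z0 = ?z1"
        using same_level_eq[OF _ _ osucc_\<kappa>[OF \<alpha>] z] u' by blast
      then show False
        using snoc_inject[of y \<alpha> "hered \<kappa>" y "hered \<kappa>"] L_seqs[OF \<alpha>] y zero_neq_one by blast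
    qed
    moreover have "\<alpha> \<in> elts (osucc \<alpha>)"
      by simp
    ultimately show ?thesis
      using osucc_\<kappa>[OF \<alpha>] by blast
  qed
  have \<Omega>T: "\<Omega> \<subseteq> T"
    unfolding \<Omega>_def by blast
  obtain \<alpha> where \<alpha>: "\<alpha> \<in> elts \<kappa>" "set_of {} \<in> elts \<alpha>"
    "\<forall>J. J \<subseteq> L \<alpha> \<and> J \<lesssim> elts (osucc (set_of {} :: 'k hset)) \<longrightarrow> (\<exists>g\<in>elts \<alpha>. set_of {} \<in> elts g \<and> (\<forall>t\<in>J. hrestrict t g \<notin> \<Omega>))"
    by (rule sealing[OF \<Omega>T dense one_lam zero_\<kappa>], assumption, erule (2) that)
  obtain \<delta> u where \<delta>: "\<delta> \<in> elts \<kappa>" "\<alpha> \<in> elts \<delta>" "u \<in> b" "u \<in> L \<delta>"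
    using large_subset_above[OF b(1,3) \<alpha>(1)] by blast
  have "{hrestrict u \<alpha>} \<subseteq> L \<alpha> \<and> {hrestrict u \<alpha>} \<lesssim> elts (osucc (set_of {} :: 'k hset))"
    using L_restrict[OF \<delta>(1,4,2)] sing_lepoll by simp
  from \<alpha>(3)[rule_format, OF this] obtain g where g: "g \<in> elts \<alpha>" "hrestrict (hrestrict u \<alpha>) g \<notin> \<Omega>"
    by blast
  have g\<delta>: "g \<in> elts \<delta>" and g\<alpha>: "g \<le> \<alpha>"
    using Ord_trans[OF Ord_below[OF \<delta>(1)] \<delta>(2) g(1)] Ord_in_imp_le[OF Ord_below[OF \<alpha>(1)] g(1)] by blast+
  have "hrestrict u g \<notin> \<Omega>" "hrestrict u g \<in> T"
    using g(2) L_hrestrict_hrestrict[OF \<delta>(1,4) g\<alpha>] in_T[OF below_trans[OF \<delta>(1) g\<delta>] L_restrict[OF \<delta>(1,4) g\<delta>]] by simp_all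
  then show False
    unfolding \<Omega>_def using \<delta>(3) hrestrict_le by blast
qed

text \<open>\<Omega> is the set of all nodes on the path. Each level contains at most \<Lambda> many
  of them, while a node has at least \<open>lam\<close> many immediate successors, so \<Omega> can
  be left. Sealing all path nodes of level \<alpha> at one level \<open>g\<close> contradicts the
  comparability of levels \<open>g\<close> and \<alpha> of the path.\<close>

lemma no_ascending_path:
  assumes \<Lambda>: "\<Lambda> \<in> elts lam"
  shows "\<not> (\<exists>f. ascending_path \<kappa> T \<Lambda> f)"
proof
  assume "\<exists>f. ascending_path \<kappa> T \<Lambda> f"
  then obtain f where f: "\<forall>\<alpha>\<in>elts \<kappa>. f \<alpha> \<in> elts \<Lambda> \<rightarrow> level \<kappa> T \<alpha>"
      "\<forall>\<beta>\<in>elts \<kappa>. \<forall>\<alpha>\<in>elts \<beta>. \<exists>i\<in>elts \<Lambda>. \<exists>j\<in>elts \<Lambda>. f \<alpha> i < f \<beta> j"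
    unfolding ascending_path_def by blast
  have fL: "f \<alpha> i \<in> L \<alpha>" if "\<alpha> \<in> elts \<kappa>" "i \<in> elts \<Lambda>" for \<alpha> i
    using f(1) that level_L by blast
  define \<Omega> where "\<Omega> = (\<Union>\<alpha>\<in>elts \<kappa>. f \<alpha> ` elts \<Lambda>)"
  have \<Omega>L: "t \<in> f \<alpha> ` elts \<Lambda>" if t: "t \<in> \<Omega>" "t \<in> L \<alpha>" and \<alpha>: "\<alpha> \<in> elts \<kappa>" for t \<alpha>
  proof -
    obtain \<beta> i where \<beta>: "\<beta> \<in> elts \<kappa>" "i \<in> elts \<Lambda>" "t = f \<beta> i"
      using t(1) unfolding \<Omega>_def by blast
    then have "\<beta> = \<alpha>"
      using L_unique[OF \<beta>(1) \<alpha> _ t(2)] fL by blast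
    then show ?thesis
      using \<beta> by blast
  qed
  have dense: "\<exists>g\<in>elts \<kappa>. \<alpha> \<in> elts g \<and> (\<forall>y\<in>L \<alpha>. \<exists>z\<in>L g. y \<le> z \<and> z \<notin> \<Omega>)" if \<alpha>: "\<alpha> \<in> elts \<kappa>" for \<alpha>
  proof -
    have "\<exists>z\<in>L (osucc \<alpha>). y \<le> z \<and> z \<notin> \<Omega>" if y: "y \<in> L \<alpha>" for y
    proof (rule ccontr)
      assume neg: "\<not> ?thesis"
      have ys: "y \<in> seqs \<alpha> (hered \<kappa>)"
        using L_seqs[OF \<alpha>] y by blast
      have "snoc \<alpha> y i \<in> f (osucc \<alpha>) ` elts \<Lambda>" if "i \<in> elts lam" for i
      proof -
        have i: "i \<in> succ_vals \<alpha>"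
          unfolding succ_vals_def using that by blast
        then have "snoc \<alpha> y i \<in> \<Omega>"
          using neg snoc_L[OF \<alpha> y i] less_imp_le[OF less_snoc[OF \<alpha> y i]] by blast
        then show ?thesis
          using \<Omega>L snoc_L[OF \<alpha> y i] osucc_\<kappa>[OF \<alpha>] by blast
      qed
      then have "snoc \<alpha> y ` elts lam \<subseteq> f (osucc \<alpha>) ` elts \<Lambda>"
        by blast
      moreover have "inj_on (snoc \<alpha> y) (elts lam)"
        by (rule inj_onI) (use snoc_inject[OF ys ys] in blast)
      ultimately have "elts lam \<lesssim> f (osucc \<alpha>) ` elts \<Lambda>"
        unfolding lepoll_def by blast
      then have "elts lam \<lesssim> elts \<Lambda>"
        using lepoll_trans[OF _ image_lepoll] by blast
      \<comment> \<open>As \<open>lam\<close> is a cardinal, its member \<Lambda> has strictly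
        smaller cardinality.\<close>
      then show False
        using lam_card \<Lambda> not_lepoll_iff unfolding inf_card_def Card_def by blast
    qed
    moreover have "\<alpha> \<in> elts (osucc \<alpha>)"
      by simp
    ultimately show ?thesis
      using osucc_\<kappa>[OF \<alpha>] by blast
  qed
  have \<Omega>T: "\<Omega> \<subseteq> T"
    unfolding \<Omega>_def using fL in_T by blast
  obtain \<alpha> where \<alpha>: "\<alpha> \<in> elts \<kappa>" "set_of {} \<in> elts \<alpha>"
    "\<forall>J. J \<subseteq> L \<alpha> \<and> J \<lesssim> elts \<Lambda> \<longrightarrow> (\<exists>g\<in>elts \<alpha>. set_of {} \<in> elts g \<and> (\<forall>t\<in>J. hrestrict t g \<notin> \<Omega>))"
    by (rule sealing[OF \<Omega>T dense \<Lambda> zero_\<kappa>], assumption, erule (2) that)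
  have "f \<alpha> ` elts \<Lambda> \<subseteq> L \<alpha> \<and> f \<alpha> ` elts \<Lambda> \<lesssim> elts \<Lambda>"
    using fL[OF \<alpha>(1)] image_lepoll by blast
  from \<alpha>(3)[rule_format, OF this] obtain g where g: "g \<in> elts \<alpha>" "\<forall>t\<in>f \<alpha> ` elts \<Lambda>. hrestrict t g \<notin> \<Omega>"
    by blast
  have g\<kappa>: "g \<in> elts \<kappa>"
    using below_trans[OF \<alpha>(1) g(1)] .
  obtain i j where ij: "i \<in> elts \<Lambda>" "j \<in> elts \<Lambda>" "f g i < f \<alpha> j"
    using f(2) \<alpha>(1) g(1) by blast
  then have "hrestrict (f \<alpha> j) g = f g i"
    using L_less_iff[OF \<alpha>(1) fL[OF \<alpha>(1)] g\<kappa> fL[OF g\<kappa>]] by blast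
  then have "hrestrict (f \<alpha> j) g \<in> \<Omega>"
    unfolding \<Omega>_def using g\<kappa> ij(1) by auto
  then show False
    using g(2) ij(2) by blast
qed

text \<open>By induction the predecessors of \<open>t\<close> keep their levels, so the image of
  \<open>t\<close> is at least as high as \<open>t\<close>. Were it higher, its restriction to
  \<alpha> would be the image of some \<open>v < t\<close>, which stays on its level below
  \<alpha>.\<close>

lemma automorphism_level:
  assumes bij: "bij_betw \<Phi> T T" and iso: "\<forall>x\<in>T. \<forall>y\<in>T. x < y \<longleftrightarrow> \<Phi> x < \<Phi> y"
  shows "\<alpha> \<in> elts \<kappa> \<Longrightarrow> t \<in> L \<alpha> \<Longrightarrow> \<Phi> t \<in> L \<alpha>"
proof (induction \<alpha> arbitrary: t rule: elts_induct)
  case (step \<alpha>)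
  have tT: "t \<in> T"
    using in_T step.prems by blast
  have "\<Phi> t \<in> T"
    using bij_betwE[OF bij] tT by blast
  then obtain \<beta> where \<beta>: "\<beta> \<in> elts \<kappa>" "\<Phi> t \<in> L \<beta>"
    using T_E by blast
  have IH: "\<Phi> s \<in> L \<gamma>" if "\<gamma> \<in> elts \<alpha>" "s \<in> L \<gamma>" for \<gamma> s
    using step.IH[OF that(1) below_trans[OF step.prems(1) that(1)] that(2)] .
  have "elts \<alpha> \<subseteq> elts \<beta>"
  proof
    fix \<gamma>
    assume \<gamma>: "\<gamma> \<in> elts \<alpha>"
    have \<gamma>\<kappa>: "\<gamma> \<in> elts \<kappa>"
      using below_trans[OF step.prems(1) \<gamma>] .
    have r: "hrestrict t \<gamma> \<in> L \<gamma>"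
      using L_restrict[OF step.prems \<gamma>] .
    then have "hrestrict t \<gamma> < t"
      using L_less_iff[OF step.prems \<gamma>\<kappa> r] \<gamma> by blast
    then have "\<Phi> (hrestrict t \<gamma>) < \<Phi> t"
      using iso tT in_T[OF \<gamma>\<kappa> r] by blast
    then show "\<gamma> \<in> elts \<beta>"
      using L_less_iff[OF \<beta> \<gamma>\<kappa> IH[OF \<gamma> r]] by blast
  qed
  then have "\<alpha> \<le> \<beta>"
    unfolding less_eq_hset_def .
  moreover have "\<alpha> \<notin> elts \<beta>"
  proof
    assume \<alpha>\<beta>: "\<alpha> \<in> elts \<beta>"
    define u where "u = hrestrict (\<Phi> t) \<alpha>"
    have u: "u \<in> L \<alpha>"
      unfolding u_def using L_restrict[OF \<beta> \<alpha>\<beta>] .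
    then have "u < \<Phi> t"
      using L_less_iff[OF \<beta> step.prems(1) u] \<alpha>\<beta> unfolding u_def by blast
    obtain v where v: "v \<in> T" "u = \<Phi> v"
      using bij in_T[OF step.prems(1) u] unfolding bij_betw_def by blast
    then have "v < t"
      using iso tT \<open>u < \<Phi> t\<close> by blast
    obtain \<gamma> where \<gamma>: "\<gamma> \<in> elts \<kappa>" "v \<in> L \<gamma>"
      using T_E v(1) by blast
    then have \<gamma>\<alpha>: "\<gamma> \<in> elts \<alpha>"
      using L_less_iff[OF step.prems \<gamma>] \<open>v < t\<close> by blast
    then have "u \<in> L \<gamma>"
      using IH \<gamma>(2) v(2) by blast
    then have "\<gamma> = \<alpha>"
      using L_unique[OF \<gamma>(1) step.prems(1) _ u] by blast
    then show False
      using \<gamma>\<alpha> elts_irrefl by blast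
  qed
  ultimately have "\<alpha> = \<beta>"
    using Ord_le_iff[OF Ord_below[OF step.prems(1)] Ord_below[OF \<beta>(1)]] by blast
  then show ?case
    using \<beta>(2) by blast
qed

text \<open>If \<open>\<Phi>\<close> moves \<open>x\<close>, seal the set forcing nodes above \<open>x\<close> into \<open>P\<close> and nodes above \<open>\<Phi> x\<close>
  out of \<open>\<Phi> ` P\<close>; a branch through \<open>x\<close> and its image cannot comply simultaneously.\<close>

lemma rigid_T: "tree_rigid T"
  unfolding tree_rigid_def
proof (intro allI impI ballI)
  fix \<Phi> x
  assume \<Phi>: "bij_betw \<Phi> T T \<and> (\<forall>x\<in>T. \<forall>y\<in>T. x < y \<longleftrightarrow> \<Phi> x < \<Phi> y)" and x: "x \<in> T"
  have bij: "bij_betw \<Phi> T T" and iso: "\<forall>x\<in>T. \<forall>y\<in>T. x < y \<longleftrightarrow> \<Phi> x < \<Phi> y"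
    using \<Phi> by blast+
  note lev = automorphism_level[OF bij iso]
  have inj: "s = t" if "s \<in> T" "t \<in> T" "\<Phi> s = \<Phi> t" for s t
    using bij that unfolding bij_betw_def inj_on_def by blast
  have mono: "\<Phi> s \<le> \<Phi> t" if "s \<in> T" "t \<in> T" "s \<le> t" for s t
    using iso that order_le_less by metis
  show "\<Phi> x = x"
  proof (rule ccontr)
    assume moved: "\<Phi> x \<noteq> x"
    obtain \<delta> where \<delta>: "\<delta> \<in> elts \<kappa>" "x \<in> L \<delta>"
      using T_E x by blast
    have \<Phi>x: "\<Phi> x \<in> L \<delta>"
      using lev \<delta> by blast
    \<comment> \<open>\<open>x\<close> and its image are distinct nodes of the same level, so no
      node is above both.\<close>
    have incomp: "\<not> (x \<le> s \<and> \<Phi> x \<le> s)" if sT: "s \<in> T" for s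
    proof
      assume s: "x \<le> s \<and> \<Phi> x \<le> s"
      obtain \<gamma> where "\<gamma> \<in> elts \<kappa>" "s \<in> L \<gamma>"
        using T_E sT by blast
      then show False
        using same_level_eq[OF _ _ \<delta> \<Phi>x] s moved by metis
    qed
    let ?z = "set_of {} :: 'k hset"
    \<comment> \<open>Every node above \<open>x\<close> has exactly one immediate successor in
      \<open>P\<close>. So there is always a way into \<open>P\<close> above \<open>x\<close>, and
      above the image of \<open>x\<close> always a way out of the image of \<open>P\<close>.\<close>
    define P where "P = {snoc \<alpha> y ?z | \<alpha> y. \<alpha> \<in> elts \<kappa> \<and> y \<in> L \<alpha> \<and> x \<le> y}"
    have PE: "\<exists>\<alpha> y. s = snoc \<alpha> y ?z \<and> \<alpha> \<in> elts \<kappa> \<and> y \<in> L \<alpha> \<and> x \<le> y" if "s \<in> P" for s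
      using that unfolding P_def by blast
    have PT: "s \<in> T \<and> x \<le> s" if s: "s \<in> P" for s
    proof -
      obtain \<alpha> y where y: "s = snoc \<alpha> y ?z" "\<alpha> \<in> elts \<kappa>" "y \<in> L \<alpha>" "x \<le> y"
        using PE[OF s] by blast
      show ?thesis
        unfolding y(1) using in_T[OF osucc_\<kappa>[OF y(2)] snoc_L[OF y(2,3) zero_one_vals(1)]]
          less_snoc[OF y(2,3) zero_one_vals(1)] y(4) by auto
    qed
    define \<Omega> where "\<Omega> = \<Phi> ` P \<union> {s \<in> T. x \<le> s \<and> s \<notin> P}"
    have \<Phi>P: "\<Phi> x \<le> s" if s: "s \<in> \<Phi> ` P" for s
      using s PT mono x by blast
    have \<Phi>PT: "s \<in> T" if s: "s \<in> \<Phi> ` P" for s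
      using s PT bij_betwE[OF bij] by blast
    text \<open>A node has at most one immediate successor in \<open>\<Phi> ` P\<close>.\<close>
    have \<Phi>P1: "\<exists>v. v \<in> L \<alpha> \<and> x \<le> v \<and> y = \<Phi> v \<and> s = \<Phi> (snoc \<alpha> v ?z)"
      if s: "s \<in> \<Phi> ` P" "s \<in> L (osucc \<alpha>)" and y: "y \<in> L \<alpha>" "y \<le> s" and \<alpha>: "\<alpha> \<in> elts \<kappa>" for s y \<alpha>
    proof -
      obtain \<beta> v where v: "s = \<Phi> (snoc \<beta> v ?z)" "\<beta> \<in> elts \<kappa>" "v \<in> L \<beta>" "x \<le> v"
        using s(1) PE by blast
      have "s \<in> L (osucc \<beta>)"
        unfolding v(1) using lev[OF osucc_\<kappa>[OF v(2)] snoc_L[OF v(2,3) zero_one_vals(1)]] .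
      then have "osucc \<beta> = osucc \<alpha>"
        using L_unique[OF osucc_\<kappa>[OF v(2)] osucc_\<kappa>[OF \<alpha>] _ s(2)] by blast
      then have \<beta>\<alpha>: "\<beta> = \<alpha>"
        using osucc_inject[OF Ord_below[OF v(2)] Ord_below[OF \<alpha>]] by blast
      have vs: "snoc \<alpha> v ?z \<in> L (osucc \<alpha>)" "v \<le> snoc \<alpha> v ?z"
        using snoc_L[OF v(2,3) zero_one_vals(1)] less_imp_le[OF less_snoc[OF v(2,3) zero_one_vals(1)]]
        unfolding \<beta>\<alpha> by blast+
      have "\<Phi> v \<le> s"
        using mono[OF in_T[OF v(2,3)] in_T[OF osucc_\<kappa>[OF \<alpha>] vs(1)] vs(2)] unfolding v(1) \<beta>\<alpha> .
      then have "y = \<Phi> v"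
        using same_level_eq[OF osucc_\<kappa>[OF \<alpha>] s(2) \<alpha> y(1) _ y(2)] lev[OF v(2,3)] unfolding \<beta>\<alpha> by blast
      then show ?thesis
        using v \<beta>\<alpha> by blast
    qed
    have dense: "\<exists>g\<in>elts \<kappa>. \<alpha> \<in> elts g \<and> (\<forall>y\<in>L \<alpha>. \<exists>z\<in>L g. y \<le> z \<and> z \<notin> \<Omega>)" if \<alpha>: "\<alpha> \<in> elts \<kappa>" for \<alpha>
    proof -
      have "\<exists>z\<in>L (osucc \<alpha>). y \<le> z \<and> z \<notin> \<Omega>" if y: "y \<in> L \<alpha>" for y
      proof -
        let ?s0 = "snoc \<alpha> y ?z" and ?s1 = "snoc \<alpha> y (osucc ?z)"
        have s: "?s0 \<in> L (osucc \<alpha>)" "?s1 \<in> L (osucc \<alpha>)"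
          using snoc_L[OF \<alpha> y] zero_one_vals by blast+
        have ys: "y \<le> ?s0" "y \<le> ?s1"
          using less_snoc[OF \<alpha> y] zero_one_vals less_imp_le by blast+
        have sT: "?s0 \<in> T" "?s1 \<in> T"
          using s in_T[OF osucc_\<kappa>[OF \<alpha>]] by blast+
        have ne: "?s0 \<noteq> ?s1"
          using snoc_inject[of y \<alpha> "hered \<kappa>" y "hered \<kappa>"] L_seqs[OF \<alpha>] y zero_neq_one by blast
        show ?thesis
        \<comment> \<open>Above \<open>x\<close> the successor with label zero avoids \<Omega>: it
          is in \<open>P\<close>, and the image of \<open>P\<close> lies above
          \<open>\<Phi> x\<close>, which is incompatible with \<open>x\<close>.\<close>
        proof (cases "x \<le> y")
          case True
          then have "?s0 \<in> P"
            unfolding P_def using \<alpha> y by blast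
          moreover have "?s0 \<notin> \<Phi> ` P"
            using \<Phi>P incomp[OF sT(1)] order_trans[OF True ys(1)] by blast
          ultimately have "?s0 \<notin> \<Omega>"
            unfolding \<Omega>_def by blast
          then show ?thesis
            using s(1) ys(1) by blast
        next
          case False
          show ?thesis
          proof (rule ccontr)
            assume neg: "\<not> ?thesis"
            have in\<Omega>: "?s0 \<in> \<Omega>" "?s1 \<in> \<Omega>"
              using neg s ys by blast+
            \<comment> \<open>An immediate successor of \<open>y\<close> that is above
              \<open>x\<close>, while \<open>y\<close> is not, can only be \<open>x\<close>
              itself.\<close>
            have cases: "r \<in> \<Phi> ` P \<or> x = r" if r: "r \<in> \<Omega>" "r \<in> L (osucc \<alpha>)" "y \<le> r" for r
            proof (rule disjCI)
              assume "x \<noteq> r"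
              show "r \<in> \<Phi> ` P"
              proof (rule ccontr)
                assume "r \<notin> \<Phi> ` P"
                then have "x \<le> r"
                  using r(1) unfolding \<Omega>_def by blast
                then have "x < r"
                  using \<open>x \<noteq> r\<close> by simp
                then have "\<delta> \<in> elts (osucc \<alpha>)" "hrestrict r \<delta> = x"
                  using L_less_iff[OF osucc_\<kappa>[OF \<alpha>] r(2) \<delta>] by blast+
                then have "\<delta> \<le> \<alpha>"
                  using Ord_in_imp_le[OF Ord_below[OF \<alpha>]] by auto
                moreover have "hrestrict r \<alpha> = y"
                  using L_le_iff[OF osucc_\<kappa>[OF \<alpha>] r(2) \<alpha> y] r(3) by blast
                ultimately have "hrestrict y \<delta> = x"
                  using L_hrestrict_hrestrict[OF osucc_\<kappa>[OF \<alpha>] r(2)] \<open>hrestrict r \<delta> = x\<close> by metis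
                then show False
                  using False hrestrict_le by metis
              qed
            qed
            have not_both: "\<not> (?s0 \<in> \<Phi> ` P \<and> ?s1 \<in> \<Phi> ` P)"
            proof
              assume both: "?s0 \<in> \<Phi> ` P \<and> ?s1 \<in> \<Phi> ` P"
              obtain v where v: "v \<in> L \<alpha>" "y = \<Phi> v" "?s0 = \<Phi> (snoc \<alpha> v ?z)"
                using \<Phi>P1[OF _ s(1) y ys(1) \<alpha>] both by blast
              obtain w where w: "w \<in> L \<alpha>" "y = \<Phi> w" "?s1 = \<Phi> (snoc \<alpha> w ?z)"
                using \<Phi>P1[OF _ s(2) y ys(2) \<alpha>] both by blast
              have "v = w"
                using inj in_T[OF \<alpha>] v w by metis
              then show False
                using v(3) w(3) ne by simp
            qed
            text \<open>One of the two successors is \<open>x\<close>, the other is in \<open>\<Phi> ` P\<close>, so it is above \<open>\<Phi> x\<close>.\<close>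
            then consider "x = ?s0" "?s1 \<in> \<Phi> ` P" | "x = ?s1" "?s0 \<in> \<Phi> ` P"
              using cases[OF in\<Omega>(1) s(1) ys(1)] cases[OF in\<Omega>(2) s(2) ys(2)] ne by metis
            then obtain r where r: "r \<in> \<Phi> ` P" "r \<in> L (osucc \<alpha>)" "y \<le> r" and xs: "x \<in> L (osucc \<alpha>)"
              using s ys by metis
            \<comment> \<open>The successor in the image of \<open>P\<close> stems from a node above
              \<open>x\<close> on level \<alpha>, so \<open>x\<close> has level at most \<alpha>;
              but the other successor, on level \<open>osucc \<alpha>\<close>, is
              \<open>x\<close>.\<close>
            obtain v where v: "v \<in> L \<alpha>" "x \<le> v"
              using \<Phi>P1[OF r(1,2) y r(3) \<alpha>] by blast
            then have "\<delta> \<le> \<alpha>"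
              using L_le_iff[OF \<alpha> v(1) \<delta>] by blast
            moreover have "\<delta> = osucc \<alpha>"
              using L_unique[OF \<delta>(1) osucc_\<kappa>[OF \<alpha>] \<delta>(2) xs] .
            ultimately show False
              using elts_irrefl[of \<alpha>] unfolding less_eq_hset_def by auto
          qed
        qed
      qed
      moreover have "\<alpha> \<in> elts (osucc \<alpha>)"
        by simp
      ultimately show ?thesis
        using osucc_\<kappa>[OF \<alpha>] by blast
    qed
    have \<Omega>T: "\<Omega> \<subseteq> T"
      unfolding \<Omega>_def using \<Phi>PT by blast
    \<comment> \<open>Sealing above \<delta> ensures that the restrictions to \<open>g\<close> are
      still above \<open>x\<close> and \<open>\<Phi> x\<close>; width two covers a node together
      with its image.\<close>
    obtain \<alpha> where \<alpha>: "\<alpha> \<in> elts \<kappa>" "\<delta> \<in> elts \<alpha>"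
      "\<forall>J. J \<subseteq> L \<alpha> \<and> J \<lesssim> elts (osucc (osucc ?z)) \<longrightarrow> (\<exists>g\<in>elts \<alpha>. \<delta> \<in> elts g \<and> (\<forall>t\<in>J. hrestrict t g \<notin> \<Omega>))"
      by (rule sealing[OF \<Omega>T dense two_lam \<delta>(1)], assumption, erule (2) that)
    obtain t where t: "t \<in> L \<alpha>" "x \<le> t"
      using L_extend[OF \<alpha>(1) \<delta>(1) Ord_in_imp_le[OF Ord_below[OF \<alpha>(1)] \<alpha>(2)] \<delta>(2)] by blast
    have \<Phi>t: "\<Phi> t \<in> L \<alpha>"
      using lev[OF \<alpha>(1) t(1)] .
    have "{t, \<Phi> t} \<lesssim> elts (osucc (osucc ?z))"
    proof -
      have "{t, \<Phi> t} = (\<lambda>i. if i = ?z then t else \<Phi> t) ` elts (osucc (osucc ?z))"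
        using zero_neq_one by auto
      then show ?thesis
        using image_lepoll by metis
    qed
    then have "{t, \<Phi> t} \<subseteq> L \<alpha> \<and> {t, \<Phi> t} \<lesssim> elts (osucc (osucc ?z))"
      using t(1) \<Phi>t by simp
    from \<alpha>(3)[rule_format, OF this] obtain g where
      g: "g \<in> elts \<alpha>" "\<delta> \<in> elts g" "\<forall>s\<in>{t, \<Phi> t}. hrestrict s g \<notin> \<Omega>"
      by blast
    have g\<kappa>: "g \<in> elts \<kappa>"
      using below_trans[OF \<alpha>(1) g(1)] .
    define s where "s = hrestrict t g"
    have sL: "s \<in> L g"
      unfolding s_def using L_restrict[OF \<alpha>(1) t(1) g(1)] .
    have "s < t"
      using L_less_iff[OF \<alpha>(1) t(1) g\<kappa> sL] g(1) unfolding s_def by blast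
    then have "\<Phi> s < \<Phi> t"
      using iso in_T[OF g\<kappa> sL] in_T[OF \<alpha>(1) t(1)] by blast
    then have \<Phi>s: "\<Phi> s = hrestrict (\<Phi> t) g"
      using L_less_iff[OF \<alpha>(1) \<Phi>t g\<kappa> lev[OF g\<kappa> sL]] by simp
    have "hrestrict s \<delta> = hrestrict t \<delta>"
      unfolding s_def using L_hrestrict_hrestrict[OF \<alpha>(1) t(1)] Ord_in_imp_le[OF Ord_below[OF g\<kappa>] g(2)] by blast
    then have "hrestrict s \<delta> = x"
      using L_le_iff[OF \<alpha>(1) t(1) \<delta>] t(2) by simp
    then have "x \<le> s"
      using hrestrict_le by metis
    moreover have "s \<notin> \<Omega>"
      unfolding s_def using g(3) by blast
    \<comment> \<open>Being above \<open>x\<close> and outside \<Omega>, the node \<open>s\<close>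
      is in \<open>P\<close>; then its image, a restriction of \<open>\<Phi> t\<close>, is in
      \<Omega> although it was sealed off.\<close>
    ultimately have "s \<in> P"
      unfolding \<Omega>_def using in_T[OF g\<kappa> sL] by blast
    then have "\<Phi> s \<in> \<Omega>"
      unfolding \<Omega>_def by blast
    then show False
      using g(3) \<Phi>s by simp
  qed
qed

lemma souslin_T: "streamlined_souslin \<kappa> T"
  unfolding streamlined_souslin_def
  using streamlined_T height_T L_small level_L no_large_branch no_large_antichain by simp

end

section \<open>Instantiation of the proxy principle\<close>

theorem theorem6p17:
  fixes \<kappa> \<chi> \<sigma> lam :: "'k hset"
  assumes "regular_card \<kappa>" and "uncountable (elts \<kappa>)"
    and "regular_card \<chi>" and "\<chi> \<in> elts \<kappa>" and "lt_closed \<chi> \<kappa>"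
    and "\<sigma> \<in> elts \<kappa>"
    and "inf_card lam" and "lam \<in> elts \<kappa>"
    and "P_bullet \<kappa> \<kappa> (sqsub \<chi>) (ord_of_nat 1)
           {E_ge \<kappa> \<chi> \<inter> E_gt \<kappa> \<Lambda> | \<Lambda>. \<Lambda> \<in> elts lam} (ord_of_nat 2)"
  shows "\<exists>T. streamlined_souslin \<kappa> T \<and> tree_normal \<kappa> T \<and> tree_prolific \<kappa> T \<and>
           tree_splitting \<sigma> T \<and> tree_complete \<chi> T \<and> tree_rigid T \<and>
           (\<forall>\<Lambda>\<in>elts lam. Card \<Lambda> \<longrightarrow> \<not> (\<exists>f. ascending_path \<kappa> T \<Lambda> f))"
proof -
  interpret regular_cardinal \<kappa>
    by unfold_locales (fact assms(1))
  obtain CC B where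
    CC: "\<forall>\<alpha>\<in>acc_pts (elts \<kappa>).
        CC \<alpha> \<subseteq> {C \<in> clubfuns \<kappa>. alpha_of C = \<alpha>} \<and> CC \<alpha> \<noteq> {} \<and> CC \<alpha> \<prec> elts \<kappa> \<and>
        (\<forall>C\<in>CC \<alpha>. \<forall>\<alpha>'\<in>acc_pts (hdom C). \<exists>D\<in>CC \<alpha>'. sqsub \<chi> D C)" and
    guess: "\<forall>\<Omega> p \<iota>. (\<forall>i\<in>elts (ord_of_nat 1). \<Omega> i \<subseteq> hered \<kappa> \<and> p i \<in> hered_plus \<kappa> \<and> \<iota> i \<in> elts \<kappa>) \<longrightarrow>
        (\<forall>S\<in>{E_ge \<kappa> \<chi> \<inter> E_gt \<kappa> \<Lambda> | \<Lambda>. \<Lambda> \<in> elts lam}. \<forall>n::nat.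
          stationary_in
            {\<alpha> \<in> S. CC \<alpha> \<prec> elts (ord_of_nat 2 :: 'k hset) \<and>
              (\<forall>C\<in>CC \<alpha>. \<forall>i\<in>elts \<alpha> \<inter> elts (ord_of_nat 1).
                osup {\<gamma> \<in> hdom C.
                  succ_n n (hdom C - elts \<gamma>) \<subseteq> guessing_set \<kappa> (B (\<iota> i)) (\<Omega> i) (p i) C} = \<alpha>)}
            \<kappa>)"
    using assms(9) unfolding P_bullet_def by - (elim exE conjE, rule that)
  have one: "elts (ord_of_nat 1 :: 'k hset) = {set_of {}}"
    by simp
  have two: "finite (elts (ord_of_nat 2 :: 'k hset))" "card (elts (ord_of_nat 2 :: 'k hset)) \<le> 2"
    by (simp_all add: numeral_2_eq_2 card_insert_if)
  \<comment> \<open>Two distinct members would embed a set of size two into a set of size less than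
    two.\<close>
  have uniq: "C = D" if lt: "A \<prec> elts (ord_of_nat 2 :: 'k hset)" and CD: "C \<in> A" "D \<in> A" for A :: "'k hset set" and C D
  proof (rule ccontr)
    assume ne: "C \<noteq> D"
    have "elts (ord_of_nat 2 :: 'k hset) \<lesssim> {C, D}"
      using two ne by (simp add: lepoll_iff_card_le)
    also have "{C, D} \<lesssim> A"
      using CD by (intro subset_imp_lepoll) blast
    finally show False
      using lt not_lepoll_iff by blast
  qed
  \<comment> \<open>The block \<open>B (set_of {})\<close> corresponds to the constant index zero;
    target and parameter are likewise fed into the principle as constant families.\<close>
  interpret tree_data \<kappa> \<chi> \<sigma> lam CC "B (set_of {})"
  proof
    show "regular_card \<chi>" "\<chi> \<in> elts \<kappa>" "lt_closed \<chi> \<kappa>" "\<sigma> \<in> elts \<kappa>" "inf_card lam" "lam \<in> elts \<kappa>"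
      by (fact assms)+
  next
    fix \<alpha>
    assume "\<alpha> \<in> elts \<kappa>" "limit \<alpha>"
    then show "CC \<alpha> \<subseteq> {C \<in> clubfuns \<kappa>. alpha_of C = \<alpha>} \<and> CC \<alpha> \<noteq> {} \<and> CC \<alpha> \<prec> elts \<kappa> \<and>
      (\<forall>C\<in>CC \<alpha>. \<forall>\<alpha>'\<in>acc_pts (hdom C). \<exists>D\<in>CC \<alpha>'. sqsub \<chi> D C)"
      using CC acc_pts_elts[OF Ord_\<kappa>] by blast
  next
    fix \<Omega> p \<Lambda>
    assume \<Omega>: "\<Omega> \<subseteq> hered \<kappa>" and p: "p \<in> hered_plus \<kappa>" and \<Lambda>: "\<Lambda> \<in> elts lam"
    let ?A = "{\<alpha> \<in> E_ge \<kappa> \<chi> \<inter> E_gt \<kappa> \<Lambda>. CC \<alpha> \<prec> elts (ord_of_nat 2 :: 'k hset) \<and>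
              (\<forall>C\<in>CC \<alpha>. \<forall>i\<in>elts \<alpha> \<inter> elts (ord_of_nat 1).
                osup {\<gamma> \<in> hdom C. succ_n 1 (hdom C - elts \<gamma>) \<subseteq> guessing_set \<kappa> (B (set_of {})) \<Omega> p C} = \<alpha>)}"
    let ?B = "{\<alpha> \<in> E_ge \<kappa> \<chi> \<inter> E_gt \<kappa> \<Lambda>. (\<forall>C\<in>CC \<alpha>. \<forall>D\<in>CC \<alpha>. C = D) \<and>
        (\<forall>C\<in>CC \<alpha>. osup {\<gamma> \<in> hdom C. succ_n 1 (hdom C - elts \<gamma>) \<subseteq> guessing_set \<kappa> (B (set_of {})) \<Omega> p C} = \<alpha>)}"
    have st: "stationary_in ?A \<kappa>"
      using guess[rule_format, of "\<lambda>_. \<Omega>" "\<lambda>_. p" "\<lambda>_. set_of {}" "E_ge \<kappa> \<chi> \<inter> E_gt \<kappa> \<Lambda>" 1] \<Omega> p zero_\<kappa> \<Lambda>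
      by blast
    have "?A \<subseteq> ?B"
    proof
      fix \<alpha>
      assume \<alpha>: "\<alpha> \<in> ?A"
      then have \<alpha>\<kappa>: "\<alpha> \<in> elts \<kappa>" "\<chi> \<le> cf \<alpha>"
        unfolding E_ge_def by blast+
      then have "limit \<alpha>"
        using limit_infinite_cf[OF Ord_in[OF Ord_\<kappa> \<alpha>\<kappa>(1)] _ \<alpha>\<kappa>(2)] assms(3)
        unfolding regular_card_def inf_card_def by blast
      \<comment> \<open>A limit contains zero, so the quantifier over indices below both \<alpha>
        and one is not vacuous and yields the statement for the single target.\<close>
      then have "set_of {} \<in> elts \<alpha>"
        using Ord_linear[OF Ord_zero, of \<alpha>] unfolding limit_def by auto
      then have "set_of {} \<in> elts \<alpha> \<inter> elts (ord_of_nat 1)"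
        unfolding one by blast
      then show "\<alpha> \<in> ?B"
        using \<alpha> uniq[of "CC \<alpha>"] by blast
    qed
    moreover have "?B \<subseteq> elts \<kappa>"
      unfolding E_ge_def by blast
    ultimately show "stationary_in ?B \<kappa>"
      using st unfolding stationary_in_def by blast
  qed
  show ?thesis
    using souslin_T normal_T prolific_T splitting_T complete_T rigid_T no_ascending_path by blast
qed

end
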